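(* The category $\mathbf{F}\mathbf{Dlg}$ of functionally generated (diffeological) spaces and smooth maps is Cartesian closed.
   Context: A diffeological space $X=(|X|,\mathcal{D})$ is a set $|X|$ with a family $\mathcal{D}=\bigcup_U\mathcal{D}_U$, where $U$ ranges over all open subsets of all $\mathbb{R}^n$, $n\in\mathbb{N}$, and $\mathcal{D}_U$ is a set of functions $U\to|X|$ (called plots, or figures of type $U$; one writes $d\in_U X$ for $d\in\mathcal{D}_U$), such that: (i) every constant function $U\to|X|$ is in $\mathcal{D}_U$; (ii) $d\circ f\in\mathcal{D}_V$ for all $d\in\mathcal{D}_U$ and $f\in\mathcal{C}^\infty(V,U)$; (iii) if $d:U\to|X|$ is a function and $\{U_i\}_i$ is an open cover of $U$ with $d|_{U_i}\in\mathcal{D}_{U_i}$ for all $i$, then $d\in\mathcal{D}_U$. A map $f:X\to Y$ of diffeological spaces is smooth if $f\circ d\in_U Y$ for all $U$ and all $d\in_U X$; $\mathcal{C}^\infty(X,Y)$ is the set of smooth maps. Diffeological spaces and smooth maps form the category $\mathbf{Dlg}$. Smooth manifolds carry the diffeology of all usual smooth maps. The $D$-topology $\tau_X$ on $|X|$ is the final topology with respect to all plots; $T_D(X)=(|X|,\tau_X)$. For $A\subseteq|X|$, $(A\prec X)$ denotes $A$ with the sub-diffeology (plots are the maps $U\to A$ which are plots of $X$). A $\tau_X$-family $\mathcal{F}=\{\mathcal{F}_A\}_{A\in\tau_X}$ with $\mathcal{F}_A\subseteq\mathcal{C}^\infty(A\prec X,\mathbb{R})$ (possibly empty) generates the diffeology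 of $X$ if for every open $U\subseteq\mathbb{R}^n$, $n\in\mathbb{N}$, and every continuous $d:U\to T_D(X)$, the condition "$l\circ d|_{d^{-1}(A)}\in\mathcal{C}^\infty(d^{-1}(A),\mathbb{R})$ for all $A\in\tau_X$ and all $l\in\mathcal{F}_A$" implies $d\in_U X$. $X$ is functionally generated if its diffeology is generated by some such family. $\mathbf{F}\mathbf{Dlg}$ is the full subcategory of $\mathbf{Dlg}$ of functionally generated spaces. *)

theory Defs
  imports "HOL-Analysis.Analysis"
begin

section \<open>Smooth maps between open subsets of Cartesian spaces\<close>

text \<open>
  The space R^n is \<open>Euclidean_space n\<close>, whose points are the sequences \<open>nat \<Rightarrow> real\<close> vanishing
  from index \<open>n\<close> on; this lets the dimension be an ordinary variable (including \<open>n = 0\<close>).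
\<close>

abbreviation open_in_Rn :: "nat \<Rightarrow> (nat \<Rightarrow> real) set \<Rightarrow> bool"
  where "open_in_Rn n U \<equiv> openin (Euclidean_space n) U"

text \<open>
  \<open>C_k n k U f\<close>: \<open>f\<close> is of class C^k on the open set \<open>U\<close> of R^n, that is, all partial
  derivatives up to order \<open>k\<close> exist and are continuous on \<open>U\<close>. As \<open>U\<close> is open, only the values of
  \<open>f\<close> on \<open>U\<close> matter.
\<close>

primrec C_k :: "nat \<Rightarrow> nat \<Rightarrow> (nat \<Rightarrow> real) set \<Rightarrow> ((nat \<Rightarrow> real) \<Rightarrow> real) \<Rightarrow> bool"
  where
    "C_k n 0 U f \<longleftrightarrow> continuous_map (subtopology (Euclidean_space n) U) euclideanreal f"
  | "C_k n (Suc k) U f \<longleftrightarrow>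
       continuous_map (subtopology (Euclidean_space n) U) euclideanreal f \<and>
       (\<forall>i<n. \<exists>g. (\<forall>x\<in>U. ((\<lambda>t. f (x(i := t))) has_real_derivative g x) (at (x i))) \<and> C_k n k U g)"

definition C_infinity :: "nat \<Rightarrow> (nat \<Rightarrow> real) set \<Rightarrow> ((nat \<Rightarrow> real) \<Rightarrow> real) \<Rightarrow> bool"
  where "C_infinity n U f \<longleftrightarrow> (\<forall>k. C_k n k U f)"

definition smooth_Rn ::
    "nat \<Rightarrow> (nat \<Rightarrow> real) set \<Rightarrow> nat \<Rightarrow> (nat \<Rightarrow> real) set \<Rightarrow> ((nat \<Rightarrow> real) \<Rightarrow> (nat \<Rightarrow> real)) set"
  where "smooth_Rn m V n U = {f \<in> V \<rightarrow>\<^sub>E U. \<forall>i<n. C_infinity m V (\<lambda>x. f x i)}"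


section \<open>Diffeological spaces and smooth maps\<close>

text \<open>
  \<open>plots X n U\<close> is the set of plots with domain the open set \<open>U\<close> of R^n; its values at sets \<open>U\<close>
  that are not open in R^n are irrelevant and never used. Functions on a set are
  extensional (\<open>undefined\<close> outside of it), so that equality of functions is equality on the domain.
\<close>

record 'a dspace =
  carrier :: "'a set"
  plots :: "nat \<Rightarrow> (nat \<Rightarrow> real) set \<Rightarrow> ((nat \<Rightarrow> real) \<Rightarrow> 'a) set"

definition diffeological_space :: "'a dspace \<Rightarrow> bool"
  where "diffeological_space X \<longleftrightarrow>
    (\<forall>n U. open_in_Rn n U \<longrightarrow> plots X n U \<subseteq> U \<rightarrow>\<^sub>E carrier X) \<and>
    (\<forall>n U. open_in_Rn n U \<longrightarrow> (\<forall>x\<in>carrier X. (\<lambda>u\<in>U. x) \<in> plots X n U)) \<and>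
    (\<forall>n U m V. open_in_Rn n U \<longrightarrow> open_in_Rn m V \<longrightarrow>
       (\<forall>d\<in>plots X n U. \<forall>f\<in>smooth_Rn m V n U. compose V d f \<in> plots X m V)) \<and>
    (\<forall>n U. open_in_Rn n U \<longrightarrow>
       (\<forall>d\<in>U \<rightarrow>\<^sub>E carrier X. \<forall>\<U>.
          (\<forall>W\<in>\<U>. open_in_Rn n W) \<longrightarrow> \<Union>\<U> = U \<longrightarrow> (\<forall>W\<in>\<U>. restrict d W \<in> plots X n W) \<longrightarrow>
          d \<in> plots X n U))"

definition smooth_maps :: "'a dspace \<Rightarrow> 'b dspace \<Rightarrow> ('a \<Rightarrow> 'b) set"
  where "smooth_maps X Y =
    {f \<in> carrier X \<rightarrow>\<^sub>E carrier Y.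
       \<forall>n U. open_in_Rn n U \<longrightarrow> (\<forall>d\<in>plots X n U. compose U f d \<in> plots Y n U)}"

lemma id_in_smooth_maps:
  assumes "diffeological_space X"
  shows "(\<lambda>x\<in>carrier X. x) \<in> smooth_maps X X"
proof -
  have "compose U (\<lambda>x\<in>carrier X. x) d = d"
    if "open_in_Rn n U" "d \<in> plots X n U" for n U d
  proof -
    have "d \<in> U \<rightarrow>\<^sub>E carrier X"
      using conjunct1[OF assms[unfolded diffeological_space_def]] that by blast
    then show ?thesis
      by (intro Id_compose) (simp_all add: PiE_def)
  qed
  then show ?thesis
    by (simp add: smooth_maps_def)
qed

lemma compose_in_smooth_maps:
  assumes X: "diffeological_space X" and f: "f \<in> smooth_maps X Y" and g: "g \<in> smooth_maps Y Z"
  shows "compose (carrier X) g f \<in> smooth_maps X Z"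
proof -
  have "compose U (compose (carrier X) g f) d \<in> plots Z n U"
    if U: "open_in_Rn n U" and d: "d \<in> plots X n U" for n U d
  proof -
    have "d \<in> U \<rightarrow>\<^sub>E carrier X"
      using conjunct1[OF X[unfolded diffeological_space_def]] U d by blast
    then have "compose U (compose (carrier X) g f) d = compose U g (compose U f d)"
      by (intro compose_assoc[symmetric]) (simp add: PiE_def)
    moreover have "compose U f d \<in> plots Y n U"
      using f U d unfolding smooth_maps_def by blast
    then have "compose U g (compose U f d) \<in> plots Z n U"
      using g U unfolding smooth_maps_def by blast
    ultimately show ?thesis by simp
  qed
  moreover have "compose (carrier X) g f \<in> carrier X \<rightarrow> carrier Z"
    by (rule funcset_compose[where B = "carrier Y"])
      (use f g in \<open>simp_all add: smooth_maps_def PiE_def\<close>)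
  ultimately show ?thesis
    by (simp add: smooth_maps_def PiE_def)
qed

definition sub_dspace :: "'a set \<Rightarrow> 'a dspace \<Rightarrow> 'a dspace"
  where "sub_dspace A X = \<lparr>carrier = A, plots = (\<lambda>n U. {d \<in> plots X n U. d ` U \<subseteq> A})\<rparr>"

definition real_dspace :: "real dspace"
  where "real_dspace =
    \<lparr>carrier = UNIV, plots = (\<lambda>n U. {d \<in> U \<rightarrow>\<^sub>E UNIV. C_infinity n U d})\<rparr>"

definition Rn_dspace :: "nat \<Rightarrow> (nat \<Rightarrow> real) set \<Rightarrow> (nat \<Rightarrow> real) dspace"
  where "Rn_dspace n U = \<lparr>carrier = U, plots = (\<lambda>m V. smooth_Rn m V n U)\<rparr>"


section \<open>The D-topology and functionally generated spaces\<close>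

definition D_open :: "'a dspace \<Rightarrow> 'a set \<Rightarrow> bool"
  where "D_open X A \<longleftrightarrow> A \<subseteq> carrier X \<and>
    (\<forall>n U. open_in_Rn n U \<longrightarrow>
       (\<forall>d\<in>plots X n U. openin (subtopology (Euclidean_space n) U) {u \<in> U. d u \<in> A}))"

definition D_topology :: "'a dspace \<Rightarrow> 'a topology"
  where "D_topology X = topology (D_open X)"

lemma istopology_D_open: "istopology (D_open X)"
  unfolding istopology_def
proof (intro conjI allI impI)
  fix A B assume A: "D_open X A" and B: "D_open X B"
  show "D_open X (A \<inter> B)"
    unfolding D_open_def
  proof (intro conjI allI impI ballI)
    show "A \<inter> B \<subseteq> carrier X"
      using A unfolding D_open_def by blast
  next
    fix n U d assume U: "open_in_Rn n U" and d: "d \<in> plots X n U"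
    have "openin (subtopology (Euclidean_space n) U) ({u \<in> U. d u \<in> A} \<inter> {u \<in> U. d u \<in> B})"
      by (rule openin_Int) (use A B U d in \<open>unfold D_open_def, blast+\<close>)
    moreover have "{u \<in> U. d u \<in> A} \<inter> {u \<in> U. d u \<in> B} = {u \<in> U. d u \<in> A \<inter> B}"
      by blast
    ultimately show "openin (subtopology (Euclidean_space n) U) {u \<in> U. d u \<in> A \<inter> B}"
      by simp
  qed
next
  fix \<K> assume K: "\<forall>A\<in>\<K>. D_open X A"
  show "D_open X (\<Union>\<K>)"
    unfolding D_open_def
  proof (intro conjI allI impI ballI)
    show "\<Union>\<K> \<subseteq> carrier X"
      using K unfolding D_open_def by blast
  next
    fix n U d assume U: "open_in_Rn n U" and d: "d \<in> plots X n U"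
    have "openin (subtopology (Euclidean_space n) U) (\<Union>((\<lambda>A. {u \<in> U. d u \<in> A}) ` \<K>))"
      by (rule openin_Union) (use K U d in \<open>unfold D_open_def, blast\<close>)
    moreover have "\<Union>((\<lambda>A. {u \<in> U. d u \<in> A}) ` \<K>) = {u \<in> U. d u \<in> \<Union>\<K>}"
      by blast
    ultimately show "openin (subtopology (Euclidean_space n) U) {u \<in> U. d u \<in> \<Union>\<K>}"
      by simp
  qed
qed

lemma openin_D_topology: "openin (D_topology X) A \<longleftrightarrow> D_open X A"
  by (simp add: D_topology_def istopology_D_open)

definition generates_diffeology :: "'a dspace \<Rightarrow> ('a set \<Rightarrow> ('a \<Rightarrow> real) set) \<Rightarrow> bool"
  where "generates_diffeology X \<F> \<longleftrightarrow>
    (\<forall>A. openin (D_topology X) A \<longrightarrow> \<F> A \<subseteq> smooth_maps (sub_dspace A X) real_dspace) \<and>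
    (\<forall>n U d. open_in_Rn n U \<longrightarrow> d \<in> U \<rightarrow>\<^sub>E carrier X \<longrightarrow>
       continuous_map (subtopology (Euclidean_space n) U) (D_topology X) d \<longrightarrow>
       (\<forall>A. openin (D_topology X) A \<longrightarrow>
          (\<forall>l\<in>\<F> A. C_infinity n {u \<in> U. d u \<in> A} (\<lambda>u. l (d u)))) \<longrightarrow>
       d \<in> plots X n U)"

definition functionally_generated :: "'a dspace \<Rightarrow> bool"
  where "functionally_generated X \<longleftrightarrow> (\<exists>\<F>. generates_diffeology X \<F>)"

definition FDlg :: "'a dspace set"
  where "FDlg = {X. diffeological_space X \<and> functionally_generated X}"


section \<open>Universal properties in the category of functionally generated spaces\<close>

text \<open>
  The objects are the members of \<open>FDlg\<close>, on arbitrary carrier types, and the arrows from \<open>X\<close>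
  to \<open>Y\<close> are the members of \<open>smooth_maps X Y\<close>. A quantifier cannot range over types, so the type
  of the test object \<open>Z\<close> in a universal property is made an explicit argument \<open>TYPE('c)\<close>;
  a theorem in which \<open>'c\<close> is a free type variable covers test objects on all types.
\<close>

definition is_terminal :: "'c itself \<Rightarrow> 't dspace \<Rightarrow> bool"
  where "is_terminal _ T \<longleftrightarrow>
    T \<in> FDlg \<and> (\<forall>Z::'c dspace. Z \<in> FDlg \<longrightarrow> (\<exists>!h. h \<in> smooth_maps Z T))"

definition is_product ::
    "'c itself \<Rightarrow> 'a dspace \<Rightarrow> 'b dspace \<Rightarrow> 'p dspace \<Rightarrow> ('p \<Rightarrow> 'a) \<Rightarrow> ('p \<Rightarrow> 'b) \<Rightarrow> bool"
  where "is_product _ X Y P p q \<longleftrightarrow>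
    P \<in> FDlg \<and> p \<in> smooth_maps P X \<and> q \<in> smooth_maps P Y \<and>
    (\<forall>Z::'c dspace. Z \<in> FDlg \<longrightarrow> (\<forall>f\<in>smooth_maps Z X. \<forall>g\<in>smooth_maps Z Y.
       \<exists>!h. h \<in> smooth_maps Z P \<and> compose (carrier Z) p h = f \<and> compose (carrier Z) q h = g))"

definition prod_dspace :: "'a dspace \<Rightarrow> 'b dspace \<Rightarrow> ('a \<times> 'b) dspace"
  where "prod_dspace X Y =
    \<lparr>carrier = carrier X \<times> carrier Y,
     plots = (\<lambda>n U. {d \<in> U \<rightarrow>\<^sub>E carrier X \<times> carrier Y.
                       compose U fst d \<in> plots X n U \<and> compose U snd d \<in> plots Y n U})\<rparr>"

definition is_exponential ::
    "'c itself \<Rightarrow> 'a dspace \<Rightarrow> 'b dspace \<Rightarrow> 'e dspace \<Rightarrow> ('e \<times> 'a \<Rightarrow> 'b) \<Rightarrow> bool"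
  where "is_exponential _ X Y E ev \<longleftrightarrow>
    E \<in> FDlg \<and> ev \<in> smooth_maps (prod_dspace E X) Y \<and>
    (\<forall>Z::'c dspace. Z \<in> FDlg \<longrightarrow> (\<forall>f\<in>smooth_maps (prod_dspace Z X) Y.
       \<exists>!g. g \<in> smooth_maps Z E \<and>
            compose (carrier Z \<times> carrier X) ev (map_prod g (\<lambda>x. x)) = f))"

definition unit_dspace :: "unit dspace"
  where "unit_dspace = \<lparr>carrier = UNIV, plots = (\<lambda>n U. U \<rightarrow>\<^sub>E UNIV)\<rparr>"

text \<open>
  The functional diffeology: \<open>d\<close> is a plot of the space of smooth maps from \<open>X\<close> to \<open>Y\<close> iff
  \<open>(u, x) \<mapsto> d u x\<close> is smooth on the product of \<open>U\<close> and \<open>X\<close>.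
\<close>

definition exp_dspace :: "'a dspace \<Rightarrow> 'b dspace \<Rightarrow> ('a \<Rightarrow> 'b) dspace"
  where "exp_dspace X Y =
    \<lparr>carrier = smooth_maps X Y,
     plots = (\<lambda>n U. {d \<in> U \<rightarrow>\<^sub>E smooth_maps X Y.
                       (\<lambda>(u, x)\<in>U \<times> carrier X. d u x) \<in> smooth_maps (prod_dspace (Rn_dspace n U) X) Y})\<rparr>"

definition eval_map :: "'a dspace \<Rightarrow> 'b dspace \<Rightarrow> ('a \<Rightarrow> 'b) \<times> 'a \<Rightarrow> 'b"
  where "eval_map X Y = (\<lambda>(f, x)\<in>smooth_maps X Y \<times> carrier X. f x)"

end

theory Submission
  imports Defs
begin

text \<open>
  A space is functionally generated iff every map that is continuous for the D-topology and becomes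
  smooth after composition with every locally defined smooth real function is a plot
  (\<open>weak_plot\<close> below); products inherit this through the projections.

  For the exponential, let \<open>d\<close> be such a weak plot of the space of smooth maps from \<open>X\<close> to \<open>Y\<close>,
  \<open>\<psi>\<close> a plot of \<open>X\<close>, and \<open>l\<close> a smooth real function on a D-open \<open>B\<close>. For compact \<open>K\<close> the maps \<open>f\<close>
  with \<open>f (\<psi> w) \<in> B\<close> on \<open>K\<close> form a D-open set, on which
  \<open>f \<mapsto> \<Sum>k. a k * \<partial>\<^sup>\<alpha>(l \<circ> f \<circ> \<psi>)(w k)\<close> is a smooth function for all points \<open>w k\<close> of a compact set and
  all rapidly decreasing weights \<open>a k\<close>. A gliding hump argument (uniform boundedness) turns
  smoothness of \<open>d\<close> against all these functionals into estimates on difference quotients in \<open>u\<close> that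
  are uniform in \<open>w\<close>, whence \<open>(u, w) \<mapsto> l (d u (\<psi> w))\<close> is jointly smooth.
\<close>

section \<open>Boxes and calculus of C^k functions\<close>

text \<open>Smoothness in \<open>u\<close> and in \<open>w\<close> separately is far from joint
  smoothness: u*w/(u^2 + w^2), with value 0 at the origin, is smooth in each variable and not
  continuous. Single evaluations of a map \<open>f\<close> see only separate smoothness, so richer
  functionals are needed. A series over points of a compact set can detect a failure of uniformity
  in \<open>w\<close>, and is still smooth along genuine plots, where joint smoothness is part of
  the definition. Derivatives in \<open>w\<close> enter the functionals because the argument is
  iterated: the derivative in \<open>u\<close> of such a family must again satisfy every hypothesis,
  including compatibility with the derivatives in \<open>w\<close>. Joint smoothness then follows
  coinductively, from a class of continuous functions closed under all partial derivatives. The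
  weights have size at most 3^-k. With ratio q the terms after the n-th sum to q/(1-q) times q^n.
  For q = 1/3 the factor is 1/2, and even after the loss of 3/2, caused by suprema that need not be
  attained, the tail is only 3/4 of the hump.\<close>

declare C_k.simps [simp del]

definition euc :: "nat \<Rightarrow> (nat \<Rightarrow> real) set"
  where "euc n = {x. \<forall>i\<ge>n. x i = 0}"

text \<open>Closed balls of the maximum norm: they are compact, and they allow one coordinate to be
  changed within the radius, the only move that a partial derivative makes.\<close>

definition rbox :: "nat \<Rightarrow> (nat \<Rightarrow> real) \<Rightarrow> real \<Rightarrow> (nat \<Rightarrow> real) set"
  where "rbox n c r = {x \<in> euc n. \<forall>i<n. \<bar>x i - c i\<bar> \<le> r}"

lemma Euclidean_space_eq: "Euclidean_space n = top_of_set (euc n)"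
  by (simp add: Euclidean_space_def euc_def euclidean_product_topology)

lemma rbox_mono: "r \<le> s \<Longrightarrow> rbox n c r \<subseteq> rbox n c s"
  by (force simp: rbox_def)

lemma center_in_rbox: "c \<in> euc n \<Longrightarrow> 0 \<le> r \<Longrightarrow> c \<in> rbox n c r"
  by (auto simp: rbox_def)

text \<open>Tychonoff's theorem for a product over all indices, in which the coordinates from
  \<open>n\<close> on contribute the compact factor {0}.\<close>

lemma compact_rbox: "compact (rbox n c r)"
proof -
  have eq: "rbox n c r = PiE UNIV (\<lambda>i. if i < n then cball (c i) r else {0})"
  proof (intro set_eqI)
    fix x
    show "x \<in> rbox n c r \<longleftrightarrow> x \<in> PiE UNIV (\<lambda>i. if i < n then cball (c i) r else {0})"
      by (simp add: rbox_def euc_def PiE_iff dist_real_def abs_minus_commute) (metis not_less)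
  qed
  show ?thesis
    unfolding eq compactin_euclidean_iff [symmetric] euclidean_product_topology [symmetric]
    by (subst compactin_PiE) auto
qed

lemma openin_Euclidean_space_rbox:
  "open_in_Rn n U \<longleftrightarrow> U \<subseteq> euc n \<and> (\<forall>x\<in>U. \<exists>r>0. rbox n x r \<subseteq> U)"
proof (intro iffI conjI ballI)
  assume U: "open_in_Rn n U"
  then obtain T where T: "open T" "U = euc n \<inter> T"
    by (auto simp: Euclidean_space_eq openin_open)
  show "U \<subseteq> euc n" using T by auto
  fix x assume "x \<in> U"
  then have x: "x \<in> T" "x \<in> euc n" using T by auto
  have "openin (product_topology (\<lambda>_. euclideanreal) UNIV) T"
    using T(1) by (simp add: euclidean_product_topology)
  from product_topology_open_contains_basis[OF this x(1)] obtain X where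
    X: "x \<in> PiE UNIV X" "\<And>i. open (X i)" "PiE UNIV X \<subseteq> T" by auto
  have "\<exists>e>0. cball (x i) e \<subseteq> X i" for i
    using X(1,2) open_contains_cball by (metis PiE_iff UNIV_I)
  then obtain e where e: "\<And>i. e i > 0" "\<And>i. cball (x i) (e i) \<subseteq> X i" by metis
  \<comment> \<open>Points of \<open>euc n\<close> can differ only in the first \<open>n\<close>
    coordinates, so a minimum of finitely many radii suffices; the inserted 1 covers
    \<open>n = 0\<close>.\<close>
  define r where "r = Min (insert 1 (e ` {..<n}))"
  have r: "r > 0" "\<And>i. i < n \<Longrightarrow> r \<le> e i"
    using e(1) by (auto simp: r_def Min_gr_iff)
  have "rbox n x r \<subseteq> U"
  proof
    fix y assume y: "y \<in> rbox n x r"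
    have "y i \<in> X i" for i
    proof (cases "i < n")
      case True
      then have "y i \<in> cball (x i) (e i)"
        using y r(2)[of i] by (auto simp: rbox_def dist_real_def abs_minus_commute intro: order_trans)
      then show ?thesis using e(2) by blast
    next
      case False
      then have "y i = x i" using y x(2) by (auto simp: rbox_def euc_def)
      then show ?thesis using X(1) by auto
    qed
    then show "y \<in> U" using X(3) y T(2) by (auto simp: rbox_def)
  qed
  then show "\<exists>r>0. rbox n x r \<subseteq> U" using r(1) by blast
next
  assume U: "U \<subseteq> euc n \<and> (\<forall>x\<in>U. \<exists>r>0. rbox n x r \<subseteq> U)"
  show "open_in_Rn n U"
  proof (subst openin_subopen, intro ballI)
    fix x assume "x \<in> U"
    then obtain r where r: "r > 0" "rbox n x r \<subseteq> U" using U by blast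
    let ?T = "\<Inter>i<n. (\<lambda>y. y i) -` ball (x i) r"
    have "open ?T"
      by (intro open_INT finite_lessThan ballI open_vimage open_ball)
         (auto intro: continuous_on_product_coordinates)
    then have "open_in_Rn n (euc n \<inter> ?T)"
      by (auto simp: Euclidean_space_eq openin_open)
    moreover have "x \<in> euc n \<inter> ?T" using \<open>x \<in> U\<close> U r by auto
    moreover have "euc n \<inter> ?T \<subseteq> U"
      using r(2) by (force simp: rbox_def dist_real_def abs_minus_commute)
    ultimately show "\<exists>T. open_in_Rn n T \<and> x \<in> T \<and> T \<subseteq> U" by blast
  qed
qed

lemma open_in_Rn_subset: "open_in_Rn n U \<Longrightarrow> U \<subseteq> euc n"
  by (simp add: openin_Euclidean_space_rbox)

lemma continuous_map_subtopology_Euclidean_space: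
  assumes "U \<subseteq> euc n"
  shows "continuous_map (subtopology (Euclidean_space n) U) euclideanreal f \<longleftrightarrow> continuous_on U f"
proof -
  have "euc n \<inter> U = U" using assms by auto
  then show ?thesis by (simp add: Euclidean_space_eq subtopology_subtopology)
qed

lemma openin_subtopology_open_in_Rn:
  assumes "open_in_Rn n U"
  shows "openin (subtopology (Euclidean_space n) U) S \<longleftrightarrow> open_in_Rn n S \<and> S \<subseteq> U"
  using openin_open_subtopology[OF assms] by auto

lemma open_in_Rn_preimage:
  assumes "open_in_Rn n U" "continuous_on U f" "open B"
  shows "open_in_Rn n {x \<in> U. f x \<in> B}"
proof -
  have "openin (top_of_set U) (U \<inter> f -` B)"
    using assms continuous_openin_preimage_gen by blast
  moreover have "U \<inter> f -` B = {x \<in> U. f x \<in> B}" by auto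
  ultimately show ?thesis
    using assms(1) open_in_Rn_subset[OF assms(1)]
    by (metis Euclidean_space_eq openin_trans)
qed

lemma continuous_on_rbox_iff:
  fixes f :: "(nat \<Rightarrow> real) \<Rightarrow> real"
  assumes U: "open_in_Rn n U"
  shows "continuous_on U f \<longleftrightarrow>
    (\<forall>x\<in>U. \<forall>e>0. \<exists>r>0. rbox n x r \<subseteq> U \<and> (\<forall>y\<in>rbox n x r. \<bar>f y - f x\<bar> < e))" (is "?L \<longleftrightarrow> ?R")
proof
  assume L: ?L
  show ?R
  proof (intro ballI allI impI)
    fix x e :: "_" assume x: "x \<in> U" and e: "(e::real) > 0"
    have "open_in_Rn n {y \<in> U. f y \<in> ball (f x) e}"
      by (rule open_in_Rn_preimage) (use U L in auto)
    then obtain r where "r > 0" "rbox n x r \<subseteq> {y \<in> U. f y \<in> ball (f x) e}"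
      using x e unfolding openin_Euclidean_space_rbox by fastforce
    then show "\<exists>r>0. rbox n x r \<subseteq> U \<and> (\<forall>y\<in>rbox n x r. \<bar>f y - f x\<bar> < e)"
      by (intro exI[of _ r]) (auto simp: dist_real_def abs_minus_commute)
  qed
next
  assume R: ?R
  have "openin (top_of_set U) (U \<inter> f -` B)" if B: "open B" for B
  proof -
    have "open_in_Rn n (U \<inter> f -` B)"
      unfolding openin_Euclidean_space_rbox
    proof (intro conjI ballI)
      show "U \<inter> f -` B \<subseteq> euc n" using open_in_Rn_subset[OF U] by auto
      fix x assume x: "x \<in> U \<inter> f -` B"
      then obtain e where e: "e > 0" "ball (f x) e \<subseteq> B" using B open_contains_ball by blast
      obtain r where r: "r > 0" "rbox n x r \<subseteq> U" "\<forall>y\<in>rbox n x r. \<bar>f y - f x\<bar> < e"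
        using R x e by blast
      then have "rbox n x r \<subseteq> U \<inter> f -` B"
        using e(2) by (auto simp: dist_real_def abs_minus_commute subset_iff)
      then show "\<exists>r>0. rbox n x r \<subseteq> U \<inter> f -` B" using r by blast
    qed
    then show ?thesis
      using U openin_subtopology_open_in_Rn
      by (metis Euclidean_space_eq inf.absorb_iff2 inf_le1 open_in_Rn_subset subtopology_subtopology)
  qed
  then show ?L by (simp add: continuous_on_open_gen[of f U UNIV] continuous_openin_preimage_eq)
qed

section \<open>Partial derivatives and the classes C^k\<close>

lemma rbox_update:
  assumes "y \<in> rbox n x r" "i < n" "\<bar>t - x i\<bar> \<le> r"
  shows "y(i := t) \<in> rbox n x r"
  using assms by (auto simp: rbox_def euc_def)

text \<open>Makes the two-sided derivative at a point of an open set depend only on the values of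
  the function on that set.\<close>

lemma eventually_update_in_open:
  assumes "open_in_Rn n U" "x \<in> U" "i < n"
  shows "\<forall>\<^sub>F t in nhds (x i). x(i := t) \<in> U"
proof -
  obtain r where r: "r > 0" "rbox n x r \<subseteq> U" using assms(1,2) openin_Euclidean_space_rbox by blast
  have "x \<in> rbox n x r" using assms open_in_Rn_subset center_in_rbox r(1) by (meson less_imp_le subsetD)
  moreover have "\<forall>\<^sub>F t in nhds (x i). \<bar>t - x i\<bar> \<le> r"
    using r(1) eventually_nhds_metric[of "\<lambda>t. \<bar>t - x i\<bar> \<le> r"] dist_real_def by (auto intro!: exI[of _ r])
  ultimately show ?thesis
    using rbox_update[OF _ assms(3)] r(2) by (auto elim!: eventually_mono)
qed

text \<open>A total choice through \<open>deriv\<close>, informative only where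
  \<open>has_pd\<close> holds. It replaces the existential in \<open>C_k\<close> by a canonical
  function and lets iterated derivatives be named.\<close>

definition pd :: "nat \<Rightarrow> ((nat \<Rightarrow> real) \<Rightarrow> real) \<Rightarrow> (nat \<Rightarrow> real) \<Rightarrow> real"
  where "pd i f x = deriv (\<lambda>t. f (x(i := t))) (x i)"

definition has_pd :: "nat \<Rightarrow> ((nat \<Rightarrow> real) \<Rightarrow> real) \<Rightarrow> (nat \<Rightarrow> real) \<Rightarrow> real \<Rightarrow> bool"
  where "has_pd i f x D \<longleftrightarrow> ((\<lambda>t. f (x(i := t))) has_real_derivative D) (at (x i))"

lemma has_pd_imp_pd: "has_pd i f x D \<Longrightarrow> pd i f x = D"
  unfolding has_pd_def pd_def by (rule DERIV_imp_deriv)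

lemma has_pd_cong:
  assumes "open_in_Rn n U" "x \<in> U" "i < n" "\<And>y. y \<in> U \<Longrightarrow> f y = g y"
  shows "has_pd i f x D \<longleftrightarrow> has_pd i g x D"
  unfolding has_pd_def
proof (rule DERIV_cong_ev[OF refl _ refl])
  show "\<forall>\<^sub>F t in nhds (x i). f (x(i := t)) = g (x(i := t))"
    using eventually_update_in_open[OF assms(1-3)] by eventually_elim (rule assms(4))
qed

lemma C_k_cong:
  assumes U: "open_in_Rn n U" and "\<And>y. y \<in> U \<Longrightarrow> f y = g y"
  shows "C_k n k U f \<longleftrightarrow> C_k n k U g"
proof -
  note [simp] = continuous_map_subtopology_Euclidean_space[OF open_in_Rn_subset[OF U]]
  have c: "continuous_on U f \<longleftrightarrow> continuous_on U g"
    using assms(2) by (intro continuous_on_cong) auto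
  show ?thesis
  proof (cases k)
    case 0
    then show ?thesis using c by (simp add: C_k.simps)
  next
    case (Suc m)
    have "(\<forall>x\<in>U. ((\<lambda>t. f (x(i := t))) has_real_derivative h x) (at (x i))) \<longleftrightarrow>
          (\<forall>x\<in>U. ((\<lambda>t. g (x(i := t))) has_real_derivative h x) (at (x i)))" if "i < n" for i h
      using has_pd_cong[where f = f and g = g, OF U _ that assms(2)] by (auto simp: has_pd_def)
    then show ?thesis using c Suc by (auto simp: C_k.simps)
  qed
qed

lemma C_k_0: "open_in_Rn n U \<Longrightarrow> C_k n 0 U f \<longleftrightarrow> continuous_on U f"
  by (simp add: C_k.simps continuous_map_subtopology_Euclidean_space[OF open_in_Rn_subset])

text \<open>Derivatives are unique, so any witness \<open>g\<close> from the recursive definition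
  agrees with \<open>pd i f\<close> on \<open>U\<close>, and \<open>C_k_cong\<close> carries its
  regularity over.\<close>

lemma C_k_Suc:
  assumes U: "open_in_Rn n U"
  shows "C_k n (Suc k) U f \<longleftrightarrow> continuous_on U f \<and>
    (\<forall>i<n. (\<forall>x\<in>U. has_pd i f x (pd i f x)) \<and> C_k n k U (pd i f))"
proof -
  have "(\<exists>g. (\<forall>x\<in>U. ((\<lambda>t. f (x(i := t))) has_real_derivative g x) (at (x i))) \<and> C_k n k U g) \<longleftrightarrow>
      (\<forall>x\<in>U. has_pd i f x (pd i f x)) \<and> C_k n k U (pd i f)" (is "?L \<longleftrightarrow> ?R") for i
  proof
    assume ?L
    then obtain g where g: "\<And>x. x\<in>U \<Longrightarrow> has_pd i f x (g x)" "C_k n k U g"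
      by (auto simp: has_pd_def)
    then have "pd i f x = g x" if "x \<in> U" for x using that has_pd_imp_pd by blast
    then show ?R using g C_k_cong[OF U, of "pd i f" g] by auto
  next
    assume ?R then show ?L by (auto simp: has_pd_def)
  qed
  then show ?thesis
    by (simp add: C_k.simps continuous_map_subtopology_Euclidean_space[OF open_in_Rn_subset[OF U]])
qed

lemma C_k_SucI:
  assumes U: "open_in_Rn n U" and "continuous_on U f"
    and "\<And>i. i < n \<Longrightarrow> \<exists>g. (\<forall>x\<in>U. has_pd i f x (g x)) \<and> C_k n k U g"
  shows "C_k n (Suc k) U f"
  using assms(2,3) by (simp add: C_k.simps continuous_map_subtopology_Euclidean_space[OF open_in_Rn_subset[OF U]] has_pd_def)

lemma C_k_continuous: "open_in_Rn n U \<Longrightarrow> C_k n k U f \<Longrightarrow> continuous_on U f"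
  by (cases k) (auto simp: C_k.simps continuous_map_subtopology_Euclidean_space[OF open_in_Rn_subset])

lemma C_k_Suc_imp: "open_in_Rn n U \<Longrightarrow> C_k n (Suc k) U f \<Longrightarrow> C_k n k U f"
proof (induction k arbitrary: f)
  case 0
  then show ?case by (simp add: C_k_0 C_k_Suc)
next
  case (Suc k)
  then show ?case by (meson C_k_Suc)
qed

lemma C_k_subset:
  assumes "open_in_Rn n U" "open_in_Rn n V" "V \<subseteq> U" "C_k n k U f"
  shows "C_k n k V f"
  using assms(4)
proof (induction k arbitrary: f)
  case 0
  then show ?case using assms by (simp add: C_k_0 continuous_on_subset)
next
  case (Suc k)
  then show ?case using assms(1-3) by (auto simp: C_k_Suc intro: continuous_on_subset)
qed

lemma continuous_on_local_Rn:
  fixes f :: "(nat \<Rightarrow> real) \<Rightarrow> real"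
  assumes U: "open_in_Rn n U"
    and loc: "\<And>x. x \<in> U \<Longrightarrow> \<exists>W. open_in_Rn n W \<and> x \<in> W \<and> W \<subseteq> U \<and> continuous_on W f"
  shows "continuous_on U f"
  unfolding continuous_on_rbox_iff[OF U]
proof (intro ballI allI impI)
  fix x e assume x: "x \<in> U" and e: "(e::real) > 0"
  obtain W where W: "open_in_Rn n W" "x \<in> W" "W \<subseteq> U" "continuous_on W f" using loc x by blast
  then obtain r where "r>0" "rbox n x r \<subseteq> W" "\<forall>y\<in>rbox n x r. \<bar>f y - f x\<bar> < e"
    using continuous_on_rbox_iff[OF W(1)] e by blast
  then show "\<exists>r>0. rbox n x r \<subseteq> U \<and> (\<forall>y\<in>rbox n x r. \<bar>f y - f x\<bar> < e)" using W by blast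
qed

lemma C_k_local:
  assumes U: "open_in_Rn n U"
    and loc: "\<And>x. x \<in> U \<Longrightarrow> \<exists>W. open_in_Rn n W \<and> x \<in> W \<and> W \<subseteq> U \<and> C_k n k W f"
  shows "C_k n k U f"
  using loc
proof (induction k arbitrary: f)
  case 0
  then show ?case using U continuous_on_local_Rn[OF U] by (metis C_k_0)
next
  case (Suc k)
  have "continuous_on U f"
    by (rule continuous_on_local_Rn[OF U]) (use Suc.prems in \<open>metis C_k_Suc\<close>)
  moreover have "has_pd i f x (pd i f x)" if "i < n" "x \<in> U" for i x
    using Suc.prems that by (metis C_k_Suc)
  moreover have "C_k n k U (pd i f)" if "i < n" for i
    by (rule Suc.IH) (use Suc.prems that in \<open>metis C_k_Suc\<close>)
  ultimately show ?case using C_k_Suc[OF U] by blast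
qed

lemma C_k_const: "open_in_Rn n U \<Longrightarrow> C_k n k U (\<lambda>x. c)"
proof (induction k arbitrary: c)
  case 0
  then show ?case by (simp add: C_k_0)
next
  case (Suc k)
  then show ?case by (intro C_k_SucI exI[of _ "\<lambda>x. 0"]) (auto simp: has_pd_def)
qed

lemma C_k_coord:
  assumes "open_in_Rn n U"
  shows "C_k n k U (\<lambda>x. x i)"
proof (cases k)
  case 0
  then show ?thesis using assms by (auto simp: C_k_0 intro: continuous_on_subset continuous_on_product_coordinates)
next
  case (Suc m)
  have der: "((\<lambda>t. (x(j := t)) i) has_real_derivative (if i = j then 1 else 0)) (at (x j))"
    for x :: "nat \<Rightarrow> real" and j by (cases "i = j") auto
  then show ?thesis unfolding Suc
  proof (intro C_k_SucI assms continuous_on_subset[OF continuous_on_product_coordinates subset_UNIV])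
    fix j
    show "\<exists>g. (\<forall>x\<in>U. has_pd j (\<lambda>x. x i) x (g x)) \<and> C_k n m U g"
      using C_k_const[OF assms, of m "if i = j then 1 else 0"] der[of _ j]
      by (intro exI[of _ "\<lambda>x. if i = j then 1 else 0"]) (simp add: has_pd_def)
  qed
qed

lemma C_k_add:
  assumes U: "open_in_Rn n U" and "C_k n k U f" "C_k n k U g"
  shows "C_k n k U (\<lambda>x. f x + g x)"
  using assms(2,3)
proof (induction k arbitrary: f g)
  case 0
  then show ?case using U by (simp add: C_k_0 continuous_on_add)
next
  case (Suc k)
  show ?case
  proof (rule C_k_SucI[OF U])
    show "continuous_on U (\<lambda>x. f x + g x)"
      using Suc.prems U by (simp add: C_k_Suc continuous_on_add)
    fix i assume i: "i < n"
    note f = Suc.prems(1)[unfolded C_k_Suc[OF U], THEN conjunct2, rule_format, OF i]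
      and g = Suc.prems(2)[unfolded C_k_Suc[OF U], THEN conjunct2, rule_format, OF i]
    have "\<forall>x\<in>U. has_pd i (\<lambda>x. f x + g x) x (pd i f x + pd i g x)"
      using f g unfolding has_pd_def by (intro ballI DERIV_add) blast+
    then show "\<exists>h. (\<forall>x\<in>U. has_pd i (\<lambda>x. f x + g x) x (h x)) \<and> C_k n k U h"
      using Suc.IH f g by (intro exI[of _ "\<lambda>x. pd i f x + pd i g x"]) blast
  qed
qed

lemma C_k_mult:
  assumes U: "open_in_Rn n U" and "C_k n k U f" "C_k n k U g"
  shows "C_k n k U (\<lambda>x. f x * g x)"
  using assms(2,3)
proof (induction k arbitrary: f g)
  case 0
  then show ?case using U by (simp add: C_k_0 continuous_on_mult)
next
  case (Suc k)
  show ?case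
  proof (rule C_k_SucI[OF U])
    show "continuous_on U (\<lambda>x. f x * g x)"
      using Suc.prems U by (simp add: C_k_Suc continuous_on_mult)
    fix i assume i: "i < n"
    have "has_pd i (\<lambda>x. f x * g x) x (pd i f x * g x + pd i g x * f x)" if x: "x \<in> U" for x
    proof -
      have "has_pd i f x (pd i f x)" "has_pd i g x (pd i g x)"
        using Suc.prems i x unfolding C_k_Suc[OF U] by auto
      from DERIV_mult[OF this[unfolded has_pd_def]] show ?thesis unfolding has_pd_def by simp
    qed
    moreover have "C_k n k U (\<lambda>x. pd i f x * g x + pd i g x * f x)"
      using Suc.prems i C_k_Suc_imp[OF U] C_k_Suc[OF U]
      by (intro C_k_add[OF U] Suc.IH) auto
    ultimately show "\<exists>h. (\<forall>x\<in>U. has_pd i (\<lambda>x. f x * g x) x (h x)) \<and> C_k n k U h"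
      by (intro exI[of _ "\<lambda>x. pd i f x * g x + pd i g x * f x"]) blast
  qed
qed

lemma C_k_sum:
  assumes U: "open_in_Rn n U" and "finite A" "\<And>j. j \<in> A \<Longrightarrow> C_k n k U (f j)"
  shows "C_k n k U (\<lambda>x. \<Sum>j\<in>A. f j x)"
  using assms(2,3)
  by (induction A rule: finite_induct) (auto intro: C_k_const[OF U] C_k_add[OF U])

text \<open>The mean value inequality for \<open>F (y(j := t)) - g x * t\<close>, whose derivative
  in \<open>t\<close> is small near \<open>x\<close> by continuity of \<open>g\<close>. The base
  point \<open>y\<close> may differ from \<open>x\<close> because the chain rule moves the
  coordinates one after the other and so starts most of its increments away from
  \<open>x\<close>.\<close>

lemma partial_increment:
  assumes U: "open_in_Rn n U" and j: "j < n" and x: "x \<in> U" and e: "e > 0"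
    and der: "\<And>y. y \<in> U \<Longrightarrow> has_pd j F y (g y)" and cont: "continuous_on U g"
  shows "\<exists>r>0. rbox n x r \<subseteq> U \<and> (\<forall>y\<in>rbox n x r. \<forall>b. \<bar>b - x j\<bar> \<le> r \<longrightarrow>
    \<bar>F (y(j := b)) - F y - g x * (b - y j)\<bar> \<le> e * \<bar>b - y j\<bar>)"
proof -
  obtain r where r: "r > 0" "rbox n x r \<subseteq> U" "\<And>y. y\<in>rbox n x r \<Longrightarrow> \<bar>g y - g x\<bar> < e"
    using cont x e unfolding continuous_on_rbox_iff[OF U] by blast
  have "\<bar>F (y(j := b)) - F y - g x * (b - y j)\<bar> \<le> e * \<bar>b - y j\<bar>"
    if y: "y \<in> rbox n x r" and b: "\<bar>b - x j\<bar> \<le> r" for y b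
  proof -
    let ?S = "cball (x j) r"
    let ?f = "\<lambda>t. F (y(j := t)) - g x * t"
    have "(?f has_real_derivative (g (y(j := t)) - g x)) (at t within ?S)" if "t \<in> ?S" for t
    proof -
      have "y(j := t) \<in> rbox n x r" using y j that
        by (intro rbox_update) (auto simp: dist_real_def abs_minus_commute)
      then have "has_pd j F (y(j := t)) (g (y(j := t)))" using der r(2) by blast
      then have "((\<lambda>s. F (y(j := s))) has_real_derivative g (y(j := t))) (at t)"
        by (simp add: has_pd_def)
      from DERIV_diff[OF this DERIV_cmult[OF DERIV_ident, of "g x"]]
      have "(?f has_real_derivative g (y(j := t)) - g x) (at t)" by simp
      then show ?thesis by (rule has_field_derivative_at_within)
    qed
    moreover have "norm (g (y(j := t)) - g x) \<le> e" if "t \<in> ?S" for t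
      using r(3)[OF rbox_update[OF y j, of t]] that by (auto simp: dist_real_def abs_minus_commute)
    ultimately have "norm (?f b - ?f (y j)) \<le> e * norm (b - y j)"
      using y b j
      by (intro field_differentiable_bound[of ?S ?f "\<lambda>t. g (y(j := t)) - g x" e])
         (auto simp: rbox_def dist_real_def abs_minus_commute)
    then show ?thesis by (simp add: algebra_simps)
  qed
  then show ?thesis using r by blast
qed

text \<open>The increment of \<open>F\<close> along \<open>c\<close> is telescoped: in
  \<open>p j t\<close> only the first \<open>j\<close> coordinates have moved, and each step from
  \<open>j\<close> to \<open>Suc j\<close> is a one-coordinate increment controlled by
  \<open>partial_increment\<close>.\<close>

lemma chain_rule:
  assumes U: "open_in_Rn n U" and x: "c t0 \<in> U"
    and der: "\<And>j y. j < n \<Longrightarrow> y \<in> U \<Longrightarrow> has_pd j F y (g j y)"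
    and cont: "\<And>j. j < n \<Longrightarrow> continuous_on U (g j)"
    and c': "\<And>j. j < n \<Longrightarrow> ((\<lambda>t. c t j) has_real_derivative c' j) (at t0)"
    and ev: "\<forall>\<^sub>F t in nhds t0. c t \<in> euc n"
  shows "((\<lambda>t. F (c t)) has_real_derivative (\<Sum>j<n. g j (c t0) * c' j)) (at t0)"
proof -
  define x0 where "x0 = c t0"
  define p where "p j t = (\<lambda>i. if i < j then c t i else x0 i)" for j t
  have x0: "x0 \<in> U" "x0 \<in> euc n" using x open_in_Rn_subset[OF U] by (auto simp: x0_def)
  have near: "\<forall>\<^sub>F t in at t0. \<forall>i<n. \<bar>c t i - x0 i\<bar> \<le> r" if "r > 0" for r
  proof -
    have "\<forall>\<^sub>F t in at t0. \<bar>c t i - x0 i\<bar> \<le> r" if i: "i < n" for i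
    proof -
      have "((\<lambda>t. c t i) \<longlongrightarrow> x0 i) (at t0)"
        using DERIV_isCont[OF c'[OF i]] by (simp add: isCont_def x0_def)
      then have "\<forall>\<^sub>F t in at t0. dist (c t i) (x0 i) < r" using \<open>r > 0\<close> tendstoD by blast
      then show ?thesis by eventually_elim (simp add: dist_real_def)
    qed
    then have "\<forall>\<^sub>F t in at t0. \<forall>i\<in>{..<n}. \<bar>c t i - x0 i\<bar> \<le> r"
      by (intro eventually_ball_finite) auto
    then show ?thesis by (simp add: Ball_def)
  qed
  have "((\<lambda>t. F (p j t)) has_real_derivative (\<Sum>i<j. g i x0 * c' i)) (at t0)" if "j \<le> n" for j
    using that
  proof (induction j)
    case 0
    have "p 0 t = x0" for t by (simp add: p_def)
    then show ?case by simp
  next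
    case (Suc j)
    then have j: "j < n" by simp
    let ?d = "\<lambda>t. F (p (Suc j) t) - F (p j t)"
    have p0: "p i t0 = x0" for i by (auto simp: p_def x0_def)
    have q: "((\<lambda>t. (c t j - x0 j) / (t - t0)) \<longlongrightarrow> c' j) (at t0)"
      using c'[OF j] by (simp add: has_field_derivative_iff x0_def)
    have "((\<lambda>t. (?d t - g j x0 * (c t j - x0 j)) / (t - t0)) \<longlongrightarrow> 0) (at t0)"
    proof (rule tendstoI)
      fix e :: real assume e: "e > 0"
      \<comment> \<open>The difference quotient of coordinate \<open>j\<close> of \<open>c\<close>
        is eventually below \<open>\<bar>c' j\<bar> + 1\<close> in absolute value, so
        \<open>e'\<close> times it stays below \<open>e\<close>.\<close>
      define e' where "e' = e / (\<bar>c' j\<bar> + 1)"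
      have e': "e' > 0" using e by (simp add: e'_def)
      obtain r where r: "r > 0" "rbox n x0 r \<subseteq> U" "\<And>y b. y\<in>rbox n x0 r \<Longrightarrow> \<bar>b - x0 j\<bar> \<le> r \<Longrightarrow>
        \<bar>F (y(j := b)) - F y - g j x0 * (b - y j)\<bar> \<le> e' * \<bar>b - y j\<bar>"
        using partial_increment[OF U j x0(1) e' der[OF j] cont[OF j]] by blast
      have "\<forall>\<^sub>F t in at t0. \<bar>(c t j - x0 j) / (t - t0) - c' j\<bar> < 1"
        using tendstoD[OF q, of 1] by (simp add: dist_real_def)
      moreover have "\<forall>\<^sub>F t in at t0. \<forall>i<n. \<bar>c t i - x0 i\<bar> \<le> r" by (rule near[OF r(1)])
      moreover have "\<forall>\<^sub>F t in at t0. t \<noteq> t0" by (simp add: eventually_at_filter)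
      ultimately show "\<forall>\<^sub>F t in at t0. dist ((?d t - g j x0 * (c t j - x0 j)) / (t - t0)) 0 < e"
      proof eventually_elim
        case (elim t)
        have pj: "p (Suc j) t = (p j t)(j := c t j)" by (auto simp: p_def fun_eq_iff)
        have "p j t \<in> rbox n x0 r"
          using elim(2) j x0(2) r(1) by (auto simp: p_def rbox_def euc_def)
        from r(3)[OF this, of "c t j"] have
          "\<bar>?d t - g j x0 * (c t j - x0 j)\<bar> \<le> e' * \<bar>c t j - x0 j\<bar>"
          using elim(2) j unfolding pj by (simp add: p_def)
        then have "\<bar>(?d t - g j x0 * (c t j - x0 j)) / (t - t0)\<bar> \<le> e' * \<bar>(c t j - x0 j) / (t - t0)\<bar>"
          using elim(3) by (simp add: abs_divide divide_simps)
        also have "\<dots> < e' * (\<bar>c' j\<bar> + 1)" using elim(1) e' by (intro mult_strict_left_mono) linarith+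
        also have "\<dots> = e" by (simp add: e'_def)
        finally show ?case by (simp add: dist_real_def)
      qed
    qed
    then have "((\<lambda>t. (?d t - g j x0 * (c t j - x0 j)) / (t - t0) + g j x0 * ((c t j - x0 j) / (t - t0)))
         \<longlongrightarrow> 0 + g j x0 * c' j) (at t0)"
      by (intro tendsto_add tendsto_mult tendsto_const q)
    moreover have "(?d t - g j x0 * (c t j - x0 j)) / (t - t0) + g j x0 * ((c t j - x0 j) / (t - t0))
        = (?d t - ?d t0) / (t - t0)" for t
      by (simp add: p0 add_divide_distrib [symmetric])
    ultimately have "(?d has_real_derivative g j x0 * c' j) (at t0)"
      by (simp add: has_field_derivative_iff)
    from DERIV_add[OF Suc.IH this] j show ?case by simp
  qed
  from this[of n] have D: "((\<lambda>t. F (p n t)) has_real_derivative (\<Sum>i<n. g i x0 * c' i)) (at t0)" by simp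
  \<comment> \<open>After \<open>n\<close> moves the coordinates from \<open>n\<close> on are still
    those of \<open>x0\<close>, namely 0; they agree with those of \<open>c t\<close> because
    \<open>c t\<close> lies in \<open>euc n\<close>.\<close>
  have "\<forall>\<^sub>F t in nhds t0. F (p n t) = F (c t)"
    using ev
  proof eventually_elim
    case (elim t)
    have "p n t = c t" using elim x0(2) by (auto simp: p_def euc_def fun_eq_iff)
    then show ?case by simp
  qed
  then show ?thesis
    using D DERIV_cong_ev[OF refl _ refl, of "\<lambda>t. F (p n t)" "\<lambda>t. F (c t)"] by (simp add: x0_def)
qed

lemma continuous_on_euc_valued:
  assumes "f ` V \<subseteq> euc n" "\<And>j. j < n \<Longrightarrow> continuous_on V (\<lambda>x. f x j)"
  shows "continuous_on V f"
proof (rule continuous_on_coordinatewise_then_product)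
  fix j show "continuous_on V (\<lambda>x. f x j)"
  proof (cases "j < n")
    case False
    then have "continuous_on V (\<lambda>x. f x j) \<longleftrightarrow> continuous_on V (\<lambda>x. 0::real)"
      using assms(1) by (intro continuous_on_cong) (auto simp: euc_def)
    then show ?thesis by simp
  qed (rule assms(2))
qed

text \<open>A derivative of the composite is a sum of products of \<open>pd j F\<close> composed
  with \<open>f\<close> and derivatives of components of \<open>f\<close>. The induction therefore
  runs over all \<open>F\<close> at once, with the components of \<open>f\<close> lowered to order
  \<open>k\<close> by \<open>C_k_Suc_imp\<close>.\<close>

lemma C_k_compose:
  assumes V: "open_in_Rn m V" and U: "open_in_Rn n U" and f: "f ` V \<subseteq> U"
    and "\<And>j. j < n \<Longrightarrow> C_k m k V (\<lambda>x. f x j)" and "C_k n k U F"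
  shows "C_k m k V (\<lambda>x. F (f x))"
  using assms(4,5)
proof (induction k arbitrary: F)
  case 0
  have "continuous_on V f"
    using 0 f open_in_Rn_subset[OF U] V by (intro continuous_on_euc_valued[of f V n]) (auto simp: C_k_0)
  moreover have "continuous_on U F" using 0 C_k_0[OF U] by blast
  ultimately show ?case using f C_k_0[OF V] continuous_on_compose2 by blast
next
  case (Suc k)
  have fe: "f ` V \<subseteq> euc n" using f open_in_Rn_subset[OF U] by blast
  note F = Suc.prems(2)[unfolded C_k_Suc[OF U]]
  have fj: "\<And>j. j < n \<Longrightarrow> C_k m k V (\<lambda>x. f x j)" using Suc.prems(1) C_k_Suc_imp[OF V] by blast
  have cf: "continuous_on V f"
    using fj C_k_continuous[OF V] by (intro continuous_on_euc_valued[OF fe]) auto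
  show ?case
  proof (rule C_k_SucI[OF V])
    show "continuous_on V (\<lambda>x. F (f x))" using F cf f continuous_on_compose2 by blast
    fix i assume i: "i < m"
    let ?h = "\<lambda>x. \<Sum>j<n. pd j F (f x) * pd i (\<lambda>x. f x j) x"
    have "has_pd i (\<lambda>x. F (f x)) x (?h x)" if x: "x \<in> V" for x
    proof -
      have "((\<lambda>t. F (f (x(i := t)))) has_real_derivative
          (\<Sum>j<n. pd j F (f (x(i := x i))) * pd i (\<lambda>x. f x j) x)) (at (x i))"
      proof (rule chain_rule[OF U])
        show "f (x(i := x i)) \<in> U" using x f by auto
        show "\<And>j y. j < n \<Longrightarrow> y \<in> U \<Longrightarrow> has_pd j F y (pd j F y)" using F by blast
        show "\<And>j. j < n \<Longrightarrow> continuous_on U (pd j F)" using F C_k_continuous[OF U] by blast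
        show "\<And>j. j < n \<Longrightarrow> ((\<lambda>t. f (x(i := t)) j) has_real_derivative pd i (\<lambda>x. f x j) x) (at (x i))"
          using Suc.prems(1) i x unfolding C_k_Suc[OF V] has_pd_def by blast
        show "\<forall>\<^sub>F t in nhds (x i). f (x(i := t)) \<in> euc n"
          using eventually_update_in_open[OF V x i] by eventually_elim (use fe in auto)
      qed
      then show ?thesis by (simp add: has_pd_def)
    qed
    moreover have "C_k m k V ?h"
    proof (rule C_k_sum[OF V])
      fix j assume "j \<in> {..<n}"
      then have j: "j < n" by simp
      have "C_k n k U (pd j F)" using F j by blast
      from Suc.IH[OF fj this] have "C_k m k V (\<lambda>x. pd j F (f x))" .
      moreover have "C_k m k V (pd i (\<lambda>x. f x j))"
        using Suc.prems(1)[OF j] i unfolding C_k_Suc[OF V] by blast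
      ultimately show "C_k m k V (\<lambda>x. pd j F (f x) * pd i (\<lambda>x. f x j) x)" by (rule C_k_mult[OF V])
    qed simp
    ultimately show "\<exists>g. (\<forall>x\<in>V. has_pd i (\<lambda>x. F (f x)) x (g x)) \<and> C_k m k V g"
      by (intro exI[of _ ?h]) blast
  qed
qed

section \<open>Infinitely differentiable functions\<close>

lemma C_infinity_cong:
  "open_in_Rn n U \<Longrightarrow> (\<And>y. y \<in> U \<Longrightarrow> f y = g y) \<Longrightarrow> C_infinity n U f \<longleftrightarrow> C_infinity n U g"
  unfolding C_infinity_def using C_k_cong by blast

lemma C_infinity_subset:
  "open_in_Rn n U \<Longrightarrow> open_in_Rn n V \<Longrightarrow> V \<subseteq> U \<Longrightarrow> C_infinity n U f \<Longrightarrow> C_infinity n V f"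
  unfolding C_infinity_def using C_k_subset by blast

lemma C_infinity_local:
  assumes "open_in_Rn n U"
    and "\<And>x. x \<in> U \<Longrightarrow> \<exists>W. open_in_Rn n W \<and> x \<in> W \<and> W \<subseteq> U \<and> C_infinity n W f"
  shows "C_infinity n U f"
  unfolding C_infinity_def
  by (intro allI C_k_local[OF assms(1)]) (meson C_infinity_def assms(2))

lemma C_infinity_const: "open_in_Rn n U \<Longrightarrow> C_infinity n U (\<lambda>x. c)"
  by (simp add: C_infinity_def C_k_const)

lemma C_infinity_coord: "open_in_Rn n U \<Longrightarrow> C_infinity n U (\<lambda>x. x i)"
  by (simp add: C_infinity_def C_k_coord)

lemma C_infinity_compose:
  assumes "open_in_Rn m V" "open_in_Rn n U" "f ` V \<subseteq> U"
    and "\<And>j. j < n \<Longrightarrow> C_infinity m V (\<lambda>x. f x j)" "C_infinity n U F"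
  shows "C_infinity m V (\<lambda>x. F (f x))"
  unfolding C_infinity_def
proof
  fix k show "C_k m k V (\<lambda>x. F (f x))"
  proof (rule C_k_compose[OF assms(1-3)])
    show "C_k m k V (\<lambda>x. f x j)" if "j < n" for j
      using assms(4)[OF that] unfolding C_infinity_def by (rule spec)
    show "C_k n k U F" using assms(5) unfolding C_infinity_def by (rule spec)
  qed
qed

lemma C_infinity_continuous: "open_in_Rn n U \<Longrightarrow> C_infinity n U f \<Longrightarrow> continuous_on U f"
  using C_infinity_def C_k_continuous by blast

lemma C_infinity_pd:
  assumes "open_in_Rn n U" "C_infinity n U f" "i < n"
  shows "C_infinity n U (pd i f)" "x \<in> U \<Longrightarrow> has_pd i f x (pd i f x)"
proof -
  have "C_k n (Suc k) U f" for k using assms(2) by (simp add: C_infinity_def)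
  then have *: "(\<forall>x\<in>U. has_pd i f x (pd i f x)) \<and> C_k n k U (pd i f)" for k
    using assms(3) by (simp add: C_k_Suc[OF assms(1)])
  show "C_infinity n U (pd i f)" using * by (simp add: C_infinity_def)
  show "x \<in> U \<Longrightarrow> has_pd i f x (pd i f x)" using * by blast
qed

text \<open>Proves smoothness without counting orders. It serves for weighted series and for jet
  families, where the derivative is an object of the same kind as the function but no formula for
  all orders is at hand.\<close>

lemma C_infinity_coinduct:
  assumes U: "open_in_Rn n U" and "P f"
    and cont: "\<And>f. P f \<Longrightarrow> continuous_on U f"
    and der: "\<And>f i. P f \<Longrightarrow> i < n \<Longrightarrow> \<exists>g. (\<forall>x\<in>U. has_pd i f x (g x)) \<and> P g"
  shows "C_infinity n U f"
proof -
  have "C_k n k U f" if "P f" for k f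
    using that
  proof (induction k arbitrary: f)
    case 0 then show ?case using cont C_k_0[OF U] by blast
  next
    case (Suc k)
    show ?case by (rule C_k_SucI[OF U cont[OF Suc.prems]]) (use der Suc in blast)
  qed
  then show ?thesis using \<open>P f\<close> unfolding C_infinity_def by blast
qed

section \<open>Uniform boundedness and smooth series\<close>

text \<open>Comparison with a geometric series; 3/2 is the sum of all 3^-k.\<close>

lemma summable_third_bounded:
  fixes a b :: "nat \<Rightarrow> real"
  assumes "\<And>k. \<bar>a k\<bar> \<le> (1/3) ^ k" "\<And>k. \<bar>b k\<bar> \<le> C"
  shows "summable (\<lambda>k. a k * b k)" "\<bar>\<Sum>k. a k * b k\<bar> \<le> 3/2 * C"
proof -
  have C: "C \<ge> 0" using assms(2)[of 0] by linarith
  have g: "(\<lambda>k. (1/3::real) ^ k * C) sums (3/2 * C)"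
    using sums_mult2[OF geometric_sums[of "1/3::real"], of C] by simp
  have le: "norm (a k * b k) \<le> (1/3) ^ k * C" for k
    using mult_mono[OF assms(1)[of k] assms(2)[of k]] by (simp add: abs_mult)
  show "summable (\<lambda>k. a k * b k)"
    by (rule summable_comparison_test'[OF sums_summable[OF g], of 0]) (use le in auto)
  have "norm (\<Sum>k. a k * b k) \<le> (\<Sum>k. (1/3) ^ k * C)"
    by (rule norm_suminf_le[OF le sums_summable[OF g]])
  then show "\<bar>\<Sum>k. a k * b k\<bar> \<le> 3/2 * C" using sums_unique[OF g] by simp
qed

text \<open>
  The weights \<open>\<plusminus>3^-k\<close> with well-chosen signs are enough to run the gliding hump argument.
\<close>

lemma uniform_boundedness_points:
  fixes T :: "'s \<Rightarrow> 'k \<Rightarrow> real"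
  assumes bdd: "\<And>s. s \<in> S \<Longrightarrow> \<exists>C. \<forall>w\<in>K. \<bar>T s w\<bar> \<le> C"
    and weak: "\<And>a w. (\<And>k. \<bar>a k\<bar> \<le> (1/3) ^ k) \<Longrightarrow> (\<And>k::nat. w k \<in> K) \<Longrightarrow>
      \<exists>C. \<forall>s\<in>S. \<bar>\<Sum>k. a k * T s (w k)\<bar> \<le> C"
  shows "\<exists>C. \<forall>s\<in>S. \<forall>w\<in>K. \<bar>T s w\<bar> \<le> C"
proof (rule ccontr)
  assume neg: "\<not> ?thesis"
  \<comment> \<open>The supremum of \<open>\<bar>T s v\<bar>\<close> over \<open>K\<close> need not
    be attained, so \<open>w\<close> is chosen to reach more than 2/3 of it; this is the factor
    3/2.\<close>
  have "\<exists>s w. s \<in> S \<and> w \<in> K \<and> \<bar>T s w\<bar> > C \<and> (\<forall>v\<in>K. \<bar>T s v\<bar> \<le> 3/2 * \<bar>T s w\<bar>)" for C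
  proof -
    obtain s w0 where s: "s \<in> S" and w0: "w0 \<in> K" "\<bar>T s w0\<bar> > max C 0"
      using neg by (meson not_le)
    define M where "M = (SUP v\<in>K. \<bar>T s v\<bar>)"
    have ba: "bdd_above ((\<lambda>v. \<bar>T s v\<bar>) ` K)" using bdd[OF s] by (auto simp: bdd_above_def)
    have up: "\<And>v. v \<in> K \<Longrightarrow> \<bar>T s v\<bar> \<le> M" unfolding M_def by (rule cSUP_upper[OF _ ba])
    then have M: "max (2/3 * M) C < M" using w0 by fastforce
    then obtain w where w: "w \<in> K" "max (2/3 * M) C < \<bar>T s w\<bar>"
      using less_cSUP_iff[of K "\<lambda>v. \<bar>T s v\<bar>" "max (2/3 * M) C", OF _ ba] w0(1)
      unfolding M_def by auto
    have "\<forall>v\<in>K. \<bar>T s v\<bar> \<le> 3/2 * \<bar>T s w\<bar>" using up w(2) by fastforce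
    then show ?thesis using s w by auto
  qed
  \<comment> \<open>The threshold is fitted to the final estimate: one quarter of the hump
    \<open>(1/3) ^ n * \<bar>T (s n) (w n)\<bar>\<close> survives and is then at least
    \<open>n\<close>.\<close>
  then have "\<forall>n. \<exists>s w. s \<in> S \<and> w \<in> K \<and> \<bar>T s w\<bar> > 4 * 3 ^ n * real n \<and> (\<forall>v\<in>K. \<bar>T s v\<bar> \<le> 3/2 * \<bar>T s w\<bar>)"
    by blast
  then obtain s w where sw: "\<And>n. s n \<in> S" "\<And>n. w n \<in> K" "\<And>n. \<bar>T (s n) (w n)\<bar> > 4 * 3 ^ n * real n"
      "\<And>n v. v \<in> K \<Longrightarrow> \<bar>T (s n) v\<bar> \<le> 3/2 * \<bar>T (s n) (w n)\<bar>"
    by metis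
  \<comment> \<open>The sign is that of the partial sum at \<open>s n\<close> times the new value,
    so the new term never cancels what has accumulated, and the earlier terms need no estimate. As
    the sign depends on the previous partial sum, weights and partial sums are built by one
    recursion.\<close>
  define e where "e n x = (1/3::real) ^ n * (if x (s n) * T (s n) (w n) \<ge> 0 then 1 else -1)" for n and x :: "'s \<Rightarrow> real"
  define x where "x = rec_nat (\<lambda>_. 0) (\<lambda>n y. \<lambda>t. y t + e n y * T t (w n))"
  define a where "a n = e n (x n)" for n
  have x0: "x 0 t = 0" and xS: "x (Suc n) t = x n t + a n * T t (w n)" for n t
    by (simp_all add: x_def a_def)
  have xsum: "x n t = (\<Sum>k<n. a k * T t (w k))" for n t
    by (induction n) (simp_all add: x0 xS)
  have a: "\<bar>a n\<bar> = (1/3) ^ n" for n by (simp add: a_def e_def abs_mult power_abs)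
  obtain C where C: "\<And>t. t \<in> S \<Longrightarrow> \<bar>\<Sum>k. a k * T t (w k)\<bar> \<le> C"
    using weak[of a w] sw(2) a by auto
  obtain n :: nat where n: "real n > C" using reals_Archimedean2 by blast
  define t where "t = \<bar>T (s n) (w n)\<bar>"
  let ?f = "\<lambda>k. a k * T (s n) (w k)"
  have bnd: "\<bar>T (s n) (w k)\<bar> \<le> 3/2 * t" for k using sw(4)[OF sw(2)] by (simp add: t_def)
  have sm: "summable ?f" using a bnd by (intro summable_third_bounded(1)[where C = "3/2 * t"]) auto
  have split: "suminf ?f = (\<Sum>k. ?f (k + Suc n)) + x (Suc n) (s n)"
    using suminf_split_initial_segment[OF sm, of "Suc n"] by (simp add: xsum)
  have tail: "\<bar>\<Sum>k. ?f (k + Suc n)\<bar> \<le> 3/4 * ((1/3) ^ n * t)"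
  proof -
    \<comment> \<open>Multiplication by \<open>3 ^ Suc n\<close> turns the weights of the tail back
      into weights of size 3^-k, to which the bound 3/2 applies.\<close>
    have "\<bar>\<Sum>k. (3 ^ Suc n * a (k + Suc n)) * T (s n) (w (k + Suc n))\<bar> \<le> 3/2 * (3/2 * t)"
      using a bnd by (intro summable_third_bounded(2)) (auto simp: abs_mult power_add power_divide)
    moreover have "(\<Sum>k. (3 ^ Suc n * a (k + Suc n)) * T (s n) (w (k + Suc n))) = 3 ^ Suc n * (\<Sum>k. ?f (k + Suc n))"
      using suminf_mult[OF summable_ignore_initial_segment[OF sm, of "Suc n"], of "3 ^ Suc n"]
      by (simp only: mult.assoc)
    ultimately have "3 ^ Suc n * \<bar>\<Sum>k. ?f (k + Suc n)\<bar> \<le> 9/4 * t" by (simp add: abs_mult)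
    then show ?thesis by (simp add: power_divide field_simps)
  qed
  have "\<bar>x (Suc n) (s n)\<bar> \<ge> (1/3) ^ n * t"
  proof -
    have same: "\<bar>p + q\<bar> = \<bar>p\<bar> + \<bar>q\<bar>" if "p * q \<ge> 0" for p q :: real
      using that by (auto simp: zero_le_mult_iff)
    have big: "\<bar>p + c * (if p * q \<ge> 0 then 1 else -1) * q\<bar> \<ge> c * \<bar>q\<bar>" if "c \<ge> 0" for p q c :: real
    proof (cases "p * q \<ge> 0")
      case True
      then have "p * (c * q) \<ge> 0" using that by (metis mult.left_commute mult_nonneg_nonneg)
      then have "\<bar>p + c * q\<bar> = \<bar>p\<bar> + \<bar>c * q\<bar>" by (rule same)
      then show ?thesis using True that by (simp add: abs_mult)
    next
      case False
      then have "p * (c * q) \<le> 0" using that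
        by (metis mult.left_commute mult_nonneg_nonpos linear)
      then have "\<bar>p - c * q\<bar> = \<bar>p\<bar> + \<bar>c * q\<bar>" using same[of p "- (c * q)"] by simp
      then show ?thesis using False that by (simp add: abs_mult)
    qed
    show ?thesis
      unfolding xS a_def e_def t_def by (rule big) simp
  qed
  then have "\<bar>suminf ?f\<bar> \<ge> 1/4 * ((1/3) ^ n * t)" using split tail by linarith
  moreover have "1/4 * ((1/3) ^ n * t) \<ge> real n"
    using sw(3)[of n] by (simp add: t_def power_divide field_simps)
  ultimately show False using C[OF sw(1)[of n]] n by linarith
qed

section \<open>Splitting points of R^(n+m) into two groups of coordinates\<close>

definition fstn :: "nat \<Rightarrow> (nat \<Rightarrow> real) \<Rightarrow> nat \<Rightarrow> real"
  where "fstn n x = (\<lambda>i. if i < n then x i else 0)"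

definition sndn :: "nat \<Rightarrow> (nat \<Rightarrow> real) \<Rightarrow> nat \<Rightarrow> real"
  where "sndn n x = (\<lambda>i. x (n + i))"

definition join :: "nat \<Rightarrow> (nat \<Rightarrow> real) \<Rightarrow> (nat \<Rightarrow> real) \<Rightarrow> nat \<Rightarrow> real"
  where "join n u w = (\<lambda>i. if i < n then u i else w (i - n))"

text \<open>The product of \<open>U\<close> and \<open>W\<close> inside R^(n+m). If \<open>W\<close>
  lies in \<open>euc m\<close>, the condition on the tail forces the coordinates from
  \<open>n + m\<close> on to vanish.\<close>

definition jprod :: "nat \<Rightarrow> (nat \<Rightarrow> real) set \<Rightarrow> (nat \<Rightarrow> real) set \<Rightarrow> (nat \<Rightarrow> real) set"
  where "jprod n U W = {x. fstn n x \<in> U \<and> sndn n x \<in> W}"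

lemma fstn_join: "u \<in> euc n \<Longrightarrow> fstn n (join n u w) = u"
  by (auto simp: fstn_def join_def euc_def fun_eq_iff)

lemma sndn_join [simp]: "sndn n (join n u w) = w"
  by (auto simp: sndn_def join_def)

lemma fstn_update: "i < n \<Longrightarrow> fstn n (x(i := t)) = (fstn n x)(i := t)"
  by (auto simp: fstn_def)

lemma fstn_update_ge: "\<not> i < n \<Longrightarrow> fstn n (x(i := t)) = fstn n x"
  by (auto simp: fstn_def fun_eq_iff)

lemma sndn_update: "i < n \<Longrightarrow> sndn n (x(i := t)) = sndn n x"
  by (auto simp: sndn_def)

lemma sndn_update_ge: "\<not> i < n \<Longrightarrow> sndn n (x(i := t)) = (sndn n x)(i - n := t)"
  by (auto simp: sndn_def fun_eq_iff)

lemma join_update_left: "i < n \<Longrightarrow> join n (u(i := t)) w = (join n u w)(i := t)"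
  by (auto simp: join_def fun_eq_iff)

lemma join_update_right: "join n u (w(j := t)) = (join n u w)(n + j := t)"
  by (auto simp: join_def fun_eq_iff)

lemma fstn_rbox: "y \<in> rbox (n + m) x r \<Longrightarrow> fstn n y \<in> rbox n (fstn n x) r"
  by (auto simp: fstn_def rbox_def euc_def)

lemma sndn_rbox: "y \<in> rbox (n + m) x r \<Longrightarrow> sndn n y \<in> rbox m (sndn n x) r"
  by (auto simp: sndn_def rbox_def euc_def)

lemma open_in_Rn_jprod:
  assumes U: "open_in_Rn n U" and W: "open_in_Rn m W"
  shows "open_in_Rn (n + m) (jprod n U W)"
  unfolding openin_Euclidean_space_rbox
proof (intro conjI ballI subsetI)
  fix x assume "x \<in> jprod n U W"
  then have x: "fstn n x \<in> U" "sndn n x \<in> W" by (auto simp: jprod_def)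
  have "x i = 0" if "i \<ge> n + m" for i
  proof -
    have "sndn n x (i - n) = 0" using x(2) open_in_Rn_subset[OF W] that by (auto simp: euc_def)
    then show ?thesis using that by (simp add: sndn_def)
  qed
  then show "x \<in> euc (n + m)" by (simp add: euc_def)
  obtain r s where r: "r > 0" "rbox n (fstn n x) r \<subseteq> U" and s: "s > 0" "rbox m (sndn n x) s \<subseteq> W"
    using x U W unfolding openin_Euclidean_space_rbox by meson
  have "rbox (n + m) x (min r s) \<subseteq> jprod n U W"
  proof
    fix y assume y: "y \<in> rbox (n + m) x (min r s)"
    have "fstn n y \<in> rbox n (fstn n x) r" "sndn n y \<in> rbox m (sndn n x) s"
      using fstn_rbox[OF y] sndn_rbox[OF y] rbox_mono min.cobounded1 min.cobounded2 by blast+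
    then show "y \<in> jprod n U W" using r s by (auto simp: jprod_def)
  qed
  then show "\<exists>r>0. rbox (n + m) x r \<subseteq> jprod n U W" using r s by (meson min_less_iff_conj)
qed

lemma join_in_jprod: "u \<in> U \<Longrightarrow> w \<in> W \<Longrightarrow> U \<subseteq> euc n \<Longrightarrow> join n u w \<in> jprod n U W"
  using fstn_join by (auto simp: jprod_def)

lemma continuous_on_join: "continuous_on S (\<lambda>(u, w). join n u w)"
proof (rule continuous_on_coordinatewise_then_product)
  fix i
  have 1: "continuous_on S (\<lambda>p. fst p i)" for i
    by (rule continuous_on_product_then_coordinatewise[OF continuous_on_fst[OF continuous_on_id]])
  have 2: "continuous_on S (\<lambda>p. snd p i)" for i
    by (rule continuous_on_product_then_coordinatewise[OF continuous_on_snd[OF continuous_on_id]])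
  show "continuous_on S (\<lambda>p. (case p of (u, w) \<Rightarrow> join n u w) i)"
    using 1[of i] 2[of "i - n"] by (cases "i < n") (simp_all add: join_def case_prod_unfold)
qed

lemma continuous_on_compact_bound:
  fixes f :: "'a::topological_space \<Rightarrow> real"
  assumes "compact K" "continuous_on K f"
  shows "\<exists>C. \<forall>x\<in>K. \<bar>f x\<bar> \<le> C"
proof -
  have "bounded (f ` K)" using compact_continuous_image[OF assms(2,1)] by (rule compact_imp_bounded)
  then show ?thesis by (auto simp: bounded_iff)
qed

lemma open_neighbourhood_in_rbox:
  assumes "x \<in> euc n" "r > 0"
  shows "\<exists>W. open_in_Rn n W \<and> x \<in> W \<and> W \<subseteq> rbox n x r"
proof -
  let ?W = "{y \<in> euc n. \<forall>i<n. \<bar>y i - x i\<bar> < r}"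
  have "open_in_Rn n ?W"
    unfolding openin_Euclidean_space_rbox
  proof (intro conjI ballI)
    fix y assume y: "y \<in> ?W"
    define d where "d = Min (insert 1 ((\<lambda>i. r - \<bar>y i - x i\<bar>) ` {..<n}))"
    have d: "d > 0" "\<And>i. i < n \<Longrightarrow> d \<le> r - \<bar>y i - x i\<bar>" using y by (auto simp: d_def Min_gr_iff)
    have "rbox n y (d/2) \<subseteq> ?W"
    proof
      fix z assume z: "z \<in> rbox n y (d/2)"
      have "\<bar>z i - x i\<bar> < r" if i: "i < n" for i
      proof -
        have "\<bar>z i - y i\<bar> \<le> d/2" using z i by (simp add: rbox_def)
        then show ?thesis using d(2)[OF i] d(1) by linarith
      qed
      then show "z \<in> ?W" using z by (simp add: rbox_def)
    qed
    then show "\<exists>r>0. rbox n y r \<subseteq> ?W" using d(1) by (intro exI[of _ "d/2"]) auto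
  qed auto
  then show ?thesis using assms by (intro exI[of _ ?W]) (auto simp: rbox_def)
qed

text \<open>Uniform estimates are available on compact sets only; this passes from uniform limits on
  boxes to continuity on an open set.\<close>

lemma continuous_on_if_rboxes:
  fixes f :: "(nat \<Rightarrow> real) \<Rightarrow> real"
  assumes U: "open_in_Rn n U"
    and box: "\<And>x r. x \<in> U \<Longrightarrow> r > 0 \<Longrightarrow> rbox n x r \<subseteq> U \<Longrightarrow> continuous_on (rbox n x r) f"
  shows "continuous_on U f"
proof (rule continuous_on_local_Rn[OF U])
  fix x assume x: "x \<in> U"
  then obtain r where r: "r > 0" "rbox n x r \<subseteq> U" using U openin_Euclidean_space_rbox by blast
  moreover obtain W where "open_in_Rn n W" "x \<in> W" "W \<subseteq> rbox n x r"
    using open_neighbourhood_in_rbox[of x n r] x r(1) open_in_Rn_subset[OF U] by blast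
  ultimately show "\<exists>W. open_in_Rn n W \<and> x \<in> W \<and> W \<subseteq> U \<and> continuous_on W f"
    using box[OF x r] by (meson continuous_on_subset order_trans)
qed

text \<open>On a compact box of parameters the terms, and likewise their derivatives in
  \<open>u\<close>, are bounded independently of \<open>k\<close>. The series and its termwise
  derivatives thus converge uniformly there. This is the source of smoothness, along plots, of the
  functionals on the function space.\<close>

lemma C_infinity_series:
  assumes P: "open_in_Rn n P" and W: "open_in_Rn m W" and K: "compact K" "K \<subseteq> W"
    and f: "C_infinity (n + m) (jprod n P W) f"
    and w: "\<And>k. w k \<in> K" and a: "\<And>k. \<bar>a k\<bar> \<le> (1/3) ^ k"
  shows "C_infinity n P (\<lambda>u. \<Sum>k. a k * f (join n u (w k)))"
proof -
  note J = open_in_Rn_jprod[OF P W]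
  have Pe: "P \<subseteq> euc n" by (rule open_in_Rn_subset[OF P])
  \<comment> \<open>For all \<open>k\<close> and all \<open>u\<close> in the box the points
    \<open>join n u (w k)\<close> lie in one compact set, the image of the box times
    \<open>K\<close>.\<close>
  have bnd: "\<exists>M. \<forall>u\<in>rbox n x r. \<forall>k. \<bar>g (join n u (w k))\<bar> \<le> M"
    if g: "continuous_on (jprod n P W) g" and r: "rbox n x r \<subseteq> P" for g :: "(nat \<Rightarrow> real) \<Rightarrow> real" and x r
  proof -
    let ?C = "(\<lambda>(u, w). join n u w) ` (rbox n x r \<times> K)"
    have c: "compact ?C"
      by (intro compact_continuous_image continuous_on_join compact_Times compact_rbox K(1))
    have sub: "?C \<subseteq> jprod n P W" using r K(2) Pe by (auto intro!: join_in_jprod)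
    obtain M where "\<forall>y\<in>?C. \<bar>g y\<bar> \<le> M"
      using continuous_on_compact_bound[OF c continuous_on_subset[OF g sub]] by blast
    then show ?thesis using w by (intro exI[of _ M]) (auto simp: image_iff)
  qed
  have sM: "summable (\<lambda>k. (1/3) ^ k * M)" for M :: real
    by (intro summable_mult2 summable_geometric) simp
  have le: "norm (a k * y) \<le> (1/3) ^ k * M" if "\<bar>y\<bar> \<le> M" for k y M
    using mult_mono[OF a[of k] that] by (simp add: abs_mult)
  \<comment> \<open>The points and the weights stay fixed while the summand varies: differentiating
    such a sum replaces \<open>f\<close> by \<open>pd i f\<close>.\<close>
  define Q where "Q F \<longleftrightarrow> (\<exists>f. C_infinity (n + m) (jprod n P W) f \<and>
    F = (\<lambda>u. \<Sum>k. a k * f (join n u (w k))))" for F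
  show ?thesis
  proof (rule C_infinity_coinduct[OF P, where P = Q])
    show "Q (\<lambda>u. \<Sum>k. a k * f (join n u (w k)))" using f by (auto simp: Q_def)
  next
    fix F assume "Q F"
    then obtain f where f: "C_infinity (n + m) (jprod n P W) f"
      and F: "F = (\<lambda>u. \<Sum>k. a k * f (join n u (w k)))" by (auto simp: Q_def)
    note fc = C_infinity_continuous[OF J f]
    show "continuous_on P F"
    proof (rule continuous_on_if_rboxes[OF P])
      fix x r assume r: "rbox n x r \<subseteq> P"
      obtain M where M: "\<And>u k. u\<in>rbox n x r \<Longrightarrow> \<bar>f (join n u (w k))\<bar> \<le> M" using bnd[OF fc r] by blast
      have ul: "uniform_limit (rbox n x r) (\<lambda>N u. \<Sum>k<N. a k * f (join n u (w k))) F sequentially"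
        unfolding F by (rule Weierstrass_m_test[OF le[OF M] sM])
      have "continuous_on (rbox n x r) (\<lambda>u. f (join n u (w k)))" for k
      proof (rule continuous_on_compose2[OF fc])
        have "continuous_on (rbox n x r) (\<lambda>u. (\<lambda>(u, w). join n u w) (u, w k))"
          by (rule continuous_on_compose2[OF continuous_on_join[of UNIV]]) (auto intro: continuous_intros)
        then show "continuous_on (rbox n x r) (\<lambda>u. join n u (w k))" by simp
        show "(\<lambda>u. join n u (w k)) ` rbox n x r \<subseteq> jprod n P W"
          using r w K(2) Pe by (auto intro!: join_in_jprod)
      qed
      then show "continuous_on (rbox n x r) F"
        by (intro uniform_limit_theorem[OF _ ul] always_eventually allI continuous_on_sum
            continuous_on_mult continuous_on_const) auto
    qed
    fix i assume i: "i < n"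
    let ?G = "\<lambda>u. \<Sum>k. a k * pd i f (join n u (w k))"
    have pdf: "C_infinity (n + m) (jprod n P W) (pd i f)" using C_infinity_pd(1)[OF J f] i by simp
    have "has_pd i F x (?G x)" if x: "x \<in> P" for x
    proof -
      obtain r where r: "r > 0" "rbox n x r \<subseteq> P" using x P openin_Euclidean_space_rbox by blast
      have xr: "x \<in> rbox n x r" using x Pe r(1) by (intro center_in_rbox) auto
      have upd: "x(i := t) \<in> rbox n x r" if "t \<in> cball (x i) r" for t
        using that by (intro rbox_update[OF xr i]) (simp add: dist_real_def abs_minus_commute)
      obtain M where M: "\<And>u k. u\<in>rbox n x r \<Longrightarrow> \<bar>pd i f (join n u (w k))\<bar> \<le> M"
        using bnd[OF C_infinity_continuous[OF J pdf] r(2)] by blast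
      obtain M' where M': "\<And>u k. u\<in>rbox n x r \<Longrightarrow> \<bar>f (join n u (w k))\<bar> \<le> M'"
        using bnd[OF fc r(2)] by blast
      have "((\<lambda>t. \<Sum>k. a k * f (join n (x(i := t)) (w k))) has_real_derivative
          (\<Sum>k. a k * pd i f (join n (x(i := x i)) (w k)))) (at (x i))"
      proof (rule has_field_derivative_series'(2))
        show "convex (cball (x i) r)" by (rule convex_cball)
        show "x i \<in> cball (x i) r" "x i \<in> interior (cball (x i) r)" using r(1) by auto
        show "summable (\<lambda>k. a k * f (join n (x(i := x i)) (w k)))"
          using summable_third_bounded(1)[OF a M'[OF xr]] by simp
        show "uniformly_convergent_on (cball (x i) r) (\<lambda>N t. \<Sum>k<N. a k * pd i f (join n (x(i := t)) (w k)))"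
          by (rule Weierstrass_m_test'[OF le[OF M[OF upd]] sM])
        fix k t assume t: "t \<in> cball (x i) r"
        have "join n (x(i := t)) (w k) \<in> jprod n P W"
          using upd[OF t] r(2) w K(2) Pe by (intro join_in_jprod) auto
        then have "has_pd i f (join n (x(i := t)) (w k)) (pd i f (join n (x(i := t)) (w k)))"
          using C_infinity_pd(2)[OF J f] i by simp
        then have "((\<lambda>t. f (join n (x(i := t)) (w k))) has_real_derivative pd i f (join n (x(i := t)) (w k))) (at t)"
          using i by (simp add: has_pd_def join_update_left)
        then show "((\<lambda>t. a k * f (join n (x(i := t)) (w k))) has_real_derivative
            a k * pd i f (join n (x(i := t)) (w k))) (at t within cball (x i) r)"
          by (rule has_field_derivative_at_within[OF DERIV_cmult])
      qed
      then show ?thesis by (simp add: has_pd_def F)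
    qed
    moreover have "Q ?G" using pdf by (auto simp: Q_def)
    ultimately show "\<exists>g. (\<forall>x\<in>P. has_pd i F x (g x)) \<and> Q g" by (intro exI[of _ ?G]) blast
  qed
qed

text \<open>The mean value inequality along the segment from \<open>x\<close> to \<open>y\<close>,
  which stays in the convex box. The hypothesis \<open>x \<in> rbox n x r\<close> amounts to
  \<open>x \<in> euc n\<close> and, for positive \<open>n\<close>, to
  \<open>0 \<le> r\<close>.\<close>

lemma C_infinity_Lipschitz_at:
  assumes U: "open_in_Rn n U" and F: "C_infinity n U F" and r: "rbox n x r \<subseteq> U" and x: "x \<in> rbox n x r"
  shows "\<exists>C. \<forall>y\<in>rbox n x r. \<bar>F y - F x\<bar> \<le> C * (\<Sum>i<n. \<bar>y i - x i\<bar>)"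
proof -
  have "\<exists>C. \<forall>y\<in>rbox n x r. \<bar>pd i F y\<bar> \<le> C" if "i < n" for i
    using C_infinity_continuous[OF U C_infinity_pd(1)[OF U F that]] continuous_on_subset r
    by (intro continuous_on_compact_bound[OF compact_rbox]) blast
  then obtain D where D: "\<And>i y. i < n \<Longrightarrow> y\<in>rbox n x r \<Longrightarrow> \<bar>pd i F y\<bar> \<le> D i" by metis
  define C where "C = (\<Sum>i<n. \<bar>D i\<bar>)"
  have DC: "\<bar>pd i F y\<bar> \<le> C" if "i < n" "y \<in> rbox n x r" for i y
  proof -
    have "\<bar>D i\<bar> \<le> C" unfolding C_def using that(1) by (intro member_le_sum) auto
    then show ?thesis using D[OF that] by linarith
  qed
  have "\<bar>F y - F x\<bar> \<le> C * (\<Sum>i<n. \<bar>y i - x i\<bar>)" if y: "y \<in> rbox n x r" for y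
  proof -
    define c where "c t = (\<lambda>i. x i + t * (y i - x i))" for t
    have ce: "c t \<in> euc n" for t using x y by (auto simp: c_def euc_def rbox_def)
    have cb: "c t \<in> rbox n x r" if t: "t \<in> {0..1}" for t
    proof -
      have "\<bar>c t i - x i\<bar> \<le> r" if "i < n" for i
      proof -
        have "\<bar>c t i - x i\<bar> = t * \<bar>y i - x i\<bar>" using t by (simp add: c_def abs_mult)
        also have "\<dots> \<le> 1 * \<bar>y i - x i\<bar>" using t by (intro mult_right_mono) auto
        also have "\<dots> \<le> r" using y \<open>i < n\<close> by (simp add: rbox_def)
        finally show ?thesis .
      qed
      then show ?thesis using ce by (simp add: rbox_def)
    qed
    let ?d = "\<lambda>t. \<Sum>i<n. pd i F (c t) * (y i - x i)"
    have "((\<lambda>t. F (c t)) has_real_derivative ?d t) (at t within {0..1})" if t: "t \<in> {0..1}" for t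
    proof (rule has_field_derivative_at_within, rule chain_rule[OF U])
      show "c t \<in> U" using cb[OF t] r by blast
      show "\<And>j y. j < n \<Longrightarrow> y \<in> U \<Longrightarrow> has_pd j F y (pd j F y)" by (rule C_infinity_pd(2)[OF U F])
      show "\<And>j. j < n \<Longrightarrow> continuous_on U (pd j F)"
        by (rule C_infinity_continuous[OF U C_infinity_pd(1)[OF U F]])
      show "\<And>j. j < n \<Longrightarrow> ((\<lambda>t. c t j) has_real_derivative y j - x j) (at t)"
        unfolding c_def by (auto intro!: derivative_eq_intros)
      show "\<forall>\<^sub>F t in nhds t. c t \<in> euc n" using ce by simp
    qed
    moreover have "norm (?d t) \<le> C * (\<Sum>i<n. \<bar>y i - x i\<bar>)" if t: "t \<in> {0..1}" for t
    proof -
      have "norm (?d t) \<le> (\<Sum>i<n. norm (pd i F (c t) * (y i - x i)))" by (rule norm_sum)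
      also have "\<dots> \<le> (\<Sum>i<n. C * \<bar>y i - x i\<bar>)"
        using DC[OF _ cb[OF t]] by (intro sum_mono) (auto simp: abs_mult intro: mult_right_mono)
      finally show ?thesis by (simp add: sum_distrib_left)
    qed
    ultimately have "norm (F (c 1) - F (c 0)) \<le> C * (\<Sum>i<n. \<bar>y i - x i\<bar>) * norm (1 - 0 :: real)"
      by (intro field_differentiable_bound[of "{0..1}" "\<lambda>t. F (c t)" ?d]) auto
    then show ?thesis by (simp add: c_def)
  qed
  then show ?thesis by blast
qed

text \<open>The mean value inequality twice: a bound on the second derivative controls the variation
  of \<open>pd i F\<close>, which in turn controls \<open>F\<close> minus its linear part. A rate
  linear in \<open>s\<close>, unlike bare convergence, is a boundedness statement, the kind that
  uniform boundedness can make uniform in \<open>w\<close>.\<close>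

lemma C_infinity_difference_quotient:
  assumes U: "open_in_Rn n U" and F: "C_infinity n U F" and r: "rbox n x r \<subseteq> U" and x: "x \<in> rbox n x r"
    and i: "i < n"
  shows "\<exists>M. \<forall>s. s \<noteq> 0 \<longrightarrow> \<bar>s\<bar> \<le> r \<longrightarrow> \<bar>(F (x(i := x i + s)) - F x) / s - pd i F x\<bar> \<le> M * \<bar>s\<bar>"
proof -
  note F1 = C_infinity_pd[OF U F i] and F2 = C_infinity_pd[OF U C_infinity_pd(1)[OF U F i] i]
  obtain M where M: "\<And>y. y \<in> rbox n x r \<Longrightarrow> \<bar>pd i (pd i F) y\<bar> \<le> M"
    using continuous_on_compact_bound[OF compact_rbox] continuous_on_subset[OF C_infinity_continuous[OF U F2(1)] r]
    by metis
  have "\<bar>(F (x(i := x i + s)) - F x) / s - pd i F x\<bar> \<le> M * \<bar>s\<bar>" if s: "s \<noteq> 0" "\<bar>s\<bar> \<le> r" for s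
  proof -
    let ?S = "cball (x i) \<bar>s\<bar>"
    have upd: "x(i := t) \<in> rbox n x r" if "t \<in> ?S" for t
      using that s by (intro rbox_update[OF x i]) (simp add: dist_real_def abs_minus_commute)
    have d1: "((\<lambda>t. F (x(i := t))) has_real_derivative pd i F (x(i := t))) (at t)" if "t \<in> ?S" for t
      using F1(2)[of "x(i := t)"] upd[OF that] r by (auto simp: has_pd_def)
    have d2: "((\<lambda>t. pd i F (x(i := t))) has_real_derivative pd i (pd i F) (x(i := t))) (at t)" if "t \<in> ?S" for t
      using F2(2)[of "x(i := t)"] upd[OF that] r by (auto simp: has_pd_def)
    have l: "\<bar>pd i F (x(i := t)) - pd i F x\<bar> \<le> M * \<bar>s\<bar>" if t: "t \<in> ?S" for t
    proof -
      have "norm (pd i F (x(i := t)) - pd i F (x(i := x i))) \<le> M * norm (t - x i)"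
      proof (rule field_differentiable_bound[of ?S "\<lambda>t. pd i F (x(i := t))" "\<lambda>t. pd i (pd i F) (x(i := t))"])
        fix t assume t: "t \<in> ?S"
        show "((\<lambda>t. pd i F (x(i := t))) has_real_derivative pd i (pd i F) (x(i := t))) (at t within ?S)"
          by (rule has_field_derivative_at_within[OF d2[OF t]])
        show "norm (pd i (pd i F) (x(i := t))) \<le> M" using M[OF upd[OF t]] by simp
      qed (use t in auto)
      moreover have "M * norm (t - x i) \<le> M * \<bar>s\<bar>"
        using t M[OF x] by (intro mult_left_mono) (auto simp: dist_real_def abs_minus_commute)
      ultimately show ?thesis by simp
    qed
    let ?h = "\<lambda>t. F (x(i := t)) - pd i F x * t"
    have "norm (?h (x i + s) - ?h (x i)) \<le> M * \<bar>s\<bar> * norm (x i + s - x i)"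
    proof (rule field_differentiable_bound[of ?S ?h "\<lambda>t. pd i F (x(i := t)) - pd i F x"])
      fix t assume t: "t \<in> ?S"
      from DERIV_diff[OF d1[OF t] DERIV_cmult[OF DERIV_ident, of "pd i F x"]]
      have "(?h has_real_derivative pd i F (x(i := t)) - pd i F x) (at t)" by simp
      then show "(?h has_real_derivative pd i F (x(i := t)) - pd i F x) (at t within ?S)"
        by (rule has_field_derivative_at_within)
      show "norm (pd i F (x(i := t)) - pd i F x) \<le> M * \<bar>s\<bar>" using l[OF t] by simp
    qed (auto simp: dist_real_def)
    then have "\<bar>F (x(i := x i + s)) - F x - pd i F x * s\<bar> \<le> M * \<bar>s\<bar> * \<bar>s\<bar>" by (simp add: algebra_simps)
    moreover have "(F (x(i := x i + s)) - F x) / s - pd i F x = (F (x(i := x i + s)) - F x - pd i F x * s) / s"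
      using s by (simp add: diff_divide_distrib)
    ultimately show ?thesis using s by (simp add: abs_divide pos_divide_le_eq)
  qed
  then show ?thesis by blast
qed

section \<open>Weakly smooth families of jets\<close>

text \<open>
  \<open>H \<alpha> u\<close> plays the role of the iterated partial derivative, along the list \<open>\<alpha>\<close> of directions in \<open>w\<close>,
  of a function \<open>H [] u w\<close>. Dependence on \<open>u\<close> is constrained only through countable combinations of
  point evaluations; no joint regularity in \<open>(u, w)\<close> is assumed.
\<close>

definition jet_smooth ::
    "nat \<Rightarrow> nat \<Rightarrow> (nat \<Rightarrow> real) set \<Rightarrow> (nat \<Rightarrow> real) set \<Rightarrow>
     (nat list \<Rightarrow> (nat \<Rightarrow> real) \<Rightarrow> (nat \<Rightarrow> real) \<Rightarrow> real) \<Rightarrow> bool"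
  where "jet_smooth n m U W H \<longleftrightarrow>
    (\<forall>u\<in>U. \<forall>\<alpha>. continuous_on W (H \<alpha> u) \<and>
       (\<forall>j<m. \<forall>w\<in>W. has_pd j (H \<alpha> u) w (H (j # \<alpha>) u w))) \<and>
    (\<forall>\<alpha> K w a. compact K \<longrightarrow> K \<subseteq> W \<longrightarrow> (\<forall>k. w k \<in> K) \<longrightarrow> (\<forall>k. \<bar>a k\<bar> \<le> (1/3) ^ k) \<longrightarrow>
       C_infinity n U (\<lambda>u. \<Sum>k. a k * H \<alpha> u (w k)))"

lemma jet_smoothD:
  assumes "jet_smooth n m U W H"
  shows "u \<in> U \<Longrightarrow> continuous_on W (H \<alpha> u)"
    and "u \<in> U \<Longrightarrow> j < m \<Longrightarrow> v \<in> W \<Longrightarrow> has_pd j (H \<alpha> u) v (H (j # \<alpha>) u v)"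
    and "compact K \<Longrightarrow> K \<subseteq> W \<Longrightarrow> (\<And>k. w k \<in> K) \<Longrightarrow> (\<And>k. \<bar>a k\<bar> \<le> (1/3) ^ k) \<Longrightarrow>
      C_infinity n U (\<lambda>u. \<Sum>k. a k * H \<alpha> u (w k))"
  using assms unfolding jet_smooth_def by blast+

text \<open>New derivatives are put at the head of the list, so fixing the direction
  \<open>j\<close> at the far end makes \<open>H [j]\<close> the base function of another family of
  the same kind.\<close>

lemma jet_smooth_snoc:
  "jet_smooth n m U W H \<Longrightarrow> jet_smooth n m U W (\<lambda>\<alpha>. H (\<alpha> @ [j]))"
  unfolding jet_smooth_def append_Cons by blast

text \<open>A single evaluation is 2/3 of the functional with constant points and weights
  3^-k.\<close>

lemma jet_smooth_C_infinity:
  assumes U: "open_in_Rn n U" and H: "jet_smooth n m U W H" and v: "v \<in> W"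
  shows "C_infinity n U (\<lambda>u. H \<alpha> u v)"
proof -
  have "C_infinity n U (\<lambda>u. \<Sum>k. (1/3) ^ k * H \<alpha> u v)"
    by (rule jet_smoothD(3)[OF H, where K = "{v}"]) (use v in auto)
  moreover have "(\<Sum>k. (1/3) ^ k * H \<alpha> u v) = 3/2 * H \<alpha> u v" for u
    using sums_unique[OF sums_mult2[OF geometric_sums[of "1/3::real"], of "H \<alpha> u v"]] by simp
  ultimately have *: "C_infinity n U (\<lambda>u. 3/2 * H \<alpha> u v)" by simp
  have "C_k n k U (\<lambda>u. 2/3 * (3/2 * H \<alpha> u v))" for k
    by (rule C_k_mult[OF U C_k_const[OF U]]) (use * in \<open>simp add: C_infinity_def\<close>)
  then show ?thesis by (simp add: C_infinity_def)
qed

lemma jet_smooth_bound: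
  assumes "jet_smooth n m U W H" "u \<in> U" "compact K" "K \<subseteq> W"
  shows "\<exists>C. \<forall>w\<in>K. \<bar>H \<alpha> u w\<bar> \<le> C"
  by (rule continuous_on_compact_bound[OF assms(3) continuous_on_subset[OF jet_smoothD(1)[OF assms(1,2)] assms(4)]])

lemma jet_smooth_summable:
  assumes H: "jet_smooth n m U W H" "u \<in> U" "compact K" "K \<subseteq> W"
    and "\<And>k::nat. w k \<in> K" "\<And>k. \<bar>a k\<bar> \<le> (1/3) ^ k"
  shows "summable (\<lambda>k. a k * H \<alpha> u (w k))"
proof -
  obtain C where "\<And>v. v \<in> K \<Longrightarrow> \<bar>H \<alpha> u v\<bar> \<le> C" using jet_smooth_bound[OF H] by blast
  then show ?thesis using assms(5,6) summable_third_bounded(1)[of a "\<lambda>k. H \<alpha> u (w k)"] by blast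
qed

text \<open>Each weighted series is smooth in the parameter, hence Lipschitz at \<open>u\<close>
  with a constant of its own. Uniform boundedness, applied to the quotients by the distance
  \<open>d y\<close>, yields one constant valid for every \<open>w\<close> in
  \<open>K\<close>.\<close>

lemma jet_smooth_uniform_Lipschitz:
  assumes U: "open_in_Rn n U" and H: "jet_smooth n m U W H" and K: "compact K" "K \<subseteq> W"
    and r: "r > 0" "rbox n u r \<subseteq> U" and u: "u \<in> U"
  shows "\<exists>C. \<forall>y\<in>rbox n u r. \<forall>w\<in>K. \<bar>H \<alpha> y w - H \<alpha> u w\<bar> \<le> C * (\<Sum>i<n. \<bar>y i - u i\<bar>)"
proof -
  define d where "d y = (\<Sum>i<n. \<bar>y i - u i\<bar>)" for y
  have ue: "u \<in> euc n" using u open_in_Rn_subset[OF U] by blast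
  have ur: "u \<in> rbox n u r" using center_in_rbox[OF ue] r(1) by simp
  have d0: "d y \<ge> 0" for y by (simp add: d_def sum_nonneg)
  have dz: "y = u" if "d y = 0" "y \<in> rbox n u r" for y
  proof
    fix i
    have "i < n \<Longrightarrow> y i = u i" using that(1) by (simp add: d_def sum_nonneg_eq_0_iff)
    then show "y i = u i" using that(2) ue by (cases "i < n") (auto simp: rbox_def euc_def)
  qed
  have "\<exists>C. \<forall>y\<in>{y \<in> rbox n u r. d y \<noteq> 0}. \<forall>w\<in>K. \<bar>(H \<alpha> y w - H \<alpha> u w) / d y\<bar> \<le> C"
  proof (rule uniform_boundedness_points)
    fix y assume y: "y \<in> {y \<in> rbox n u r. d y \<noteq> 0}"
    then have yU: "y \<in> U" using r by blast
    have "continuous_on K (\<lambda>w. (H \<alpha> y w - H \<alpha> u w) / d y)"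
      using y by (intro continuous_on_divide continuous_on_diff continuous_on_const
        continuous_on_subset[OF jet_smoothD(1)[OF H] K(2)] yU u) auto
    then show "\<exists>C. \<forall>w\<in>K. \<bar>(H \<alpha> y w - H \<alpha> u w) / d y\<bar> \<le> C"
      by (rule continuous_on_compact_bound[OF K(1)])
  next
    fix a w assume a: "\<And>k. \<bar>a k\<bar> \<le> (1/3::real) ^ k" and w: "\<And>k::nat. w k \<in> K"
    define F where "F y = (\<Sum>k. a k * H \<alpha> y (w k))" for y
    have "C_infinity n U F" unfolding F_def by (rule jet_smoothD(3)[OF H K w a])
    from C_infinity_Lipschitz_at[OF U this r(2) ur]
    obtain C where C: "\<And>y. y \<in> rbox n u r \<Longrightarrow> \<bar>F y - F u\<bar> \<le> C * d y" unfolding d_def by blast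
    have "\<bar>\<Sum>k. a k * ((H \<alpha> y (w k) - H \<alpha> u (w k)) / d y)\<bar> \<le> C" if y: "y \<in> rbox n u r" "d y \<noteq> 0" for y
    proof -
      note s = jet_smooth_summable[OF H _ K w a]
      have yU: "y \<in> U" using y r by blast
      have "(\<lambda>k. a k * ((H \<alpha> y (w k) - H \<alpha> u (w k)) / d y)) sums ((F y - F u) / d y)"
        using sums_divide[OF sums_diff[OF summable_sums[OF s[OF yU]] summable_sums[OF s[OF u]]], where c = "d y"]
        by (simp add: F_def right_diff_distrib)
      from sums_unique[OF this, symmetric]
      have "\<bar>\<Sum>k. a k * ((H \<alpha> y (w k) - H \<alpha> u (w k)) / d y)\<bar> = \<bar>F y - F u\<bar> / d y"
        using d0[of y] by (simp only: abs_divide abs_of_nonneg)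
      also have "\<dots> \<le> C" using C[OF y(1)] d0[of y] y(2) by (simp add: pos_divide_le_eq)
      finally show ?thesis .
    qed
    then show "\<exists>C. \<forall>y\<in>{y \<in> rbox n u r. d y \<noteq> 0}. \<bar>\<Sum>k. a k * ((H \<alpha> y (w k) - H \<alpha> u (w k)) / d y)\<bar> \<le> C"
      by blast
  qed
  then obtain C where C: "\<And>y w. y\<in>rbox n u r \<Longrightarrow> d y \<noteq> 0 \<Longrightarrow> w \<in> K \<Longrightarrow> \<bar>(H \<alpha> y w - H \<alpha> u w) / d y\<bar> \<le> C"
    by blast
  have "\<bar>H \<alpha> y w - H \<alpha> u w\<bar> \<le> C * d y" if "y \<in> rbox n u r" "w \<in> K" for y w
  proof (cases "d y = 0")
    case True
    then have "y = u" using dz that(1) by blast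
    then show ?thesis using True by simp
  next
    case False
    then show ?thesis using C[OF that(1) False that(2)] d0[of y] by (simp add: abs_divide pos_divide_le_eq)
  qed
  then show ?thesis unfolding d_def by blast
qed

text \<open>The passage from \<open>x\<close> to \<open>y\<close> splits into a move of the second
  component, covered by continuity of \<open>H \<alpha> u\<close> at the fixed \<open>u\<close>, and
  a move of the first, covered by a Lipschitz constant common to a compact box.\<close>

lemma jet_smooth_jointly_continuous:
  assumes U: "open_in_Rn n U" and W: "open_in_Rn m W" and H: "jet_smooth n m U W H"
  shows "continuous_on (jprod n U W) (\<lambda>x. H \<alpha> (fstn n x) (sndn n x))"
  unfolding continuous_on_rbox_iff[OF open_in_Rn_jprod[OF U W]]
proof (intro ballI allI impI)
  fix x e assume "x \<in> jprod n U W" and e: "(e::real) > 0"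
  then have x: "fstn n x \<in> U" "sndn n x \<in> W" by (auto simp: jprod_def)
  let ?u = "fstn n x" and ?w = "sndn n x"
  obtain s where s: "s > 0" "rbox m ?w s \<subseteq> W" "\<And>v. v \<in> rbox m ?w s \<Longrightarrow> \<bar>H \<alpha> ?u v - H \<alpha> ?u ?w\<bar> < e/2"
    using jet_smoothD(1)[OF H x(1), of \<alpha>] x(2) e unfolding continuous_on_rbox_iff[OF W]
    by (meson half_gt_zero)
  obtain r where r: "r > 0" "rbox n ?u r \<subseteq> U" using x(1) U openin_Euclidean_space_rbox by blast
  obtain C where C: "\<And>y v. y\<in>rbox n ?u r \<Longrightarrow> v \<in> rbox m ?w s \<Longrightarrow>
      \<bar>H \<alpha> y v - H \<alpha> ?u v\<bar> \<le> C * (\<Sum>i<n. \<bar>y i - ?u i\<bar>)"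
    using jet_smooth_uniform_Lipschitz[OF U H compact_rbox s(2) r x(1)] by blast
  \<comment> \<open>Half of \<open>e\<close> is reserved for each move; the 1 in the denominator
    keeps it positive when \<open>C\<close> or \<open>n\<close> is zero.\<close>
  define t where "t = Min {r, s, e / (2 * (\<bar>C\<bar> * real n + 1))}"
  have pos: "e / (2 * (\<bar>C\<bar> * real n + 1)) > 0" using e by (intro divide_pos_pos) (auto intro: add_nonneg_pos)
  have t: "t > 0" "t \<le> r" "t \<le> s" "t \<le> e / (2 * (\<bar>C\<bar> * real n + 1))"
    using r(1) s(1) pos by (auto simp: t_def)
  have "rbox (n + m) x t \<subseteq> jprod n U W \<and>
      (\<forall>y\<in>rbox (n + m) x t. \<bar>H \<alpha> (fstn n y) (sndn n y) - H \<alpha> ?u ?w\<bar> < e)"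
  proof (intro conjI subsetI ballI)
    fix y assume y: "y \<in> rbox (n + m) x t"
    have 1: "fstn n y \<in> rbox n ?u r" "sndn n y \<in> rbox m ?w s"
      using fstn_rbox[OF y] sndn_rbox[OF y] rbox_mono t by blast+
    then show "y \<in> jprod n U W" using r s by (auto simp: jprod_def)
    have "(\<Sum>i<n. \<bar>fstn n y i - ?u i\<bar>) \<le> (\<Sum>i<n. t)"
      using fstn_rbox[OF y] by (intro sum_mono) (auto simp: rbox_def)
    then have "C * (\<Sum>i<n. \<bar>fstn n y i - ?u i\<bar>) \<le> \<bar>C\<bar> * (real n * t)"
      by (intro mult_mono) (auto simp: sum_nonneg)
    also have "\<dots> \<le> (\<bar>C\<bar> * real n + 1) * t" using t(1) by (simp add: algebra_simps)
    also have "\<dots> \<le> e / 2"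
    proof -
      have "2 * (\<bar>C\<bar> * real n + 1) > 0" by (simp add: add_nonneg_pos)
      then show ?thesis using t(4) by (simp add: pos_le_divide_eq algebra_simps)
    qed
    finally have "\<bar>H \<alpha> (fstn n y) (sndn n y) - H \<alpha> ?u (sndn n y)\<bar> \<le> e / 2"
      using C[OF 1] by linarith
    then show "\<bar>H \<alpha> (fstn n y) (sndn n y) - H \<alpha> ?u ?w\<bar> < e" using s(3)[OF 1(2)] by linarith
  qed
  then show "\<exists>r>0. rbox (n + m) x r \<subseteq> jprod n U W \<and>
      (\<forall>y\<in>rbox (n + m) x r. \<bar>H \<alpha> (fstn n y) (sndn n y) - H \<alpha> ?u ?w\<bar> < e)"
    using t(1) by blast
qed

definition jet_pd ::
    "nat \<Rightarrow> (nat list \<Rightarrow> (nat \<Rightarrow> real) \<Rightarrow> (nat \<Rightarrow> real) \<Rightarrow> real) \<Rightarrow>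
     nat list \<Rightarrow> (nat \<Rightarrow> real) \<Rightarrow> (nat \<Rightarrow> real) \<Rightarrow> real"
  where "jet_pd i H \<alpha> u w = pd i (\<lambda>y. H \<alpha> y w) u"

lemma has_pd_quotient_limit:
  assumes "has_pd i F u D"
  shows "((\<lambda>s. (F (u(i := u i + s)) - F u) / s) \<longlongrightarrow> D) (at 0)"
  using assms unfolding has_pd_def DERIV_def by simp

text \<open>
  Uniform boundedness is applied to differences of two difference quotients, because
  \<open>jet_pd i H \<alpha> u\<close> itself is not yet known to be bounded on \<open>K\<close>.
\<close>

lemma jet_smooth_uniform_quotient:
  assumes U: "open_in_Rn n U" and H: "jet_smooth n m U W H" and K: "compact K" "K \<subseteq> W"
    and r: "r > 0" "rbox n u r \<subseteq> U" and u: "u \<in> U" and i: "i < n"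
  shows "\<exists>C. \<forall>s. \<forall>w\<in>K. s \<noteq> 0 \<longrightarrow> \<bar>s\<bar> \<le> r \<longrightarrow>
    \<bar>(H \<alpha> (u(i := u i + s)) w - H \<alpha> u w) / s - jet_pd i H \<alpha> u w\<bar> \<le> C * \<bar>s\<bar>"
proof -
  have ue: "u \<in> euc n" using u open_in_Rn_subset[OF U] by blast
  have ur: "u \<in> rbox n u r" using center_in_rbox[OF ue] r(1) by simp
  have upd: "u(i := u i + s) \<in> U" if "\<bar>s\<bar> \<le> r" for s
    using rbox_update[OF ur i, of "u i + s"] that r(2) by auto
  define q where "q s w = (H \<alpha> (u(i := u i + s)) w - H \<alpha> u w) / s" for s w
  define S where "S = {(s, t). s \<noteq> 0 \<and> t \<noteq> 0 \<and> \<bar>s\<bar> \<le> r \<and> \<bar>t\<bar> \<le> (r::real)}"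
  \<comment> \<open>For every weighted series the two quotients lie within
    \<open>M * \<bar>s\<bar>\<close> and \<open>M * \<bar>t\<bar>\<close> of the same derivative, so
    their difference is bounded on the scale \<open>\<bar>s\<bar> + \<bar>t\<bar>\<close>.\<close>
  define T where "T = (\<lambda>(s, t) w. (q s w - q t w) / (\<bar>s\<bar> + \<bar>t\<bar>))"
  have "\<exists>C. \<forall>p\<in>S. \<forall>w\<in>K. \<bar>T p w\<bar> \<le> C"
  proof (rule uniform_boundedness_points)
    fix p assume "p \<in> S"
    then obtain s t where p: "p = (s, t)" "s \<noteq> 0" "t \<noteq> 0" "\<bar>s\<bar> \<le> r" "\<bar>t\<bar> \<le> r" by (auto simp: S_def)
    have "continuous_on K (T p)"
      unfolding p(1) T_def q_def prod.case using p
      by (intro continuous_on_divide continuous_on_diff continuous_on_const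
        continuous_on_subset[OF jet_smoothD(1)[OF H] K(2)] upd u) auto
    then show "\<exists>C. \<forall>w\<in>K. \<bar>T p w\<bar> \<le> C"
      by (rule continuous_on_compact_bound[OF K(1)])
  next
    fix a w assume a: "\<And>k. \<bar>a k\<bar> \<le> (1/3::real) ^ k" and w: "\<And>k::nat. w k \<in> K"
    define F where "F y = (\<Sum>k. a k * H \<alpha> y (w k))" for y
    have "C_infinity n U F" unfolding F_def by (rule jet_smoothD(3)[OF H K w a])
    from C_infinity_difference_quotient[OF U this r(2) ur i]
    obtain M where M: "\<And>s. s \<noteq> 0 \<Longrightarrow> \<bar>s\<bar> \<le> r \<Longrightarrow> \<bar>(F (u(i := u i + s)) - F u) / s - pd i F u\<bar> \<le> M * \<bar>s\<bar>"
      by blast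
    have "\<bar>\<Sum>k. a k * T p (w k)\<bar> \<le> M" if "p \<in> S" for p
    proof -
      obtain s t where p: "p = (s, t)" "s \<noteq> 0" "t \<noteq> 0" "\<bar>s\<bar> \<le> r" "\<bar>t\<bar> \<le> r"
        using \<open>p \<in> S\<close> by (auto simp: S_def)
      note sm = summable_sums[OF jet_smooth_summable[OF H _ K w a]]
      have q: "(\<lambda>k. a k * q s (w k)) sums ((F (u(i := u i + s)) - F u) / s)" if "\<bar>s\<bar> \<le> r" for s
        using sums_divide[OF sums_diff[OF sm[OF upd[OF that]] sm[OF u]], where c = s]
        by (simp add: F_def q_def right_diff_distrib)
      let ?Q = "\<lambda>s. (F (u(i := u i + s)) - F u) / s"
      have "(\<lambda>k. a k * T p (w k)) sums ((?Q s - ?Q t) / (\<bar>s\<bar> + \<bar>t\<bar>))"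
        using sums_divide[OF sums_diff[OF q[OF p(4)] q[OF p(5)]], where c = "\<bar>s\<bar> + \<bar>t\<bar>"]
        by (simp add: p(1) T_def right_diff_distrib)
      moreover have "\<bar>?Q s - ?Q t\<bar> \<le> M * (\<bar>s\<bar> + \<bar>t\<bar>)"
        using M[OF p(2,4)] M[OF p(3,5)] unfolding distrib_left by linarith
      ultimately show ?thesis using p(2)
        by (simp add: sums_unique[symmetric] abs_divide pos_divide_le_eq)
    qed
    then show "\<exists>C. \<forall>p\<in>S. \<bar>\<Sum>k. a k * T p (w k)\<bar> \<le> C" by blast
  qed
  then obtain C where C: "\<And>p w. p\<in>S \<Longrightarrow> w\<in>K \<Longrightarrow> \<bar>T p w\<bar> \<le> C" by blast
  have "\<bar>q s w - jet_pd i H \<alpha> u w\<bar> \<le> C * \<bar>s\<bar>" if s: "s \<noteq> 0" "\<bar>s\<bar> \<le> r" and w: "w \<in> K" for s w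
  proof -
    \<comment> \<open>Letting \<open>t\<close> tend to 0 in the bound on \<open>T\<close> turns
      \<open>q t w\<close> into the derivative and leaves \<open>C * \<bar>s\<bar>\<close>.\<close>
    have "has_pd i (\<lambda>y. H \<alpha> y w) u (jet_pd i H \<alpha> u w)" unfolding jet_pd_def
      using C_infinity_pd(2)[OF U jet_smooth_C_infinity[OF U H] i u] w K(2) by blast
    then have lim: "((\<lambda>t. q t w) \<longlongrightarrow> jet_pd i H \<alpha> u w) (at 0)"
      unfolding q_def by (rule has_pd_quotient_limit)
    have ev: "\<forall>\<^sub>F t in at 0. \<bar>q s w - q t w\<bar> \<le> C * (\<bar>s\<bar> + \<bar>t\<bar>)"
    proof -
      have "\<forall>\<^sub>F t in at (0::real). t \<noteq> 0 \<and> \<bar>t\<bar> \<le> r"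
        unfolding eventually_at using r(1) by (intro exI[of _ r]) (auto simp: dist_real_def)
      then show ?thesis
      proof eventually_elim
        case (elim t)
        then have "\<bar>T (s, t) w\<bar> \<le> C" using s w by (intro C) (auto simp: S_def)
        then show ?case using s(1) by (simp add: T_def abs_divide pos_divide_le_eq)
      qed
    qed
    show ?thesis
    proof (rule tendsto_le[OF _ _ _ ev])
      show "((\<lambda>t. \<bar>q s w - q t w\<bar>) \<longlongrightarrow> \<bar>q s w - jet_pd i H \<alpha> u w\<bar>) (at 0)"
        by (intro tendsto_intros lim)
      have "((\<lambda>t. C * (\<bar>s\<bar> + \<bar>t\<bar>)) \<longlongrightarrow> C * (\<bar>s\<bar> + \<bar>0\<bar>)) (at 0)" by (intro tendsto_intros)
      then show "((\<lambda>t. C * (\<bar>s\<bar> + \<bar>t\<bar>)) \<longlongrightarrow> C * \<bar>s\<bar>) (at 0)" by simp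
    qed simp
  qed
  then show ?thesis unfolding q_def by blast
qed

text \<open>The difference quotients in \<open>u\<close> converge to
  \<open>jet_pd i H \<alpha> u\<close> uniformly on compact sets, for every \<open>\<alpha>\<close>.
  Each clause of \<open>jet_smooth\<close> passes to such limits: continuity in \<open>w\<close>,
  differentiation in \<open>w\<close>, and the weighted series, whose limit is a derivative of a
  smooth function.\<close>

lemma jet_smooth_jet_pd:
  assumes U: "open_in_Rn n U" and W: "open_in_Rn m W" and H: "jet_smooth n m U W H" and i: "i < n"
  shows "jet_smooth n m U W (jet_pd i H)"
proof -
  \<comment> \<open>One sequence of increments has to serve all \<open>\<alpha>\<close> and
    \<open>K\<close>, because the quotients for \<open>\<alpha>\<close> and for
    \<open>j # \<alpha>\<close> are later compared term by term.\<close>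
  have approx: "\<exists>s. (\<forall>N. s N \<noteq> 0 \<and> u(i := u i + s N) \<in> U) \<and> s \<longlonglongrightarrow> 0 \<and>
      (\<forall>\<alpha> K. compact K \<longrightarrow> K \<subseteq> W \<longrightarrow> (\<exists>C. \<forall>N. \<forall>w\<in>K.
        \<bar>(H \<alpha> (u(i := u i + s N)) w - H \<alpha> u w) / s N - jet_pd i H \<alpha> u w\<bar> \<le> C * \<bar>s N\<bar>))"
    if u: "u \<in> U" for u
  proof -
    obtain r where r: "r > 0" "rbox n u r \<subseteq> U" using u U openin_Euclidean_space_rbox by blast
    have ur: "u \<in> rbox n u r" using center_in_rbox u open_in_Rn_subset[OF U] r(1) by (meson less_imp_le subsetD)
    define s where "s N = r / real (Suc N)" for N
    have s: "s N \<noteq> 0" "\<bar>s N\<bar> \<le> r" for N using r(1) by (auto simp: s_def field_simps)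
    have "s \<longlonglongrightarrow> r * 0" unfolding s_def divide_inverse
      by (intro tendsto_mult tendsto_const LIMSEQ_inverse_real_of_nat)
    then have lim: "s \<longlonglongrightarrow> 0" by simp
    have inU: "u(i := u i + s N) \<in> U" for N
      using rbox_update[OF ur i, of "u i + s N"] s(2)[of N] r(2) by auto
    have quot: "\<exists>C. \<forall>N. \<forall>w\<in>K.
        \<bar>(H \<alpha> (u(i := u i + s N)) w - H \<alpha> u w) / s N - jet_pd i H \<alpha> u w\<bar> \<le> C * \<bar>s N\<bar>"
      if "compact K" "K \<subseteq> W" for \<alpha> K
      using jet_smooth_uniform_quotient[OF U H that r u i, of \<alpha>] s by meson
    show ?thesis
      by (rule exI[of _ s], intro conjI allI impI s(1) inU lim quot)
  qed
  have uni: "\<forall>\<^sub>F N in sequentially. C * \<bar>s N\<bar> < e" if "s \<longlonglongrightarrow> 0" "e > 0" for s :: "nat \<Rightarrow> real" and C e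
  proof -
    have "(\<lambda>N. C * \<bar>s N\<bar>) \<longlonglongrightarrow> C * \<bar>0\<bar>" by (intro tendsto_intros that)
    then show ?thesis using that(2) by (intro order_tendstoD(2)) auto
  qed
  have cont: "continuous_on W (jet_pd i H \<alpha> u)" if u: "u \<in> U" for u \<alpha>
  proof (rule continuous_on_if_rboxes[OF W])
    fix w r assume r: "rbox m w r \<subseteq> W"
    obtain s where s0: "\<forall>N. s N \<noteq> 0 \<and> u(i := u i + s N) \<in> U" and s3: "s \<longlonglongrightarrow> 0"
      and ap0: "\<forall>\<alpha> K. compact K \<longrightarrow> K \<subseteq> W \<longrightarrow> (\<exists>C. \<forall>N. \<forall>w\<in>K.
        \<bar>(H \<alpha> (u(i := u i + s N)) w - H \<alpha> u w) / s N - jet_pd i H \<alpha> u w\<bar> \<le> C * \<bar>s N\<bar>)"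
      using approx[OF u] by (elim exE conjE) (rule that)
    note s = s0[rule_format, THEN conjunct1] s0[rule_format, THEN conjunct2] s3 and ap = ap0[rule_format]
    obtain C where C: "\<And>N v. v \<in> rbox m w r \<Longrightarrow>
        \<bar>(H \<alpha> (u(i := u i + s N)) v - H \<alpha> u v) / s N - jet_pd i H \<alpha> u v\<bar> \<le> C * \<bar>s N\<bar>"
      using ap[OF compact_rbox r] by blast
    have "uniform_limit (rbox m w r) (\<lambda>N v. (H \<alpha> (u(i := u i + s N)) v - H \<alpha> u v) / s N) (jet_pd i H \<alpha> u) sequentially"
    proof (rule uniform_limitI)
      fix e :: real assume "e > 0"
      from uni[OF s(3) this, of C]
      show "\<forall>\<^sub>F N in sequentially. \<forall>v\<in>rbox m w r.
          dist ((H \<alpha> (u(i := u i + s N)) v - H \<alpha> u v) / s N) (jet_pd i H \<alpha> u v) < e"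
        by eventually_elim (use C in \<open>fastforce simp: dist_real_def intro: le_less_trans\<close>)
    qed
    then show "continuous_on (rbox m w r) (jet_pd i H \<alpha> u)"
    proof (rule uniform_limit_theorem[rotated])
      show "\<forall>\<^sub>F N in sequentially. continuous_on (rbox m w r) (\<lambda>v. (H \<alpha> (u(i := u i + s N)) v - H \<alpha> u v) / s N)"
        using s(1,2) u by (intro always_eventually allI continuous_on_divide continuous_on_diff continuous_on_const
            continuous_on_subset[OF jet_smoothD(1)[OF H] r]) auto
    qed simp
  qed
  have der: "has_pd j (jet_pd i H \<alpha> u) w (jet_pd i H (j # \<alpha>) u w)"
    if u: "u \<in> U" and j: "j < m" and w: "w \<in> W" for u \<alpha> j w
  proof -
    obtain r where r: "r > 0" "rbox m w r \<subseteq> W" using w W openin_Euclidean_space_rbox by blast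
    have wr: "w \<in> rbox m w r" using center_in_rbox w open_in_Rn_subset[OF W] r(1) by (meson less_imp_le subsetD)
    have upd: "w(j := t) \<in> rbox m w r" if "t \<in> cball (w j) r" for t
      using that by (intro rbox_update[OF wr j]) (simp add: dist_real_def abs_minus_commute)
    obtain s where s0: "\<forall>N. s N \<noteq> 0 \<and> u(i := u i + s N) \<in> U" and s3: "s \<longlonglongrightarrow> 0"
      and ap0: "\<forall>\<alpha> K. compact K \<longrightarrow> K \<subseteq> W \<longrightarrow> (\<exists>C. \<forall>N. \<forall>w\<in>K.
        \<bar>(H \<alpha> (u(i := u i + s N)) w - H \<alpha> u w) / s N - jet_pd i H \<alpha> u w\<bar> \<le> C * \<bar>s N\<bar>)"
      using approx[OF u] by (elim exE conjE) (rule that)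
    note s = s0[rule_format, THEN conjunct1] s0[rule_format, THEN conjunct2] s3 and ap = ap0[rule_format]
    define q where "q \<alpha> N v = (H \<alpha> (u(i := u i + s N)) v - H \<alpha> u v) / s N" for \<alpha> N v
    have lim: "\<exists>C. \<forall>N. \<forall>v\<in>rbox m w r. \<bar>q \<alpha> N v - jet_pd i H \<alpha> u v\<bar> \<le> C * \<bar>s N\<bar>" for \<alpha>
      using ap[OF compact_rbox r(2)] unfolding q_def by blast
    have ptw: "(\<lambda>N. q \<alpha> N v) \<longlonglongrightarrow> jet_pd i H \<alpha> u v" if v: "v \<in> rbox m w r" for \<alpha> v
    proof -
      obtain C where C: "\<And>N. \<bar>q \<alpha> N v - jet_pd i H \<alpha> u v\<bar> \<le> C * \<bar>s N\<bar>" using lim[of \<alpha>] v by blast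
      show ?thesis
      proof (rule tendstoI)
        fix e :: real assume "e > 0"
        from uni[OF s(3) this, of C] show "\<forall>\<^sub>F N in sequentially. dist (q \<alpha> N v) (jet_pd i H \<alpha> u v) < e"
          by eventually_elim (use C in \<open>auto simp: dist_real_def intro: le_less_trans\<close>)
      qed
    qed
    let ?S = "cball (w j) r"
    \<comment> \<open>The exchange of the derivatives in \<open>u\<close> and \<open>w\<close>: the
      quotients of \<open>H \<alpha>\<close> converge, and their derivatives in direction
      \<open>j\<close>, the quotients of \<open>H (j # \<alpha>)\<close>, converge
      uniformly.\<close>
    have "\<exists>g. \<forall>t\<in>?S. (\<lambda>N. q \<alpha> N (w(j := t))) \<longlonglongrightarrow> g t \<and>
        (g has_derivative (\<lambda>h. jet_pd i H (j # \<alpha>) u (w(j := t)) * h)) (at t within ?S)"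
    proof (rule has_derivative_sequence)
      show "convex ?S" by simp
      show "w j \<in> ?S" using r(1) by simp
      show "(\<lambda>N. q \<alpha> N (w(j := w j))) \<longlonglongrightarrow> jet_pd i H \<alpha> u w" using ptw[OF wr] by simp
      show "((\<lambda>t. q \<alpha> N (w(j := t))) has_derivative (\<lambda>h. q (j # \<alpha>) N (w(j := t)) * h)) (at t within ?S)"
        if t: "t \<in> ?S" for N t
      proof -
        have "((\<lambda>t. H \<alpha> y (w(j := t))) has_real_derivative H (j # \<alpha>) y (w(j := t))) (at t)" if "y \<in> U" for y
          using jet_smoothD(2)[OF H that j, of "w(j := t)" \<alpha>] upd[OF t] r(2) by (auto simp: has_pd_def)
        from DERIV_cdivide[OF DERIV_diff[OF this[OF s(2)[of N]] this[OF u]], of "s N"]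
        have "((\<lambda>t. q \<alpha> N (w(j := t))) has_real_derivative q (j # \<alpha>) N (w(j := t))) (at t)"
          by (simp add: q_def)
        then show ?thesis
          by (metis has_field_derivative_at_within has_field_derivative_def)
      qed
      fix e :: real assume e: "e > 0"
      obtain C where C: "\<And>N v. v \<in> rbox m w r \<Longrightarrow> \<bar>q (j # \<alpha>) N v - jet_pd i H (j # \<alpha>) u v\<bar> \<le> C * \<bar>s N\<bar>"
        using lim by blast
      from uni[OF s(3) e, of C] show "\<forall>\<^sub>F N in sequentially. \<forall>t\<in>?S. \<forall>h.
          norm (q (j # \<alpha>) N (w(j := t)) * h - jet_pd i H (j # \<alpha>) u (w(j := t)) * h) \<le> e * norm h"
      proof eventually_elim
        case (elim N)
        show ?case
        proof (intro ballI allI)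
          fix t h assume "t \<in> ?S"
          from C[OF upd[OF this], of N] elim
          have "\<bar>q (j # \<alpha>) N (w(j := t)) - jet_pd i H (j # \<alpha>) u (w(j := t))\<bar> * \<bar>h\<bar> \<le> e * \<bar>h\<bar>"
            by (intro mult_right_mono) auto
          then show "norm (q (j # \<alpha>) N (w(j := t)) * h - jet_pd i H (j # \<alpha>) u (w(j := t)) * h) \<le> e * norm h"
            by (simp add: left_diff_distrib[symmetric] abs_mult)
        qed
      qed
    qed
    then obtain g where g: "\<And>t. t \<in> ?S \<Longrightarrow> (\<lambda>N. q \<alpha> N (w(j := t))) \<longlonglongrightarrow> g t"
      "\<And>t. t \<in> ?S \<Longrightarrow> (g has_derivative (\<lambda>h. jet_pd i H (j # \<alpha>) u (w(j := t)) * h)) (at t within ?S)"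
      by blast
    have geq: "g t = jet_pd i H \<alpha> u (w(j := t))" if "t \<in> ?S" for t
      using LIMSEQ_unique[OF g(1)[OF that] ptw[OF upd[OF that]]] .
    have "(g has_real_derivative jet_pd i H (j # \<alpha>) u w) (at (w j) within ?S)"
      using g(2)[of "w j"] r(1) by (simp add: has_field_derivative_def)
    moreover have "at (w j) within ?S = at (w j)"
      using r(1) by (intro at_within_interior) simp
    ultimately have D: "(g has_real_derivative jet_pd i H (j # \<alpha>) u w) (at (w j))" by simp
    have "\<forall>\<^sub>F t in nhds (w j). g t = jet_pd i H \<alpha> u (w(j := t))"
      using eventually_nhds_in_open[OF open_ball, of "w j" "w j" r] r(1)
      by (auto elim!: eventually_mono intro: geq)
    from DERIV_cong_ev[OF refl this refl] D show ?thesis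
      unfolding has_pd_def by (rule iffD1)
  qed
  have weak: "C_infinity n U (\<lambda>u. \<Sum>k. a k * jet_pd i H \<alpha> u (w k))"
    if K: "compact K" "K \<subseteq> W" and w: "\<And>k. w k \<in> K" and a: "\<And>k. \<bar>a k\<bar> \<le> (1/3) ^ k" for \<alpha> K w a
  proof -
    define F where "F u = (\<Sum>k. a k * H \<alpha> u (w k))" for u
    have F: "C_infinity n U F" unfolding F_def by (rule jet_smoothD(3)[OF H K w a])
    \<comment> \<open>The quotients \<open>Q N\<close> of \<open>F\<close> have two limits, the
      derivative of \<open>F\<close> and the series of derivatives. For the second, the error
      \<open>C * \<bar>s N\<bar>\<close> is uniform over \<open>K\<close>, and summation against the
      weights costs at most a factor 3/2.\<close>
    have "(\<Sum>k. a k * jet_pd i H \<alpha> u (w k)) = pd i F u" if u: "u \<in> U" for u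
    proof -
      obtain s where s0: "\<forall>N. s N \<noteq> 0 \<and> u(i := u i + s N) \<in> U" and s3: "s \<longlonglongrightarrow> 0"
        and ap0: "\<forall>\<alpha> K. compact K \<longrightarrow> K \<subseteq> W \<longrightarrow> (\<exists>C. \<forall>N. \<forall>w\<in>K.
          \<bar>(H \<alpha> (u(i := u i + s N)) w - H \<alpha> u w) / s N - jet_pd i H \<alpha> u w\<bar> \<le> C * \<bar>s N\<bar>)"
        using approx[OF u] by (elim exE conjE) (rule that)
      note s = s0[rule_format, THEN conjunct1] s0[rule_format, THEN conjunct2] s3 and ap = ap0[rule_format]
      define q where "q N v = (H \<alpha> (u(i := u i + s N)) v - H \<alpha> u v) / s N" for N v
      define Q where "Q N = (F (u(i := u i + s N)) - F u) / s N" for N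
      obtain C where C: "\<And>N v. v \<in> K \<Longrightarrow> \<bar>q N v - jet_pd i H \<alpha> u v\<bar> \<le> C * \<bar>s N\<bar>"
        using ap[OF K] unfolding q_def by blast
      have "Q \<longlonglongrightarrow> pd i F u" unfolding Q_def
        by (rule tendsto_compose_at[where y = 0 and g = "\<lambda>s. (F (u(i := u i + s)) - F u) / s", unfolded comp_def])
           (use s has_pd_quotient_limit[OF C_infinity_pd(2)[OF U F i u]] in auto)
      moreover have "Q \<longlonglongrightarrow> (\<Sum>k. a k * jet_pd i H \<alpha> u (w k))"
      proof (rule tendstoI)
        fix e :: real assume "e > 0"
        obtain B where B: "\<And>v. v \<in> K \<Longrightarrow> \<bar>jet_pd i H \<alpha> u v\<bar> \<le> B"
          using continuous_on_compact_bound[OF K(1) continuous_on_subset[OF cont[OF u] K(2)]] by blast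
        note sm = jet_smooth_summable[OF H _ K w a, THEN summable_sums]
        have le: "\<bar>Q N - (\<Sum>k. a k * jet_pd i H \<alpha> u (w k))\<bar> \<le> 3/2 * (C * \<bar>s N\<bar>)" for N
        proof -
          have "(\<lambda>k. a k * q N (w k)) sums Q N"
            using sums_divide[OF sums_diff[OF sm[OF s(2)[of N]] sm[OF u]], where c = "s N"]
            by (simp add: F_def q_def Q_def right_diff_distrib)
          from sums_diff[OF this summable_sums[OF summable_third_bounded(1)[OF a B[OF w]]]]
          have "Q N - (\<Sum>k. a k * jet_pd i H \<alpha> u (w k)) = (\<Sum>k. a k * (q N (w k) - jet_pd i H \<alpha> u (w k)))"
            by (simp add: sums_unique right_diff_distrib)
          then show ?thesis using summable_third_bounded(2)[OF a C[OF w]] by simp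
        qed
        from uni[OF s(3) \<open>e > 0\<close>, of "3/2 * C"]
        show "\<forall>\<^sub>F N in sequentially. dist (Q N) (\<Sum>k. a k * jet_pd i H \<alpha> u (w k)) < e"
        proof eventually_elim
          case (elim N)
          then show ?case using le[of N] unfolding dist_real_def mult.assoc by linarith
        qed
      qed
      ultimately show ?thesis by (metis LIMSEQ_unique)
    qed
    from C_infinity_cong[OF U this] C_infinity_pd(1)[OF U F i] show ?thesis by (rule iffD2)
  qed
  show ?thesis unfolding jet_smooth_def using cont der weak by blast
qed

text \<open>Coinduction over the functions that are the base of some family: derivatives in
  \<open>u\<close> stay in the class by \<open>jet_smooth_jet_pd\<close>, those in \<open>w\<close>
  by \<open>jet_smooth_snoc\<close>, and every member is jointly continuous.\<close>

theorem jet_smooth_C_infinity_joint: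
  assumes U: "open_in_Rn n U" and W: "open_in_Rn m W" and H: "jet_smooth n m U W H"
  shows "C_infinity (n + m) (jprod n U W) (\<lambda>x. H [] (fstn n x) (sndn n x))"
proof -
  define P where "P f \<longleftrightarrow> (\<exists>H. jet_smooth n m U W H \<and> f = (\<lambda>x. H [] (fstn n x) (sndn n x)))" for f
  show ?thesis
  proof (rule C_infinity_coinduct[OF open_in_Rn_jprod[OF U W], where P = P])
    show "P (\<lambda>x. H [] (fstn n x) (sndn n x))" using H by (auto simp: P_def)
  next
    fix f assume "P f"
    then show "continuous_on (jprod n U W) f"
      using jet_smooth_jointly_continuous[OF U W] by (auto simp: P_def)
  next
    fix f i assume "P f" and i: "i < n + m"
    then obtain H where H: "jet_smooth n m U W H" and f: "f = (\<lambda>x. H [] (fstn n x) (sndn n x))"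
      by (auto simp: P_def)
    show "\<exists>g. (\<forall>x\<in>jprod n U W. has_pd i f x (g x)) \<and> P g"
    proof (cases "i < n")
      case True
      have "has_pd i f x (jet_pd i H [] (fstn n x) (sndn n x))" if "x \<in> jprod n U W" for x
      proof -
        have "has_pd i (\<lambda>y. H [] y (sndn n x)) (fstn n x) (jet_pd i H [] (fstn n x) (sndn n x))"
          unfolding jet_pd_def using that
          by (intro C_infinity_pd(2)[OF U jet_smooth_C_infinity[OF U H] True]) (auto simp: jprod_def)
        then show ?thesis using True
          by (simp add: has_pd_def f fstn_update sndn_update) (simp add: fstn_def)
      qed
      moreover have "P (\<lambda>x. jet_pd i H [] (fstn n x) (sndn n x))"
        using jet_smooth_jet_pd[OF U W H True] by (auto simp: P_def)
      ultimately show ?thesis by (intro exI[of _ "\<lambda>x. jet_pd i H [] (fstn n x) (sndn n x)"]) blast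
    next
      case False
      have "has_pd i f x (H [i - n] (fstn n x) (sndn n x))" if "x \<in> jprod n U W" for x
      proof -
        have "has_pd (i - n) (H [] (fstn n x)) (sndn n x) (H [i - n] (fstn n x) (sndn n x))"
          using that i False by (intro jet_smoothD(2)[OF H]) (auto simp: jprod_def)
        then show ?thesis using False
          by (simp add: has_pd_def f fstn_update_ge sndn_update_ge) (simp add: sndn_def)
      qed
      moreover have "P (\<lambda>x. H [i - n] (fstn n x) (sndn n x))"
        unfolding P_def by (intro exI[of _ "\<lambda>\<alpha>. H (\<alpha> @ [i - n])"] conjI jet_smooth_snoc H) simp
      ultimately show ?thesis by (intro exI[of _ "\<lambda>x. H [i - n] (fstn n x) (sndn n x)"]) blast
    qed
  qed
qed

section \<open>Weak plots and products\<close>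

lemma smooth_RnD:
  assumes "f \<in> smooth_Rn m V n U"
  shows "f \<in> V \<rightarrow>\<^sub>E U" "v \<in> V \<Longrightarrow> f v \<in> U" "i < n \<Longrightarrow> C_infinity m V (\<lambda>x. f x i)"
  using assms by (auto simp: smooth_Rn_def)

lemma smooth_Rn_restrictI:
  assumes V: "open_in_Rn m V" and f: "\<And>v. v \<in> V \<Longrightarrow> f v \<in> U"
    and sm: "\<And>i. i < n \<Longrightarrow> C_infinity m V (\<lambda>v. f v i)"
  shows "restrict f V \<in> smooth_Rn m V n U"
proof -
  have "C_infinity m V (\<lambda>v. restrict f V v i)" if "i < n" for i
    by (subst C_infinity_cong[OF V, where g = "\<lambda>v. f v i"]) (use sm[OF that] in auto)
  then show ?thesis using f by (simp add: smooth_Rn_def)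
qed

lemma smooth_Rn_inclusion:
  assumes "open_in_Rn n V" "V \<subseteq> U"
  shows "(\<lambda>x\<in>V. x) \<in> smooth_Rn n V n U"
  using assms by (intro smooth_Rn_restrictI C_infinity_coord) auto

lemma smooth_Rn_compose:
  assumes P: "open_in_Rn k P" and V: "open_in_Rn m V"
    and f: "f \<in> smooth_Rn m V n U" and g: "g \<in> smooth_Rn k P m V"
  shows "compose P f g \<in> smooth_Rn k P n U"
  unfolding compose_def
proof (rule smooth_Rn_restrictI[OF P])
  show "f (g v) \<in> U" if "v \<in> P" for v using smooth_RnD(2)[OF f smooth_RnD(2)[OF g that]] .
  fix i assume i: "i < n"
  show "C_infinity k P (\<lambda>v. f (g v) i)"
  proof (rule C_infinity_compose[OF P V, where F = "\<lambda>x. f x i"])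
    show "g ` P \<subseteq> V" using smooth_RnD(2)[OF g] by auto
    show "\<And>j. j < m \<Longrightarrow> C_infinity k P (\<lambda>x. g x j)" by (rule smooth_RnD(3)[OF g])
    show "C_infinity m V (\<lambda>x. f x i)" by (rule smooth_RnD(3)[OF f i])
  qed
qed

lemma smooth_Rn_fstn:
  assumes U: "open_in_Rn n U" and W: "open_in_Rn m W"
  shows "restrict (fstn n) (jprod n U W) \<in> smooth_Rn (n + m) (jprod n U W) n U"
proof (rule smooth_Rn_restrictI[OF open_in_Rn_jprod[OF U W]])
  show "fstn n v \<in> U" if "v \<in> jprod n U W" for v using that by (simp add: jprod_def)
  fix i assume i: "i < n"
  have "(\<lambda>v. fstn n v i) = (\<lambda>v. v i)" using i by (simp add: fstn_def)
  then show "C_infinity (n + m) (jprod n U W) (\<lambda>v. fstn n v i)"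
    using C_infinity_coord[OF open_in_Rn_jprod[OF U W]] by simp
qed

lemma smooth_Rn_sndn:
  assumes U: "open_in_Rn n U" and W: "open_in_Rn m W"
  shows "restrict (sndn n) (jprod n U W) \<in> smooth_Rn (n + m) (jprod n U W) m W"
  by (rule smooth_Rn_restrictI[OF open_in_Rn_jprod[OF U W]])
     (auto simp: jprod_def sndn_def intro: C_infinity_coord[OF open_in_Rn_jprod[OF U W], unfolded jprod_def sndn_def])

lemma smooth_Rn_continuous_on:
  assumes V: "open_in_Rn m V" and U: "U \<subseteq> euc n" and f: "f \<in> smooth_Rn m V n U"
  shows "continuous_on V f"
proof (rule continuous_on_euc_valued[of f V n])
  show "f ` V \<subseteq> euc n" using smooth_RnD(2)[OF f] U by auto
  show "\<And>j. j < n \<Longrightarrow> continuous_on V (\<lambda>x. f x j)"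
    using C_infinity_continuous[OF V smooth_RnD(3)[OF f]] .
qed

lemma open_in_Rn_smooth_preimage:
  assumes V: "open_in_Rn m V" and U: "U \<subseteq> euc n" and f: "f \<in> smooth_Rn m V n U"
    and S: "open_in_Rn n S"
  shows "open_in_Rn m {v \<in> V. f v \<in> S}"
proof -
  obtain T where T: "open T" "S = euc n \<inter> T" using S by (auto simp: Euclidean_space_eq openin_open)
  have "{v \<in> V. f v \<in> S} = {v \<in> V. f v \<in> T}" using T(2) smooth_RnD(2)[OF f] U by auto
  then show ?thesis using open_in_Rn_preimage[OF V smooth_Rn_continuous_on[OF V U f] T(1)] by simp
qed

section \<open>Plots, the D-topology and test functions\<close>

lemma diffeological_spaceI:
  assumes "\<And>n U d. open_in_Rn n U \<Longrightarrow> d \<in> plots X n U \<Longrightarrow> d \<in> U \<rightarrow>\<^sub>E carrier X"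
    and "\<And>n U x. open_in_Rn n U \<Longrightarrow> x \<in> carrier X \<Longrightarrow> (\<lambda>u\<in>U. x) \<in> plots X n U"
    and "\<And>n U m V d f. open_in_Rn n U \<Longrightarrow> open_in_Rn m V \<Longrightarrow> d \<in> plots X n U \<Longrightarrow>
      f \<in> smooth_Rn m V n U \<Longrightarrow> compose V d f \<in> plots X m V"
    and "\<And>n U d \<U>. open_in_Rn n U \<Longrightarrow> d \<in> U \<rightarrow>\<^sub>E carrier X \<Longrightarrow> (\<And>W. W \<in> \<U> \<Longrightarrow> open_in_Rn n W) \<Longrightarrow>
      \<Union>\<U> = U \<Longrightarrow> (\<And>W. W \<in> \<U> \<Longrightarrow> restrict d W \<in> plots X n W) \<Longrightarrow> d \<in> plots X n U"
  shows "diffeological_space X"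
  unfolding diffeological_space_def
proof (intro conjI allI impI ballI subsetI)
  fix n U d \<U> assume "open_in_Rn n U" "d \<in> U \<rightarrow>\<^sub>E carrier X" "\<forall>W\<in>\<U>. open_in_Rn n W"
    "\<Union>\<U> = U" "\<forall>W\<in>\<U>. restrict d W \<in> plots X n W"
  then show "d \<in> plots X n U" by (intro assms(4)[of n U d \<U>]) auto
qed (rule assms; assumption)+

context
  fixes X :: "'a dspace"
  assumes X: "diffeological_space X"
begin

lemma plots_PiE: "open_in_Rn n U \<Longrightarrow> d \<in> plots X n U \<Longrightarrow> d \<in> U \<rightarrow>\<^sub>E carrier X"
  using X[unfolded diffeological_space_def, THEN conjunct1] by blast

lemma plots_mem: "open_in_Rn n U \<Longrightarrow> d \<in> plots X n U \<Longrightarrow> u \<in> U \<Longrightarrow> d u \<in> carrier X"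
  using plots_PiE by blast

lemma plots_const: "open_in_Rn n U \<Longrightarrow> x \<in> carrier X \<Longrightarrow> (\<lambda>u\<in>U. x) \<in> plots X n U"
  using X[unfolded diffeological_space_def, THEN conjunct2, THEN conjunct1] by blast

lemma plots_compose:
  "open_in_Rn n U \<Longrightarrow> open_in_Rn m V \<Longrightarrow> d \<in> plots X n U \<Longrightarrow> f \<in> smooth_Rn m V n U \<Longrightarrow>
    compose V d f \<in> plots X m V"
  using X[unfolded diffeological_space_def, THEN conjunct2, THEN conjunct2, THEN conjunct1] by blast

lemma plots_glue:
  assumes U: "open_in_Rn n U" and d: "d \<in> U \<rightarrow>\<^sub>E carrier X"
    and W: "\<And>W. W \<in> \<U> \<Longrightarrow> open_in_Rn n W" "\<Union>\<U> = U" "\<And>W. W \<in> \<U> \<Longrightarrow> restrict d W \<in> plots X n W"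
  shows "d \<in> plots X n U"
  using X[unfolded diffeological_space_def, THEN conjunct2, THEN conjunct2, THEN conjunct2,
      rule_format, OF U d _ W(2)] W(1,3) by blast

lemma plots_restrict:
  assumes U: "open_in_Rn n U" and W: "open_in_Rn n W" "W \<subseteq> U" and d: "d \<in> plots X n U"
  shows "restrict d W \<in> plots X n W"
proof -
  have "compose W d (\<lambda>x\<in>W. x) = restrict d W" by (auto simp: compose_def fun_eq_iff)
  then show ?thesis using plots_compose[OF U W(1) d smooth_Rn_inclusion[OF W]] by simp
qed

lemma D_open_iff:
  "D_open X A \<longleftrightarrow> A \<subseteq> carrier X \<and>
    (\<forall>n U d. open_in_Rn n U \<longrightarrow> d \<in> plots X n U \<longrightarrow> open_in_Rn n {u \<in> U. d u \<in> A})"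
  unfolding D_open_def using openin_subtopology_open_in_Rn by (auto 0 4)

lemma topspace_D_topology: "topspace (D_topology X) = carrier X"
proof (rule antisym)
  show "topspace (D_topology X) \<subseteq> carrier X"
    using openin_topspace[of "D_topology X"] by (simp only: openin_D_topology D_open_def)
  have "D_open X (carrier X)"
    unfolding D_open_iff
  proof (intro conjI allI impI order_refl)
    fix n U d assume U: "open_in_Rn n U" and d: "d \<in> plots X n U"
    have "{u \<in> U. d u \<in> carrier X} = U" using plots_mem[OF U d] by auto
    then show "open_in_Rn n {u \<in> U. d u \<in> carrier X}" using U by simp
  qed
  then show "carrier X \<subseteq> topspace (D_topology X)"
    by (intro openin_subset) (simp add: openin_D_topology)
qed

lemma continuous_map_D_topology:
  assumes U: "open_in_Rn n U" and d: "d \<in> U \<rightarrow>\<^sub>E carrier X"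
  shows "continuous_map (subtopology (Euclidean_space n) U) (D_topology X) d \<longleftrightarrow>
    (\<forall>A. D_open X A \<longrightarrow> open_in_Rn n {u \<in> U. d u \<in> A})"
proof -
  have "topspace (subtopology (Euclidean_space n) U) = U"
    using openin_subset[OF U] by auto
  then show ?thesis
    using d by (auto simp: continuous_map_def topspace_D_topology openin_D_topology
        openin_subtopology_open_in_Rn[OF U])
qed

lemma smooth_real_iff:
  "l \<in> smooth_maps (sub_dspace A X) real_dspace \<longleftrightarrow> l \<in> extensional A \<and>
    (\<forall>n U d. open_in_Rn n U \<longrightarrow> d \<in> plots X n U \<longrightarrow> d ` U \<subseteq> A \<longrightarrow> C_infinity n U (\<lambda>u. l (d u)))"
proof -
  have "C_infinity n U (compose U l d) \<longleftrightarrow> C_infinity n U (\<lambda>u. l (d u))" if "open_in_Rn n U" for n U and d :: "_ \<Rightarrow> 'a"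
    by (rule C_infinity_cong[OF that]) (simp add: compose_def)
  then show ?thesis
    by (auto simp: smooth_maps_def sub_dspace_def real_dspace_def PiE_def compose_def)
qed

end

text \<open>Continuity for the D-topology appears as openness of preimages, which also makes the
  domains in the smoothness clause open sets.\<close>

definition weak_plot :: "'a dspace \<Rightarrow> nat \<Rightarrow> (nat \<Rightarrow> real) set \<Rightarrow> ((nat \<Rightarrow> real) \<Rightarrow> 'a) \<Rightarrow> bool"
  where "weak_plot X n U d \<longleftrightarrow> d \<in> U \<rightarrow>\<^sub>E carrier X \<and>
    (\<forall>A. D_open X A \<longrightarrow> open_in_Rn n {u \<in> U. d u \<in> A} \<and>
      (\<forall>l\<in>smooth_maps (sub_dspace A X) real_dspace. C_infinity n {u \<in> U. d u \<in> A} (\<lambda>u. l (d u))))"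

text \<open>Enlarging a generating family puts more conditions on \<open>d\<close>, so the family of
  all smooth real functions on all D-open sets generates whenever some family does.\<close>

lemma functionally_generated_iff:
  assumes X: "diffeological_space X"
  shows "functionally_generated X \<longleftrightarrow>
    (\<forall>n U d. open_in_Rn n U \<longrightarrow> weak_plot X n U d \<longrightarrow> d \<in> plots X n U)" (is "?L \<longleftrightarrow> ?R")
proof
  assume ?L
  then obtain \<F> where \<F>: "generates_diffeology X \<F>" by (auto simp: functionally_generated_def)
  note sub = \<F>[unfolded generates_diffeology_def openin_D_topology, THEN conjunct1, rule_format]
    and gen = \<F>[unfolded generates_diffeology_def openin_D_topology, THEN conjunct2, rule_format]
  show ?R
  proof (intro allI impI)
    fix n U d assume U: "open_in_Rn n U" and d: "weak_plot X n U d"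
    have dE: "d \<in> U \<rightarrow>\<^sub>E carrier X" using d by (simp add: weak_plot_def)
    show "d \<in> plots X n U"
    proof (rule gen[OF U dE])
      show "continuous_map (subtopology (Euclidean_space n) U) (D_topology X) d"
        unfolding continuous_map_D_topology[OF X U dE] using d by (simp add: weak_plot_def)
      fix A l assume "D_open X A" "l \<in> \<F> A"
      then show "C_infinity n {u \<in> U. d u \<in> A} (\<lambda>u. l (d u))"
        using d sub unfolding weak_plot_def by blast
    qed
  qed
next
  assume R: ?R
  have "generates_diffeology X (\<lambda>A. smooth_maps (sub_dspace A X) real_dspace)"
    unfolding generates_diffeology_def openin_D_topology
  proof (intro conjI allI impI order_refl)
    fix n U d assume U: "open_in_Rn n U" and d: "d \<in> U \<rightarrow>\<^sub>E carrier X"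
      and c: "continuous_map (subtopology (Euclidean_space n) U) (D_topology X) d"
      and t: "\<forall>A. D_open X A \<longrightarrow> (\<forall>l\<in>smooth_maps (sub_dspace A X) real_dspace.
          C_infinity n {u \<in> U. d u \<in> A} (\<lambda>u. l (d u)))"
    have "weak_plot X n U d"
      using d t c[unfolded continuous_map_D_topology[OF X U d]] unfolding weak_plot_def by blast
    then show "d \<in> plots X n U" using R U by blast
  qed
  then show ?L unfolding functionally_generated_def by blast
qed

lemma FDlg_iff:
  "X \<in> FDlg \<longleftrightarrow> diffeological_space X \<and>
    (\<forall>n U d. open_in_Rn n U \<longrightarrow> weak_plot X n U d \<longrightarrow> d \<in> plots X n U)"
  using functionally_generated_iff by (auto simp: FDlg_def)

lemma smooth_mapsD:
  assumes "f \<in> smooth_maps X Y"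
  shows "f \<in> carrier X \<rightarrow>\<^sub>E carrier Y" "x \<in> carrier X \<Longrightarrow> f x \<in> carrier Y"
    "open_in_Rn n U \<Longrightarrow> d \<in> plots X n U \<Longrightarrow> compose U f d \<in> plots Y n U"
  using assms by (auto simp: smooth_maps_def)

lemma D_open_preimage:
  assumes X: "diffeological_space X" and Y: "diffeological_space Y"
    and f: "f \<in> smooth_maps X Y" and B: "D_open Y B"
  shows "D_open X {x \<in> carrier X. f x \<in> B}"
  unfolding D_open_iff[OF X]
proof (intro conjI allI impI)
  fix n U d assume U: "open_in_Rn n U" and d: "d \<in> plots X n U"
  have "open_in_Rn n {u \<in> U. compose U f d u \<in> B}"
    using B smooth_mapsD(3)[OF f U d] U unfolding D_open_iff[OF Y] by blast
  moreover have "{u \<in> U. compose U f d u \<in> B} = {u \<in> U. d u \<in> {x \<in> carrier X. f x \<in> B}}"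
    using plots_mem[OF X U d] by (auto simp: compose_def)
  ultimately show "open_in_Rn n {u \<in> U. d u \<in> {x \<in> carrier X. f x \<in> B}}" by simp
qed auto

text \<open>A test function on a D-open set of \<open>Y\<close> pulls back along \<open>f\<close> to
  a test function on the preimage, which is D-open in \<open>X\<close>.\<close>

lemma weak_plot_compose:
  assumes X: "diffeological_space X" and Y: "diffeological_space Y"
    and f: "f \<in> smooth_maps X Y" and d: "weak_plot X n U d"
  shows "weak_plot Y n U (compose U f d)"
  unfolding weak_plot_def
proof (intro conjI allI impI ballI)
  have dE: "d \<in> U \<rightarrow>\<^sub>E carrier X" using d by (simp add: weak_plot_def)
  then show "compose U f d \<in> U \<rightarrow>\<^sub>E carrier Y"
    using smooth_mapsD(1)[OF f] by (auto simp: compose_def)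
  fix B assume B: "D_open Y B"
  let ?A = "{x \<in> carrier X. f x \<in> B}"
  note A = D_open_preimage[OF X Y f B]
  have eq: "{u \<in> U. compose U f d u \<in> B} = {u \<in> U. d u \<in> ?A}"
    using dE by (auto simp: compose_def)
  show op: "open_in_Rn n {u \<in> U. compose U f d u \<in> B}"
    unfolding eq using d A unfolding weak_plot_def by blast
  fix l assume l: "l \<in> smooth_maps (sub_dspace B Y) real_dspace"
  have "(\<lambda>x\<in>?A. l (f x)) \<in> smooth_maps (sub_dspace ?A X) real_dspace"
    unfolding smooth_real_iff[OF X]
  proof (intro conjI allI impI)
    fix k P p assume P: "open_in_Rn k P" and p: "p \<in> plots X k P" and pA: "p ` P \<subseteq> ?A"
    have "compose P f p ` P \<subseteq> B" using pA by (auto simp: compose_def)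
    then have "C_infinity k P (\<lambda>u. l (compose P f p u))"
      using l smooth_mapsD(3)[OF f P p] P unfolding smooth_real_iff[OF Y] by blast
    moreover have "(\<lambda>x\<in>?A. l (f x)) (p u) = l (compose P f p u)" if "u \<in> P" for u
      using that pA by (auto simp: compose_def)
    ultimately show "C_infinity k P (\<lambda>u. (\<lambda>x\<in>?A. l (f x)) (p u))"
      by (subst C_infinity_cong[OF P])
  qed auto
  then have "C_infinity n {u \<in> U. d u \<in> ?A} (\<lambda>u. (\<lambda>x\<in>?A. l (f x)) (d u))"
    using d A unfolding weak_plot_def by blast
  then show "C_infinity n {u \<in> U. compose U f d u \<in> B} (\<lambda>u. l (compose U f d u))"
    unfolding eq
    by (subst C_infinity_cong[OF op[unfolded eq], where g = "\<lambda>u. (\<lambda>x\<in>?A. l (f x)) (d u)"])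
       (auto simp: compose_def)
qed

section \<open>The terminal object and products\<close>

lemma diffeological_unit_dspace: "diffeological_space unit_dspace"
  by (rule diffeological_spaceI) (auto simp: unit_dspace_def compose_def)

lemma unit_dspace_FDlg: "unit_dspace \<in> FDlg"
  unfolding FDlg_iff using diffeological_unit_dspace by (auto simp: weak_plot_def unit_dspace_def)

lemma is_terminal_unit_dspace: "is_terminal TYPE('c) unit_dspace"
  unfolding is_terminal_def
proof (intro conjI allI impI unit_dspace_FDlg ex1I)
  fix Z :: "'c dspace"
  show "(\<lambda>z\<in>carrier Z. ()) \<in> smooth_maps Z unit_dspace"
    by (auto simp: smooth_maps_def unit_dspace_def compose_def)
qed (auto simp: fun_eq_iff)

lemma compose_compose_eq: "f \<in> V \<rightarrow> U \<Longrightarrow> compose V h (compose V d f) = compose V (compose U h d) f"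
  by (auto simp: compose_def fun_eq_iff)

lemma compose_restrict: "W \<subseteq> U \<Longrightarrow> compose W h (restrict d W) = restrict (compose U h d) W"
  by (auto simp: compose_def fun_eq_iff)

lemma diffeological_prod_dspace:
  assumes X: "diffeological_space X" and Y: "diffeological_space Y"
  shows "diffeological_space (prod_dspace X Y)"
proof (rule diffeological_spaceI)
  fix n U d assume "open_in_Rn n U" "d \<in> plots (prod_dspace X Y) n U"
  then show "d \<in> U \<rightarrow>\<^sub>E carrier (prod_dspace X Y)" by (simp add: prod_dspace_def)
next
  fix n U x assume U: "open_in_Rn n U" and x: "x \<in> carrier (prod_dspace X Y)"
  have "compose U fst (\<lambda>u\<in>U. x) = (\<lambda>u\<in>U. fst x)" "compose U snd (\<lambda>u\<in>U. x) = (\<lambda>u\<in>U. snd x)"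
    by (auto simp: compose_def fun_eq_iff)
  then show "(\<lambda>u\<in>U. x) \<in> plots (prod_dspace X Y) n U"
    using plots_const[OF X U, of "fst x"] plots_const[OF Y U, of "snd x"] x
    by (auto simp: prod_dspace_def)
next
  fix n U m V d f assume U: "open_in_Rn n U" and V: "open_in_Rn m V"
    and d: "d \<in> plots (prod_dspace X Y) n U" and f: "f \<in> smooth_Rn m V n U"
  have fU: "f \<in> V \<rightarrow> U" using smooth_RnD(1)[OF f] by auto
  show "compose V d f \<in> plots (prod_dspace X Y) m V"
    using d plots_compose[OF X U V _ f] plots_compose[OF Y U V _ f] fU
    by (auto simp: prod_dspace_def compose_compose_eq[OF fU]) (auto simp: compose_def)
next
  fix n U d \<U> assume U: "open_in_Rn n U" and d: "d \<in> U \<rightarrow>\<^sub>E carrier (prod_dspace X Y)"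
    and op: "\<And>W. W \<in> \<U> \<Longrightarrow> open_in_Rn n W" and un: "\<Union>\<U> = U"
    and pl: "\<And>W. W \<in> \<U> \<Longrightarrow> restrict d W \<in> plots (prod_dspace X Y) n W"
  have d': "d \<in> U \<rightarrow>\<^sub>E carrier X \<times> carrier Y" using d by (simp add: prod_dspace_def)
  have "restrict (compose U fst d) W \<in> plots X n W \<and> restrict (compose U snd d) W \<in> plots Y n W"
    if W: "W \<in> \<U>" for W
  proof -
    have "W \<subseteq> U" using un W by auto
    note eq = compose_restrict[OF this, where d = d]
    show ?thesis using pl[OF W] unfolding eq[symmetric] by (simp add: prod_dspace_def)
  qed
  moreover have "compose U fst d \<in> U \<rightarrow>\<^sub>E carrier X" "compose U snd d \<in> U \<rightarrow>\<^sub>E carrier Y"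
    using d' by (auto simp: compose_def PiE_iff)
  ultimately have "compose U fst d \<in> plots X n U" "compose U snd d \<in> plots Y n U"
    using plots_glue[OF X U _ op un] plots_glue[OF Y U _ op un] by blast+
  then show "d \<in> plots (prod_dspace X Y) n U" using d' by (simp add: prod_dspace_def)
qed

lemma compose_restrict_PiE:
  "d \<in> U \<rightarrow>\<^sub>E A \<Longrightarrow> compose U (restrict h A) d = compose U h d"
  by (auto simp: compose_def fun_eq_iff)

lemma restrict_fst_smooth: "restrict fst (carrier X \<times> carrier Y) \<in> smooth_maps (prod_dspace X Y) X"
  by (auto simp: smooth_maps_def prod_dspace_def compose_restrict_PiE)

lemma restrict_snd_smooth: "restrict snd (carrier X \<times> carrier Y) \<in> smooth_maps (prod_dspace X Y) Y"
  by (auto simp: smooth_maps_def prod_dspace_def compose_restrict_PiE)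

lemma prod_dspace_FDlg:
  assumes "X \<in> FDlg" "Y \<in> FDlg"
  shows "prod_dspace X Y \<in> FDlg"
proof -
  have X: "diffeological_space X" and Y: "diffeological_space Y" using assms by (auto simp: FDlg_def)
  note P = diffeological_prod_dspace[OF X Y]
  have "d \<in> plots (prod_dspace X Y) n U" if U: "open_in_Rn n U" and d: "weak_plot (prod_dspace X Y) n U d" for n U d
  proof -
    have dE: "d \<in> U \<rightarrow>\<^sub>E carrier X \<times> carrier Y" using d by (simp add: weak_plot_def prod_dspace_def)
    have "compose U fst d \<in> plots X n U"
      using weak_plot_compose[OF P X restrict_fst_smooth d] assms(1) U
      unfolding FDlg_iff compose_restrict_PiE[OF dE] by blast
    moreover have "compose U snd d \<in> plots Y n U"
      using weak_plot_compose[OF P Y restrict_snd_smooth d] assms(2) U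
      unfolding FDlg_iff compose_restrict_PiE[OF dE] by blast
    ultimately show ?thesis using dE by (simp add: prod_dspace_def)
  qed
  then show ?thesis using P by (simp add: FDlg_iff)
qed

lemma is_product_prod_dspace:
  assumes "X \<in> FDlg" "Y \<in> FDlg"
  shows "is_product TYPE('c) X Y (prod_dspace X Y)
         (restrict fst (carrier X \<times> carrier Y)) (restrict snd (carrier X \<times> carrier Y))"
  unfolding is_product_def
proof (intro conjI allI impI ballI prod_dspace_FDlg assms restrict_fst_smooth restrict_snd_smooth ex1I)
  fix Z :: "'c dspace" and f g
  assume Z: "Z \<in> FDlg" and f: "f \<in> smooth_maps Z X" and g: "g \<in> smooth_maps Z Y"
  let ?h = "\<lambda>z\<in>carrier Z. (f z, g z)"
  have Zd: "diffeological_space Z" using Z by (simp add: FDlg_def)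
  show "?h \<in> smooth_maps Z (prod_dspace X Y)"
    unfolding smooth_maps_def
  proof (intro CollectI conjI allI impI ballI)
    show "?h \<in> carrier Z \<rightarrow>\<^sub>E carrier (prod_dspace X Y)"
      using smooth_mapsD(2)[OF f] smooth_mapsD(2)[OF g] by (auto simp: prod_dspace_def)
    fix n U d assume U: "open_in_Rn n U" and d: "d \<in> plots Z n U"
    have "compose U fst (compose U ?h d) = compose U f d" "compose U snd (compose U ?h d) = compose U g d"
      using plots_mem[OF Zd U d] by (auto simp: compose_def fun_eq_iff)
    then show "compose U ?h d \<in> plots (prod_dspace X Y) n U"
      using smooth_mapsD(3)[OF f U d] smooth_mapsD(3)[OF g U d] plots_mem[OF Zd U d]
        smooth_mapsD(2)[OF f] smooth_mapsD(2)[OF g]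
      by (auto simp: prod_dspace_def compose_def)
  qed
  show "compose (carrier Z) (restrict fst (carrier X \<times> carrier Y)) ?h = f"
    "compose (carrier Z) (restrict snd (carrier X \<times> carrier Y)) ?h = g"
    using smooth_mapsD(1)[OF f] smooth_mapsD(1)[OF g] by (auto simp: compose_def fun_eq_iff PiE_iff extensional_def)
  fix h assume h: "h \<in> smooth_maps Z (prod_dspace X Y) \<and>
    compose (carrier Z) (restrict fst (carrier X \<times> carrier Y)) h = f \<and>
    compose (carrier Z) (restrict snd (carrier X \<times> carrier Y)) h = g"
  then have hE: "h \<in> carrier Z \<rightarrow>\<^sub>E carrier X \<times> carrier Y"
    using smooth_mapsD(1)[of h Z "prod_dspace X Y"] by (simp add: prod_dspace_def)
  have "compose (carrier Z) fst h = f" "compose (carrier Z) snd h = g"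
    using h by (auto simp: compose_restrict_PiE[OF hE])
  then have "fst (h z) = f z \<and> snd (h z) = g z" if "z \<in> carrier Z" for z
    using compose_eq[OF that] by metis
  then show "h = ?h" using hE by (auto simp: fun_eq_iff PiE_iff extensional_def prod_eq_iff)
qed

section \<open>Exponentials\<close>

text \<open>The tube lemma seen through \<open>join\<close>: compactness of \<open>K\<close> gives
  one radius for all \<open>w\<close>. The clause \<open>w \<in> euc m\<close> keeps the joined
  point in \<open>euc (n + m)\<close>, the space containing \<open>G\<close>.\<close>

lemma tube_join:
  assumes G: "open_in_Rn (n + m) G" and K: "compact K" and u: "u \<in> euc n"
    and sub: "\<And>w. w \<in> K \<Longrightarrow> join n u w \<in> G"
  shows "\<exists>r>0. \<forall>y\<in>rbox n u r. \<forall>w\<in>K. w \<in> euc m \<longrightarrow> join n y w \<in> G"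
proof -
  obtain T where T: "open T" "G = euc (n + m) \<inter> T" using G by (auto simp: Euclidean_space_eq openin_open)
  let ?J = "\<lambda>(u, w). join n u w"
  have op: "open (?J -` T)" by (rule open_vimage[OF T(1) continuous_on_join])
  have "{u} \<times> K \<subseteq> ?J -` T" using sub T(2) by auto
  from Elementary_Topology.tube_lemma[OF K op this]
  obtain X0 where X0: "u \<in> X0" "open X0" "X0 \<times> K \<subseteq> ?J -` T" by (elim exE conjE)
  have "open_in_Rn n (euc n \<inter> X0)" using X0(2) by (auto simp: Euclidean_space_eq openin_open)
  then obtain r where r: "r > 0" "rbox n u r \<subseteq> euc n \<inter> X0"
    using X0(1) u unfolding openin_Euclidean_space_rbox by blast
  have "join n y w \<in> G" if "y \<in> rbox n u r" "w \<in> K" "w \<in> euc m" for y w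
  proof -
    have "join n y w \<in> euc (n + m)" using that(3) by (auto simp: join_def euc_def)
    moreover have "y \<in> X0" using r(2) that(1) by blast
    then have "join n y w \<in> T" using X0(3) that(2) by auto
    ultimately show ?thesis using T(2) by blast
  qed
  then show ?thesis using r(1) by blast
qed

section \<open>Iterated partial derivatives in the second group of variables\<close>

primrec pds :: "nat list \<Rightarrow> ((nat \<Rightarrow> real) \<Rightarrow> real) \<Rightarrow> (nat \<Rightarrow> real) \<Rightarrow> real"
  where "pds [] f = f" | "pds (j # \<alpha>) f = pd j (pds \<alpha> f)"

lemma C_infinity_pds:
  assumes U: "open_in_Rn n U" and f: "C_infinity n U f" and "set \<alpha> \<subseteq> {..<n}"
  shows "C_infinity n U (pds \<alpha> f)"
  using assms(3) by (induction \<alpha>) (use f C_infinity_pd(1)[OF U] in auto)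

text \<open>Direction \<open>j\<close> of the second factor is direction \<open>n + j\<close> of the
  product. The identity holds for arbitrary \<open>f\<close>, since at each level both sides are
  \<open>deriv\<close> of the same function of one variable at the same point.\<close>

lemma pds_join: "pds \<alpha> (\<lambda>w. f (join n u w)) w = pds (map ((+) n) \<alpha>) f (join n u w)"
proof (induction \<alpha> arbitrary: w)
  case (Cons j \<alpha>)
  have "pds \<alpha> (\<lambda>w. f (join n u w)) = (\<lambda>w. pds (map ((+) n) \<alpha>) f (join n u w))"
    using Cons.IH by blast
  then show ?case by (simp add: pd_def join_update_right) (simp add: join_def)
qed simp

text \<open>
  Directions \<open>j \<ge> m\<close> leave \<open>R^m\<close>, where \<open>pd j\<close> is a junk value; \<open>jet\<close> is set to zero there.
\<close>

definition jet :: "nat \<Rightarrow> nat list \<Rightarrow> ((nat \<Rightarrow> real) \<Rightarrow> real) \<Rightarrow> (nat \<Rightarrow> real) \<Rightarrow> real"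
  where "jet m \<alpha> f = (if set \<alpha> \<subseteq> {..<m} then pds \<alpha> f else (\<lambda>w. 0))"

lemma C_infinity_jet:
  "open_in_Rn m W \<Longrightarrow> C_infinity m W f \<Longrightarrow> C_infinity m W (jet m \<alpha> f)"
  unfolding jet_def by (simp add: C_infinity_pds C_infinity_const)

lemma has_pd_jet:
  assumes "open_in_Rn m W" "C_infinity m W f" "j < m" "w \<in> W"
  shows "has_pd j (jet m \<alpha> f) w (jet m (j # \<alpha>) f w)"
proof (cases "set \<alpha> \<subseteq> {..<m}")
  case True
  then show ?thesis
    using C_infinity_pd(2)[OF assms(1) C_infinity_pds[OF assms(1,2) True] assms(3,4)] assms(3)
    by (simp add: jet_def)
next
  case False
  then show ?thesis by (auto simp: jet_def has_pd_def)
qed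

section \<open>The functional diffeology\<close>

lemma exp_dspace_carrier [simp]: "carrier (exp_dspace X Y) = smooth_maps X Y"
  by (simp add: exp_dspace_def)

text \<open>A plot of the product of \<open>U\<close> and \<open>X\<close> is a pair of a smooth map
  \<open>\<phi>\<close> into \<open>U\<close> and a plot \<open>\<psi>\<close> of \<open>X\<close>;
  in this form the product space disappears from later arguments.\<close>

lemma plots_exp_dspace_iff:
  assumes X: "diffeological_space X" and U: "open_in_Rn n U"
  shows "d \<in> plots (exp_dspace X Y) n U \<longleftrightarrow> d \<in> U \<rightarrow>\<^sub>E smooth_maps X Y \<and>
    (\<forall>m V \<phi> \<psi>. open_in_Rn m V \<longrightarrow> \<phi> \<in> smooth_Rn m V n U \<longrightarrow> \<psi> \<in> plots X m V \<longrightarrow>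
       (\<lambda>v\<in>V. d (\<phi> v) (\<psi> v)) \<in> plots Y m V)" (is "_ \<longleftrightarrow> ?E \<and> ?R")
proof -
  let ?f = "\<lambda>(u, x)\<in>U \<times> carrier X. d u x"
  let ?P = "prod_dspace (Rn_dspace n U) X"
  have "?f \<in> smooth_maps ?P Y \<longleftrightarrow> ?R" if E: ?E
  proof
    assume S: "?f \<in> smooth_maps ?P Y"
    show ?R
    proof (intro allI impI)
      fix m V \<phi> \<psi> assume V: "open_in_Rn m V" and \<phi>: "\<phi> \<in> smooth_Rn m V n U" and \<psi>: "\<psi> \<in> plots X m V"
      let ?p = "\<lambda>v\<in>V. (\<phi> v, \<psi> v)"
      have "compose V fst ?p = \<phi>" "compose V snd ?p = \<psi>"
        using smooth_RnD(1)[OF \<phi>] plots_PiE[OF X V \<psi>]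
        by (auto simp: compose_def fun_eq_iff PiE_iff extensional_def)
      then have "?p \<in> plots ?P m V"
        using smooth_RnD(1)[OF \<phi>] plots_PiE[OF X V \<psi>] \<phi> \<psi>
        by (auto simp: prod_dspace_def Rn_dspace_def PiE_iff)
      from smooth_mapsD(3)[OF S V this] have "compose V ?f ?p \<in> plots Y m V" .
      moreover have "compose V ?f ?p = (\<lambda>v\<in>V. d (\<phi> v) (\<psi> v))"
        using smooth_RnD(2)[OF \<phi>] plots_mem[OF X V \<psi>] by (auto simp: compose_def fun_eq_iff)
      ultimately show "(\<lambda>v\<in>V. d (\<phi> v) (\<psi> v)) \<in> plots Y m V" by simp
    qed
  next
    assume R: ?R
    show "?f \<in> smooth_maps ?P Y"
      unfolding smooth_maps_def
    proof (intro CollectI conjI allI impI ballI)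
      show "?f \<in> carrier ?P \<rightarrow>\<^sub>E carrier Y"
        using E smooth_mapsD(2)[of _ X Y] by (auto simp: prod_dspace_def Rn_dspace_def PiE_iff)
      fix m V p assume V: "open_in_Rn m V" and p: "p \<in> plots ?P m V"
      then have pE: "p \<in> V \<rightarrow>\<^sub>E U \<times> carrier X" and \<phi>: "compose V fst p \<in> smooth_Rn m V n U"
        and \<psi>: "compose V snd p \<in> plots X m V"
        by (auto simp: prod_dspace_def Rn_dspace_def)
      have "(\<lambda>v\<in>V. d (compose V fst p v) (compose V snd p v)) \<in> plots Y m V"
        using R V \<phi> \<psi> by blast
      moreover have "(\<lambda>v\<in>V. d (compose V fst p v) (compose V snd p v)) = compose V ?f p"
      proof
        fix v
        show "(\<lambda>v\<in>V. d (compose V fst p v) (compose V snd p v)) v = compose V ?f p v"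
        proof (cases "v \<in> V")
          case True
          then have "p v \<in> U \<times> carrier X" using pE by blast
          then show ?thesis using True by (auto simp: compose_def)
        qed (simp add: compose_def)
      qed
      ultimately show "compose V ?f p \<in> plots Y m V" by simp
    qed
  qed
  then show ?thesis by (auto simp: exp_dspace_def)
qed

text \<open>Pulling the two arguments back along the projections of \<open>jprod\<close> makes them
  independent. For genuine plots joint smoothness is thus built in; for weak plots it is the point
  at issue.\<close>

lemma exp_plot_joint:
  assumes X: "diffeological_space X" and P: "open_in_Rn k P" and p: "p \<in> plots (exp_dspace X Y) k P"
    and V: "open_in_Rn m V" and \<psi>: "\<psi> \<in> plots X m V"
  shows "(\<lambda>x\<in>jprod k P V. p (fstn k x) (\<psi> (sndn k x))) \<in> plots Y (k + m) (jprod k P V)"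
proof -
  note J = open_in_Rn_jprod[OF P V]
  have "compose (jprod k P V) \<psi> (restrict (sndn k) (jprod k P V)) \<in> plots X (k + m) (jprod k P V)"
    by (rule plots_compose[OF X V J \<psi> smooth_Rn_sndn[OF P V]])
  then have "(\<lambda>x\<in>jprod k P V. p (restrict (fstn k) (jprod k P V) x)
      (compose (jprod k P V) \<psi> (restrict (sndn k) (jprod k P V)) x)) \<in> plots Y (k + m) (jprod k P V)"
    using p[unfolded plots_exp_dspace_iff[OF X P]] J smooth_Rn_fstn[OF P V] by blast
  moreover have "(\<lambda>x\<in>jprod k P V. p (restrict (fstn k) (jprod k P V) x)
      (compose (jprod k P V) \<psi> (restrict (sndn k) (jprod k P V)) x)) =
      (\<lambda>x\<in>jprod k P V. p (fstn k x) (\<psi> (sndn k x)))"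
    by (auto simp: compose_def fun_eq_iff)
  ultimately show ?thesis by simp
qed

lemma diffeological_exp_dspace:
  assumes X: "diffeological_space X" and Y: "diffeological_space Y"
  shows "diffeological_space (exp_dspace X Y)"
proof (rule diffeological_spaceI)
  fix n U d assume "open_in_Rn n U" "d \<in> plots (exp_dspace X Y) n U"
  then show "d \<in> U \<rightarrow>\<^sub>E carrier (exp_dspace X Y)" by (simp add: exp_dspace_def)
next
  fix n U f assume U: "open_in_Rn n U" and f: "f \<in> carrier (exp_dspace X Y)"
  then have f: "f \<in> smooth_maps X Y" by simp
  have "(\<lambda>v\<in>V. (\<lambda>u\<in>U. f) (\<phi> v) (\<psi> v)) \<in> plots Y m V"
    if V: "open_in_Rn m V" and \<phi>: "\<phi> \<in> smooth_Rn m V n U" and \<psi>: "\<psi> \<in> plots X m V" for m V \<phi> \<psi>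
  proof -
    have "(\<lambda>v\<in>V. (\<lambda>u\<in>U. f) (\<phi> v) (\<psi> v)) = compose V f \<psi>"
      using smooth_RnD(2)[OF \<phi>] by (auto simp: compose_def fun_eq_iff)
    then show ?thesis using smooth_mapsD(3)[OF f V \<psi>] by simp
  qed
  then show "(\<lambda>u\<in>U. f) \<in> plots (exp_dspace X Y) n U"
    unfolding plots_exp_dspace_iff[OF X U] using f by auto
next
  fix n U k P d g assume U: "open_in_Rn n U" and P: "open_in_Rn k P"
    and d: "d \<in> plots (exp_dspace X Y) n U" and g: "g \<in> smooth_Rn k P n U"
  note d' = d[unfolded plots_exp_dspace_iff[OF X U]]
  have "(\<lambda>v\<in>V. compose P d g (\<phi> v) (\<psi> v)) \<in> plots Y m V"
    if V: "open_in_Rn m V" and \<phi>: "\<phi> \<in> smooth_Rn m V k P" and \<psi>: "\<psi> \<in> plots X m V" for m V \<phi> \<psi>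
  proof -
    have "(\<lambda>v\<in>V. d (compose V g \<phi> v) (\<psi> v)) \<in> plots Y m V"
      using d' V smooth_Rn_compose[OF V P g \<phi>] \<psi> by blast
    moreover have "(\<lambda>v\<in>V. d (compose V g \<phi> v) (\<psi> v)) = (\<lambda>v\<in>V. compose P d g (\<phi> v) (\<psi> v))"
      using smooth_RnD(2)[OF \<phi>] by (auto simp: compose_def fun_eq_iff)
    ultimately show ?thesis by simp
  qed
  moreover have "compose P d g \<in> P \<rightarrow>\<^sub>E smooth_maps X Y"
    using d' smooth_RnD(2)[OF g] by (auto simp: compose_def)
  ultimately show "compose P d g \<in> plots (exp_dspace X Y) k P"
    unfolding plots_exp_dspace_iff[OF X P] by blast
next
  fix n U d \<U> assume U: "open_in_Rn n U" and d: "d \<in> U \<rightarrow>\<^sub>E carrier (exp_dspace X Y)"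
    and op: "\<And>W. W \<in> \<U> \<Longrightarrow> open_in_Rn n W" and un: "\<Union>\<U> = U"
    and pl: "\<And>W. W \<in> \<U> \<Longrightarrow> restrict d W \<in> plots (exp_dspace X Y) n W"
  have dE: "d \<in> U \<rightarrow>\<^sub>E smooth_maps X Y" using d by simp
  have "(\<lambda>v\<in>V. d (\<phi> v) (\<psi> v)) \<in> plots Y m V" (is "?c \<in> _")
    if V: "open_in_Rn m V" and \<phi>: "\<phi> \<in> smooth_Rn m V n U" and \<psi>: "\<psi> \<in> plots X m V" for m V \<phi> \<psi>
  proof (rule plots_glue[OF Y V])
    have "d (\<phi> v) (\<psi> v) \<in> carrier Y" if "v \<in> V" for v
    proof -
      have "d (\<phi> v) \<in> smooth_maps X Y" using dE smooth_RnD(2)[OF \<phi> that] by blast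
      from smooth_mapsD(2)[OF this plots_mem[OF X V \<psi> that]] show ?thesis .
    qed
    then show "?c \<in> V \<rightarrow>\<^sub>E carrier Y" by auto
    \<comment> \<open>The cover of \<open>U\<close> is pulled back along \<open>\<phi>\<close> to a
      cover of \<open>V\<close>, on which the gluing axiom of \<open>Y\<close> is used.\<close>
    let ?S = "\<lambda>W. {v \<in> V. \<phi> v \<in> W}"
    have opS: "open_in_Rn m (?S W)" if "W \<in> \<U>" for W
      by (rule open_in_Rn_smooth_preimage[OF V open_in_Rn_subset[OF U] \<phi> op[OF that]])
    show "\<Union>(?S ` \<U>) = V" using smooth_RnD(2)[OF \<phi>] un by auto
    fix S assume "S \<in> ?S ` \<U>"
    then obtain W where W: "W \<in> \<U>" and S: "S = ?S W" by blast
    show oS: "open_in_Rn m S" using opS[OF W] S by simp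
    have SV: "S \<subseteq> V" using S by auto
    have \<phi>S: "restrict \<phi> S \<in> smooth_Rn m S n W"
      using S smooth_RnD(3)[OF \<phi>] by (intro smooth_Rn_restrictI[OF oS] C_infinity_subset[OF V oS SV]) auto
    have "(\<lambda>v\<in>S. restrict d W (restrict \<phi> S v) (restrict \<psi> S v)) \<in> plots Y m S"
      using pl[OF W, unfolded plots_exp_dspace_iff[OF X op[OF W]]] oS \<phi>S plots_restrict[OF X V oS SV \<psi>] by blast
    moreover have "(\<lambda>v\<in>S. restrict d W (restrict \<phi> S v) (restrict \<psi> S v)) = restrict ?c S"
      using S by (auto simp: fun_eq_iff)
    ultimately show "restrict ?c S \<in> plots Y m S" by simp
  qed
  then show "d \<in> plots (exp_dspace X Y) n U"
    unfolding plots_exp_dspace_iff[OF X U] using dE by blast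
qed

text \<open>Supplies the domains of the functionals. Along a plot \<open>p\<close> the pairs (u, w)
  with \<open>p u (\<psi> w) \<in> B\<close> form an open set, and if it contains a slice over the
  compact \<open>K\<close>, it contains all neighbouring slices.\<close>

lemma D_open_compact_open:
  assumes X: "diffeological_space X" and Y: "diffeological_space Y"
    and V: "open_in_Rn m V" and \<psi>: "\<psi> \<in> plots X m V" and K: "compact K" "K \<subseteq> V" and B: "D_open Y B"
  shows "D_open (exp_dspace X Y) {f \<in> smooth_maps X Y. \<forall>w\<in>K. f (\<psi> w) \<in> B}"
  unfolding D_open_iff[OF diffeological_exp_dspace[OF X Y]]
proof (intro conjI allI impI)
  fix k P p assume P: "open_in_Rn k P" and p: "p \<in> plots (exp_dspace X Y) k P"
  let ?O = "{f \<in> smooth_maps X Y. \<forall>w\<in>K. f (\<psi> w) \<in> B}"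
  let ?c = "\<lambda>x\<in>jprod k P V. p (fstn k x) (\<psi> (sndn k x))"
  let ?G = "{x \<in> jprod k P V. ?c x \<in> B}"
  have pE: "p \<in> P \<rightarrow>\<^sub>E smooth_maps X Y" using p by (simp add: exp_dspace_def)
  have Pe: "P \<subseteq> euc k" and Ve: "V \<subseteq> euc m" using P V open_in_Rn_subset by auto
  have G: "open_in_Rn (k + m) ?G"
    using B exp_plot_joint[OF X P p V \<psi>] open_in_Rn_jprod[OF P V] unfolding D_open_iff[OF Y] by blast
  have memG: "join k u w \<in> ?G \<longleftrightarrow> p u (\<psi> w) \<in> B" if "u \<in> P" "w \<in> V" for u w
    using join_in_jprod[OF that Pe] fstn_join[of u k w] that Pe by auto
  show "open_in_Rn k {u \<in> P. p u \<in> ?O}"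
    unfolding openin_Euclidean_space_rbox
  proof (intro conjI ballI)
    show "{u \<in> P. p u \<in> ?O} \<subseteq> euc k" using Pe by auto
    fix u assume u: "u \<in> {u \<in> P. p u \<in> ?O}"
    have uG: "join k u w \<in> ?G" if "w \<in> K" for w using memG[of u w] u that K(2) by blast
    have "u \<in> euc k" using u Pe by blast
    from tube_join[OF G K(1) this uG] obtain r where
      r: "r > 0" "\<forall>y\<in>rbox k u r. \<forall>w\<in>K. w \<in> euc m \<longrightarrow> join k y w \<in> ?G" by blast
    obtain s where s: "s > 0" "rbox k u s \<subseteq> P" using u P openin_Euclidean_space_rbox by blast
    have "rbox k u (min r s) \<subseteq> {u \<in> P. p u \<in> ?O}"
    proof
      fix y assume "y \<in> rbox k u (min r s)"
      then have y: "y \<in> rbox k u r" "y \<in> P" using rbox_mono s(2) min.cobounded1 min.cobounded2 by blast+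
      have "p y (\<psi> w) \<in> B" if w: "w \<in> K" for w
        using r(2) y(1) w K(2) Ve memG[OF y(2), of w] by blast
      then show "y \<in> {u \<in> P. p u \<in> ?O}" using y(2) pE by blast
    qed
    then show "\<exists>r>0. rbox k u r \<subseteq> {u \<in> P. p u \<in> ?O}" using r(1) s(1) by (meson min_less_iff_conj)
  qed
qed auto

text \<open>The pair \<open>W \<subseteq> K\<close> meets two opposite demands: compactness of
  \<open>K\<close> makes \<open>U'\<close> open, while derivatives in \<open>w\<close> require the
  open set \<open>W\<close>. Once \<open>u\<close> is restricted to \<open>U'\<close>, the map
  \<open>w \<mapsto> l (d u (\<psi> w))\<close> is smooth on \<open>W\<close>, and its derivatives
  form the jet family.\<close>

lemma weak_plot_exp_joint_smooth:
  assumes X: "diffeological_space X" and Y: "diffeological_space Y"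
    and U: "open_in_Rn n U" and d: "weak_plot (exp_dspace X Y) n U d"
    and V: "open_in_Rn m V" and \<psi>: "\<psi> \<in> plots X m V"
    and B: "D_open Y B" and l: "l \<in> smooth_maps (sub_dspace B Y) real_dspace"
    and K: "compact K" "K \<subseteq> V" and W: "open_in_Rn m W" "W \<subseteq> K"
  defines "U' \<equiv> {u \<in> U. d u \<in> {f \<in> smooth_maps X Y. \<forall>w\<in>K. f (\<psi> w) \<in> B}}"
  shows "open_in_Rn n U'"
    and "C_infinity (n + m) (jprod n U' W) (\<lambda>x. l (d (fstn n x) (\<psi> (sndn n x))))"
proof -
  let ?E = "exp_dspace X Y" and ?O = "{f \<in> smooth_maps X Y. \<forall>w\<in>K. f (\<psi> w) \<in> B}"
  note E = diffeological_exp_dspace[OF X Y]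
  note O = D_open_compact_open[OF X Y V \<psi> K B]
  show U': "open_in_Rn n U'"
    using d O unfolding weak_plot_def U'_def by blast
  have WV: "W \<subseteq> V" using W(2) K(2) by blast
  note l' = l[unfolded smooth_real_iff[OF Y], THEN conjunct2, rule_format]
  define H where "H \<alpha> u w = jet m \<alpha> (\<lambda>w. l (d u (\<psi> w))) w" for \<alpha> u w
  have h: "C_infinity m W (\<lambda>w. l (d u (\<psi> w)))" if u: "u \<in> U'" for u
  proof -
    have du: "d u \<in> smooth_maps X Y" "\<And>w. w \<in> K \<Longrightarrow> d u (\<psi> w) \<in> B" using u by (auto simp: U'_def)
    let ?c = "restrict (compose V (d u) \<psi>) W"
    have "?c \<in> plots Y m W"
      by (rule plots_restrict[OF Y V W(1) WV smooth_mapsD(3)[OF du(1) V \<psi>]])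
    moreover have eq: "?c w = d u (\<psi> w)" if "w \<in> W" for w
      using that WV by (auto simp: compose_def)
    then have "?c ` W \<subseteq> B" using du(2) W(2) by auto
    ultimately have "C_infinity m W (\<lambda>w. l (?c w))" by (rule l'[OF W(1)])
    then show ?thesis by (subst C_infinity_cong[OF W(1), where g = "\<lambda>w. l (?c w)"]) (simp_all only: eq)
  qed
  have weak: "C_infinity n U' (\<lambda>u. \<Sum>k. a k * H \<alpha> u (w k))"
    if K': "compact K'" "K' \<subseteq> W" and w: "\<And>k. w k \<in> K'" and a: "\<And>k. \<bar>a k\<bar> \<le> (1/3) ^ k" for \<alpha> K' w a
  proof -
    define \<Lambda> where "\<Lambda> f = (\<Sum>k. a k * jet m \<alpha> (\<lambda>w. l (f (\<psi> w))) (w k))" for f :: "'a \<Rightarrow> 'b"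
    \<comment> \<open>Smoothness of the functional is tested on genuine plots \<open>p\<close>, for
      which \<open>l (p u (\<psi> w))\<close> is jointly smooth in (u, w). Its derivatives in
      \<open>w\<close> become joint derivatives in shifted directions, and
      \<open>C_infinity_series\<close> applies.\<close>
    have "restrict \<Lambda> ?O \<in> smooth_maps (sub_dspace ?O ?E) real_dspace"
      unfolding smooth_real_iff[OF E]
    proof (intro conjI allI impI restrict_extensional)
      fix k P p assume P: "open_in_Rn k P" and p: "p \<in> plots ?E k P" and pO: "p ` P \<subseteq> ?O"
      have "C_infinity k P (\<lambda>u. \<Lambda> (p u))"
      proof (cases "set \<alpha> \<subseteq> {..<m}")
        case False
        then show ?thesis using P by (simp add: \<Lambda>_def jet_def C_infinity_const)
      next
        case True
        let ?F = "\<lambda>x. l (p (fstn k x) (\<psi> (sndn k x)))"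
        let ?c = "\<lambda>x\<in>jprod k P V. p (fstn k x) (\<psi> (sndn k x))"
        note J = open_in_Rn_jprod[OF P W(1)]
        have sub: "jprod k P W \<subseteq> jprod k P V" using WV by (auto simp: jprod_def)
        have eq: "restrict ?c (jprod k P W) x = p (fstn k x) (\<psi> (sndn k x))" if "x \<in> jprod k P W" for x
          using that sub by auto
        have "restrict ?c (jprod k P W) ` jprod k P W \<subseteq> B"
          using pO W(2) eq by (auto simp: jprod_def)
        from l'[OF J plots_restrict[OF Y open_in_Rn_jprod[OF P V] J sub exp_plot_joint[OF X P p V \<psi>]] this]
        have F: "C_infinity (k + m) (jprod k P W) ?F"
          by (subst C_infinity_cong[OF J, where g = "\<lambda>x. l (restrict ?c (jprod k P W) x)"]) (simp_all only: eq)
        have "set (map ((+) k) \<alpha>) \<subseteq> {..<k + m}" using True by auto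
        from C_infinity_series[OF P W(1) K' C_infinity_pds[OF J F this] w a]
        have "C_infinity k P (\<lambda>u. \<Sum>j. a j * pds (map ((+) k) \<alpha>) ?F (join k u (w j)))" .
        moreover have "\<Lambda> (p u) = (\<Sum>j. a j * pds (map ((+) k) \<alpha>) ?F (join k u (w j)))" if "u \<in> P" for u
        proof -
          have "fstn k (join k u v) = u" for v using that open_in_Rn_subset[OF P] by (auto intro: fstn_join)
          then have "(\<lambda>v. l (p u (\<psi> v))) = (\<lambda>v. ?F (join k u v))" by simp
          then show ?thesis unfolding \<Lambda>_def jet_def using True by (simp only: if_True pds_join[where f = ?F and n = k and u = u])
        qed
        ultimately show ?thesis by (subst C_infinity_cong[OF P]) simp_all
      qed
      then show "C_infinity k P (\<lambda>u. restrict \<Lambda> ?O (p u))"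
        by (subst C_infinity_cong[OF P, where g = "\<lambda>u. \<Lambda> (p u)"]) (use pO in auto)
    qed
    \<comment> \<open>Here the smoothness test satisfied by the weak plot \<open>d\<close> is
      applied to the functional; on \<open>U'\<close> the values of \<open>d\<close> lie in its
      domain.\<close>
    then have "C_infinity n U' (\<lambda>u. restrict \<Lambda> ?O (d u))"
      using d O unfolding weak_plot_def U'_def by blast
    then show ?thesis
      by (subst C_infinity_cong[OF U', where g = "\<lambda>u. restrict \<Lambda> ?O (d u)"])
         (simp_all add: \<Lambda>_def H_def U'_def)
  qed
  have "jet_smooth n m U' W H"
    unfolding jet_smooth_def
  proof (intro conjI ballI allI impI)
    fix u \<alpha> assume u: "u \<in> U'"
    show "continuous_on W (H \<alpha> u)"
      using C_infinity_continuous[OF W(1) C_infinity_jet[OF W(1) h[OF u]]] unfolding H_def .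
    fix j w assume "j < m" "w \<in> W"
    from has_pd_jet[OF W(1) h[OF u] this] show "has_pd j (H \<alpha> u) w (H (j # \<alpha>) u w)"
      unfolding H_def .
  next
    fix \<alpha> K' a and w :: "nat \<Rightarrow> nat \<Rightarrow> real"
    assume "compact K'" "K' \<subseteq> W" "\<forall>k. w k \<in> K'" "\<forall>k. \<bar>a k\<bar> \<le> (1/3::real) ^ k"
    then show "C_infinity n U' (\<lambda>u. \<Sum>k. a k * H \<alpha> u (w k))" by (intro weak) auto
  qed
  from jet_smooth_C_infinity_joint[OF U' W(1) this]
  show "C_infinity (n + m) (jprod n U' W) (\<lambda>x. l (d (fstn n x) (\<psi> (sndn n x))))"
    by (simp add: H_def jet_def)
qed

text \<open>As \<open>Y\<close> is functionally generated, it is enough that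
  \<open>v \<mapsto> d (\<phi> v) (\<psi> v)\<close> is a weak plot of \<open>Y\<close>. Both halves
  of that condition are local, so they can be checked near one point \<open>v0\<close>, where a
  compact box is available.\<close>

lemma exp_dspace_FDlg:
  assumes X: "diffeological_space X" and "Y \<in> FDlg"
  shows "exp_dspace X Y \<in> FDlg"
proof -
  have Y: "diffeological_space Y"
    and Yfg: "\<And>n U d. open_in_Rn n U \<Longrightarrow> weak_plot Y n U d \<Longrightarrow> d \<in> plots Y n U"
    using assms(2) by (auto simp: FDlg_iff)
  have "d \<in> plots (exp_dspace X Y) n U"
    if U: "open_in_Rn n U" and d: "weak_plot (exp_dspace X Y) n U d" for n U d
  proof -
    have dE: "d \<in> U \<rightarrow>\<^sub>E smooth_maps X Y" using d by (simp add: weak_plot_def)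
    have Ue: "U \<subseteq> euc n" by (rule open_in_Rn_subset[OF U])
    have "(\<lambda>v\<in>V. d (\<phi> v) (\<psi> v)) \<in> plots Y m V" (is "?c \<in> _")
      if V: "open_in_Rn m V" and \<phi>: "\<phi> \<in> smooth_Rn m V n U" and \<psi>: "\<psi> \<in> plots X m V" for m V \<phi> \<psi>
    proof (rule Yfg[OF V])
      have Ve: "V \<subseteq> euc m" by (rule open_in_Rn_subset[OF V])
      have d\<phi>: "d (\<phi> v) \<in> smooth_maps X Y" if "v \<in> V" for v
        using dE smooth_RnD(2)[OF \<phi> that] by blast
      have locally: "\<exists>S. open_in_Rn m S \<and> v0 \<in> S \<and> S \<subseteq> {v \<in> V. ?c v \<in> B} \<and>
          (\<forall>l\<in>smooth_maps (sub_dspace B Y) real_dspace. C_infinity m S (\<lambda>v. l (?c v)))"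
        if B: "D_open Y B" and v0: "v0 \<in> {v \<in> V. ?c v \<in> B}" for B v0
      proof -
        have v0V: "v0 \<in> V" and v0B: "d (\<phi> v0) (\<psi> v0) \<in> B" using v0 by auto
        \<comment> \<open>With the first argument frozen at \<open>\<phi> v0\<close> a plot of
          \<open>Y\<close> remains, so \<open>B\<close> is hit on a whole compact box around
          \<open>v0\<close>. This is what puts \<open>\<phi> v0\<close> into
          \<open>U'\<close>.\<close>
        let ?h = "compose V (d (\<phi> v0)) \<psi>"
        have "open_in_Rn m {v \<in> V. ?h v \<in> B}"
          using B smooth_mapsD(3)[OF d\<phi>[OF v0V] V \<psi>] V unfolding D_open_iff[OF Y] by blast
        moreover have "v0 \<in> {v \<in> V. ?h v \<in> B}" using v0V v0B by (simp add: compose_def)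
        ultimately obtain r where r: "r > 0" "rbox m v0 r \<subseteq> {v \<in> V. ?h v \<in> B}"
          unfolding openin_Euclidean_space_rbox by blast
        let ?K = "rbox m v0 r"
        have K: "?K \<subseteq> V" "\<And>w. w \<in> ?K \<Longrightarrow> d (\<phi> v0) (\<psi> w) \<in> B"
          using r(2) by (auto simp: compose_def)
        obtain W where W: "open_in_Rn m W" "v0 \<in> W" "W \<subseteq> ?K"
          using open_neighbourhood_in_rbox[of v0 m r] v0V Ve r(1) by blast
        define U' where "U' = {u \<in> U. d u \<in> {f \<in> smooth_maps X Y. \<forall>w\<in>?K. f (\<psi> w) \<in> B}}"
        note joint = weak_plot_exp_joint_smooth[OF X Y U d V \<psi> B _ compact_rbox K(1) W(1,3), folded U'_def]
        have U': "open_in_Rn n U'"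
          using d D_open_compact_open[OF X Y V \<psi> compact_rbox K(1) B] unfolding weak_plot_def U'_def by blast
        define S where "S = {v \<in> V. \<phi> v \<in> U'} \<inter> W"
        have S: "open_in_Rn m S" unfolding S_def
          by (intro openin_Int W(1) open_in_Rn_smooth_preimage[OF V Ue \<phi> U'])
        have v0S: "v0 \<in> S"
          using v0V W(2) smooth_RnD(2)[OF \<phi> v0V] d\<phi>[OF v0V] K(2) by (auto simp: S_def U'_def)
        have SV: "S \<subseteq> V" by (auto simp: S_def)
        have SB: "S \<subseteq> {v \<in> V. ?c v \<in> B}" using W(3) by (auto simp: S_def U'_def)
        have "C_infinity m S (\<lambda>v. l (?c v))" if l: "l \<in> smooth_maps (sub_dspace B Y) real_dspace" for l
        proof -
          let ?F = "\<lambda>x. l (d (fstn n x) (\<psi> (sndn n x)))"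
          \<comment> \<open>The jointly smooth function is restricted to the pairs (\<phi> v, v);
            membership of \<open>v\<close> in \<open>S\<close> keeps them in the product of
            \<open>U'\<close> and \<open>W\<close>.\<close>
          have "C_infinity m S (\<lambda>v. ?F (join n (\<phi> v) v))"
          proof (rule C_infinity_compose[OF S open_in_Rn_jprod[OF U' W(1)], where F = ?F and f = "\<lambda>v. join n (\<phi> v) v"])
            show "(\<lambda>v. join n (\<phi> v) v) ` S \<subseteq> jprod n U' W"
              using open_in_Rn_subset[OF U'] by (auto simp: S_def intro!: join_in_jprod)
            show "C_infinity m S (\<lambda>v. join n (\<phi> v) v j)" for j
            proof (cases "j < n")
              case True
              then show ?thesis
                using C_infinity_subset[OF V S SV smooth_RnD(3)[OF \<phi> True]] by (simp add: join_def)
            next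
              case False
              then show ?thesis using C_infinity_coord[OF S] by (simp add: join_def)
            qed
            show "C_infinity (n + m) (jprod n U' W) ?F" by (rule joint(2)[OF l])
          qed
          moreover have "l (?c v) = ?F (join n (\<phi> v) v)" if "v \<in> S" for v
          proof -
            have "fstn n (join n (\<phi> v) v) = \<phi> v"
              using that SV smooth_RnD(2)[OF \<phi>] Ue by (intro fstn_join) blast
            then show ?thesis using that SV by auto
          qed
          ultimately show ?thesis by (subst C_infinity_cong[OF S]) simp_all
        qed
        then show ?thesis using S v0S SB by blast
      qed
      show "weak_plot Y m V ?c"
        unfolding weak_plot_def
      proof (intro conjI allI impI ballI)
        show "?c \<in> V \<rightarrow>\<^sub>E carrier Y"
          using smooth_mapsD(2)[OF d\<phi> plots_mem[OF X V \<psi>]] by auto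
        fix B assume B: "D_open Y B"
        show op: "open_in_Rn m {v \<in> V. ?c v \<in> B}"
          using locally[OF B] by (subst openin_subopen) blast
        fix l assume l: "l \<in> smooth_maps (sub_dspace B Y) real_dspace"
        show "C_infinity m {v \<in> V. ?c v \<in> B} (\<lambda>v. l (?c v))"
          by (rule C_infinity_local[OF op]) (use locally[OF B] l in blast)
      qed
    qed
    then show ?thesis unfolding plots_exp_dspace_iff[OF X U] using dE by blast
  qed
  then show ?thesis using diffeological_exp_dspace[OF X Y] by (simp add: FDlg_iff)
qed

section \<open>Evaluation, currying and the universal property\<close>

lemma eval_map_smooth:
  assumes X: "diffeological_space X"
  shows "eval_map X Y \<in> smooth_maps (prod_dspace (exp_dspace X Y) X) Y"
  unfolding smooth_maps_def
proof (intro CollectI conjI allI impI ballI)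
  show "eval_map X Y \<in> carrier (prod_dspace (exp_dspace X Y) X) \<rightarrow>\<^sub>E carrier Y"
    using smooth_mapsD(2) by (fastforce simp: eval_map_def prod_dspace_def)
  fix n U p assume U: "open_in_Rn n U" and "p \<in> plots (prod_dspace (exp_dspace X Y) X) n U"
  then have pE: "p \<in> U \<rightarrow>\<^sub>E smooth_maps X Y \<times> carrier X"
    and d: "compose U fst p \<in> plots (exp_dspace X Y) n U" and \<psi>: "compose U snd p \<in> plots X n U"
    by (auto simp: prod_dspace_def)
  \<comment> \<open>The description of plots of the function space is used with the identity of
    \<open>U\<close> as \<open>\<phi>\<close>.\<close>
  have "(\<lambda>v\<in>U. compose U fst p ((\<lambda>x\<in>U. x) v) (compose U snd p v)) \<in> plots Y n U"
    using d[unfolded plots_exp_dspace_iff[OF X U]] U smooth_Rn_inclusion[OF U order_refl] \<psi> by blast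
  moreover have "(\<lambda>v\<in>U. compose U fst p ((\<lambda>x\<in>U. x) v) (compose U snd p v)) = compose U (eval_map X Y) p"
  proof
    fix v show "(\<lambda>v\<in>U. compose U fst p ((\<lambda>x\<in>U. x) v) (compose U snd p v)) v = compose U (eval_map X Y) p v"
    proof (cases "v \<in> U")
      case True
      then have "p v \<in> smooth_maps X Y \<times> carrier X" using pE by blast
      then show ?thesis using True by (auto simp: compose_def eval_map_def)
    qed (simp add: compose_def)
  qed
  ultimately show "compose U (eval_map X Y) p \<in> plots Y n U" by simp
qed

text \<open>All plots to be checked have the form \<open>f\<close> applied to a pair of plots of
  \<open>Z\<close> and \<open>X\<close>; a single point \<open>z\<close> enters as a constant
  plot.\<close>

lemma curry_smooth:
  assumes Z: "diffeological_space Z" and X: "diffeological_space X"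
    and f: "f \<in> smooth_maps (prod_dspace Z X) Y"
  shows "(\<lambda>z\<in>carrier Z. \<lambda>x\<in>carrier X. f (z, x)) \<in> smooth_maps Z (exp_dspace X Y)"
proof -
  let ?g = "\<lambda>z\<in>carrier Z. \<lambda>x\<in>carrier X. f (z, x)"
  have fY: "f (z, x) \<in> carrier Y" if "z \<in> carrier Z" "x \<in> carrier X" for z x
    using smooth_mapsD(2)[OF f, of "(z, x)"] that by (simp add: prod_dspace_def)
  have pair: "(\<lambda>v\<in>V. f (d v, \<psi> v)) \<in> plots Y m V"
    if V: "open_in_Rn m V" and d: "d \<in> plots Z m V" and \<psi>: "\<psi> \<in> plots X m V" for m V d \<psi>
  proof -
    let ?p = "\<lambda>v\<in>V. (d v, \<psi> v)"
    have "compose V fst ?p = d" "compose V snd ?p = \<psi>"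
      using plots_PiE[OF Z V d] plots_PiE[OF X V \<psi>]
      by (auto simp: compose_def fun_eq_iff PiE_iff extensional_def)
    then have "?p \<in> plots (prod_dspace Z X) m V"
      using plots_mem[OF Z V d] plots_mem[OF X V \<psi>] d \<psi> by (auto simp: prod_dspace_def)
    from smooth_mapsD(3)[OF f V this] show ?thesis
      by (simp add: compose_def cong: restrict_cong)
  qed
  have g: "?g z \<in> smooth_maps X Y" if z: "z \<in> carrier Z" for z
    unfolding smooth_maps_def
  proof (intro CollectI conjI allI impI ballI)
    show "?g z \<in> carrier X \<rightarrow>\<^sub>E carrier Y" using fY z by auto
    fix m V \<psi> assume V: "open_in_Rn m V" and \<psi>: "\<psi> \<in> plots X m V"
    have "compose V (?g z) \<psi> = (\<lambda>v\<in>V. f ((\<lambda>u\<in>V. z) v, \<psi> v))"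
      using z plots_mem[OF X V \<psi>] by (auto simp: compose_def fun_eq_iff)
    then show "compose V (?g z) \<psi> \<in> plots Y m V"
      using pair[OF V plots_const[OF Z V z] \<psi>] by simp
  qed
  show ?thesis
    unfolding smooth_maps_def
  proof (intro CollectI conjI allI impI ballI)
    show "?g \<in> carrier Z \<rightarrow>\<^sub>E carrier (exp_dspace X Y)" using g by auto
    fix n U d assume U: "open_in_Rn n U" and d: "d \<in> plots Z n U"
    have "(\<lambda>v\<in>V. compose U ?g d (\<phi> v) (\<psi> v)) \<in> plots Y m V"
      if V: "open_in_Rn m V" and \<phi>: "\<phi> \<in> smooth_Rn m V n U" and \<psi>: "\<psi> \<in> plots X m V" for m V \<phi> \<psi>
    proof -
      have "(\<lambda>v\<in>V. compose U ?g d (\<phi> v) (\<psi> v)) = (\<lambda>v\<in>V. f (compose V d \<phi> v, \<psi> v))"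
        using smooth_RnD(2)[OF \<phi>] plots_mem[OF Z U d] plots_mem[OF X V \<psi>]
        by (auto simp: compose_def fun_eq_iff)
      then show ?thesis using pair[OF V plots_compose[OF Z U V d \<phi>] \<psi>] by simp
    qed
    moreover have "compose U ?g d \<in> U \<rightarrow>\<^sub>E smooth_maps X Y"
    proof (rule PiE_I)
      show "compose U ?g d u \<in> smooth_maps X Y" if "u \<in> U" for u
        using g[OF plots_mem[OF Z U d that]] that by (simp add: compose_def)
    qed (simp add: compose_def)
    ultimately show "compose U ?g d \<in> plots (exp_dspace X Y) n U"
      unfolding plots_exp_dspace_iff[OF X U] by blast
  qed
qed

lemma is_exponential_exp_dspace:
  assumes "X \<in> FDlg" "Y \<in> FDlg"
  shows "is_exponential TYPE('c) X Y (exp_dspace X Y) (eval_map X Y)"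
proof -
  have X: "diffeological_space X" using assms by (simp add: FDlg_def)
  show ?thesis
    unfolding is_exponential_def
  proof (intro conjI allI impI ballI exp_dspace_FDlg eval_map_smooth X assms(2) ex1I)
    fix Z :: "'c dspace" and f assume "Z \<in> FDlg" and f: "f \<in> smooth_maps (prod_dspace Z X) Y"
    then have Z: "diffeological_space Z" by (simp add: FDlg_def)
    let ?g = "\<lambda>z\<in>carrier Z. \<lambda>x\<in>carrier X. f (z, x)"
    show g: "?g \<in> smooth_maps Z (exp_dspace X Y)" by (rule curry_smooth[OF Z X f])
    have fE: "f \<in> extensional (carrier Z \<times> carrier X)"
      using smooth_mapsD(1)[OF f] by (simp add: prod_dspace_def PiE_iff)
    \<comment> \<open>Equality of total functions: outside the carriers both sides are
      \<open>undefined\<close>, on the right because \<open>f\<close> is extensional.\<close>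
    show "compose (carrier Z \<times> carrier X) (eval_map X Y) (map_prod ?g (\<lambda>x. x)) = f"
    proof
      fix p show "compose (carrier Z \<times> carrier X) (eval_map X Y) (map_prod ?g (\<lambda>x. x)) p = f p"
      proof (cases "p \<in> carrier Z \<times> carrier X")
        case True
        then obtain z x where p: "p = (z, x)" "z \<in> carrier Z" "x \<in> carrier X" by blast
        have "?g z \<in> smooth_maps X Y" using smooth_mapsD(2)[OF g p(2)] by simp
        then show ?thesis using p by (simp add: compose_def eval_map_def)
      next
        case False
        then have "f p = undefined" by (rule extensional_arb[OF fE])
        then show ?thesis using False by (simp add: compose_def)
      qed
    qed
    fix h assume h: "h \<in> smooth_maps Z (exp_dspace X Y) \<and>
      compose (carrier Z \<times> carrier X) (eval_map X Y) (map_prod h (\<lambda>x. x)) = f"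
    show "h = ?g"
    proof
      fix z show "h z = ?g z"
      proof (cases "z \<in> carrier Z")
        case True
        then have hz: "h z \<in> smooth_maps X Y" using smooth_mapsD(2)[of h Z "exp_dspace X Y"] h by simp
        have "h z x = f (z, x)" if x: "x \<in> carrier X" for x
        proof -
          have "compose (carrier Z \<times> carrier X) (eval_map X Y) (map_prod h (\<lambda>x. x)) (z, x) = f (z, x)"
            using h by simp
          then show ?thesis using hz x True by (simp add: compose_def eval_map_def)
        qed
        moreover have "h z \<in> extensional (carrier X)" using smooth_mapsD(1)[OF hz] by (simp add: PiE_iff)
        ultimately show ?thesis using True by (auto simp: fun_eq_iff extensional_def)
      next
        case False
        then show ?thesis
          using h smooth_mapsD(1)[of h Z "exp_dspace X Y"] by (simp add: PiE_iff extensional_def)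
      qed
    qed
  qed
qed

theorem theorem26:
  shows "is_terminal TYPE('c) unit_dspace \<and>
    (\<forall>(X :: 'a dspace) \<in> FDlg. \<forall>(Y :: 'b dspace) \<in> FDlg.
       is_product TYPE('c) X Y (prod_dspace X Y)
         (restrict fst (carrier X \<times> carrier Y)) (restrict snd (carrier X \<times> carrier Y)) \<and>
       is_exponential TYPE('c) X Y (exp_dspace X Y) (eval_map X Y))"
  by (intro conjI ballI is_terminal_unit_dspace is_product_prod_dspace is_exponential_exp_dspace)

end
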